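(* Let $\vec\beta$ be in the high temperature (sub-critical) phase. Let $m=m(n)$ be any sequence of positive integers with $m\to\infty$ and $m=o(n)$ as $n\to\infty$. For each $n$, consider any set of $m$ different edges $i_1,\dots,i_m\in E(K_n)$ no two of which share a vertex (the set may depend on $n$), and let $X=(X_e)_{e\in E(K_n)}$ have law $\mathrm{ERGM}(\vec\beta)$ on $\mathcal G_n$. Then, as $n\to\infty$, $$\frac{X_{i_1}+\cdots+X_{i_m}-\mathbb E[X_{i_1}+\cdots+X_{i_m}]}{\sqrt{\mathrm{Var}(X_{i_1}+\cdots+X_{i_m})}}\xrightarrow{d}N(0,1),$$ where $\xrightarrow{d}$ denotes weak convergence (convergence in distribution).
   Context: Configurations. $\mathcal G_n$ is the set of simple graphs on vertex set $\{1,\dots,n\}$, identified with $\{0,1\}^M$, $M=n(n-1)/2$, with coordinates indexed by the edges of the complete graph $K_n$: $x=(x_e)_{e\in E(K_n)}$, $x_e=1$ iff $e$ is present. ERGM. Fix $s\ge1$, finite simple graphs $G_1,\dots,G_s$ with $|V_i|$ vertices and $|E_i|$ edges, and $\vec\beta=(\beta_1,\dots,\beta_s)$ with all $\beta_i>0$ (all independent of $n$). For a graph $G$, $N_G(x)=\sum_{\psi}\prod_{(v,w)\in E(G)}x_{(\psi(v),\psi(w))}$, the sum over all injective $\psi:V(G)\to\{1,\dots,n\}$. The Hamiltonian is $H(x)=\sum_{i=1}^s\beta_i N_{G_i}(x)/n^{|V_i|-2}$, and $\mathrm{ERGM}(\vec\beta)$ is the probability measure $\pi=\pi_n$ on $\mathcal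 G_n$ with $\pi(x)\propto e^{H(x)}$. High temperature phase. Let $\Phi(u)=e^u/(1+e^u)$ and, for $p>0$, $\Psi_{\vec\beta}(p)=\sum_{i=1}^s2\beta_i|E_i|p^{|E_i|-1}$ and $\varphi_{\vec\beta}(p)=\Phi(\Psi_{\vec\beta}(p))$. $\vec\beta$ is in the high temperature (sub-critical) phase if $\varphi_{\vec\beta}(p)=p$ has a unique solution $p^*$ and $\varphi_{\vec\beta}'(p^* )<1$. *)

theory Defs
  imports "HOL-Probability.Probability"
begin

definition edges_on :: "'v set \<Rightarrow> 'v set set" where
  "edges_on V = {e. e \<subseteq> V \<and> card e = 2}"

type_synonym 'v graph = "'v set \<times> 'v set set"

abbreviation verts :: "'v graph \<Rightarrow> 'v set" where
  "verts G \<equiv> fst G"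

abbreviation edges :: "'v graph \<Rightarrow> 'v set set" where
  "edges G \<equiv> snd G"

definition finite_simple_graph :: "'v graph \<Rightarrow> bool" where
  "finite_simple_graph G \<longleftrightarrow> finite (verts G) \<and> edges G \<subseteq> edges_on (verts G)"

abbreviation complete_edges :: "nat \<Rightarrow> nat set set" where
  "complete_edges n \<equiv> edges_on {1..n}"

text \<open>A simple graph on \<open>{1..n}\<close> is given by its edge indicators, as an extensional function
  from the edges of the complete graph to \<open>{0, 1}\<close>.\<close>

type_synonym config = "nat set \<Rightarrow> real"

definition configs :: "nat \<Rightarrow> config set" where
  "configs n = complete_edges n \<rightarrow>\<^sub>E {0, 1}"

text \<open>For an edge \<open>e = {v, w}\<close>, the image \<open>\<psi> ` e\<close> is \<open>{\<psi> v, \<psi> w}\<close>. Injections are taken to be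
  extensional, so that each injection of the vertex set is counted once.\<close>

definition subgraph_count :: "'v graph \<Rightarrow> nat \<Rightarrow> config \<Rightarrow> real" where
  "subgraph_count G n x =
     (\<Sum>\<psi> \<in> {\<psi> \<in> verts G \<rightarrow>\<^sub>E {1..n}. inj_on \<psi> (verts G)}. \<Prod>e\<in>edges G. x (\<psi> ` e))"

text \<open>The exponent is an integer, since a graph with a single vertex gives \<open>-1\<close>.\<close>

definition hamiltonian ::
  "nat \<Rightarrow> (nat \<Rightarrow> real) \<Rightarrow> (nat \<Rightarrow> 'v graph) \<Rightarrow> nat \<Rightarrow> config \<Rightarrow> real" where
  "hamiltonian s \<beta> G n x =
     (\<Sum>i=1..s. \<beta> i * subgraph_count (G i) n x / real n powi (int (card (verts (G i))) - 2))"

definition ergm ::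
  "nat \<Rightarrow> (nat \<Rightarrow> real) \<Rightarrow> (nat \<Rightarrow> 'v graph) \<Rightarrow> nat \<Rightarrow> config measure" where
  "ergm s \<beta> G n = point_measure (configs n)
     (\<lambda>x. ennreal (exp (hamiltonian s \<beta> G n x) / (\<Sum>y\<in>configs n. exp (hamiltonian s \<beta> G n y))))"

definition Phi :: "real \<Rightarrow> real" where
  "Phi u = exp u / (1 + exp u)"

text \<open>For \<open>card (edges (G i)) = 0\<close> the truncated exponent is harmless: the summand is \<open>0\<close>.\<close>

definition Psi :: "nat \<Rightarrow> (nat \<Rightarrow> real) \<Rightarrow> (nat \<Rightarrow> 'v graph) \<Rightarrow> real \<Rightarrow> real" where
  "Psi s \<beta> G p =
     (\<Sum>i=1..s. 2 * \<beta> i * real (card (edges (G i))) * p ^ (card (edges (G i)) - 1))"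

definition phi :: "nat \<Rightarrow> (nat \<Rightarrow> real) \<Rightarrow> (nat \<Rightarrow> 'v graph) \<Rightarrow> real \<Rightarrow> real" where
  "phi s \<beta> G p = Phi (Psi s \<beta> G p)"

definition high_temperature :: "nat \<Rightarrow> (nat \<Rightarrow> real) \<Rightarrow> (nat \<Rightarrow> 'v graph) \<Rightarrow> bool" where
  "high_temperature s \<beta> G \<longleftrightarrow>
     (\<exists>p>0. phi s \<beta> G p = p \<and> (\<forall>q>0. phi s \<beta> G q = q \<longrightarrow> q = p) \<and> deriv (phi s \<beta> G) p < 1)"

lemma finite_edges_on: "finite V \<Longrightarrow> finite (edges_on V)"
  by (rule finite_subset[of _ "Pow V"]) (auto simp: edges_on_def)

lemma finite_configs: "finite (configs n)"
  unfolding configs_def by (intro finite_PiE finite_edges_on) auto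

lemma configs_nonempty: "configs n \<noteq> {}"
  by (simp add: configs_def PiE_eq_empty_iff)

lemma prob_space_ergm: "prob_space (ergm s \<beta> G n)"
proof -
  let ?w = "\<lambda>x. exp (hamiltonian s \<beta> G n x)"
  have "0 < (\<Sum>y\<in>configs n. ?w y)"
    by (intro sum_pos finite_configs configs_nonempty) auto
  then have "(\<Sum>x\<in>configs n. ennreal (?w x / (\<Sum>y\<in>configs n. ?w y))) = 1"
    by (subst sum_ennreal) (auto simp: sum_nonneg simp flip: sum_divide_distrib)
  then show ?thesis
    unfolding ergm_def
    by (intro prob_spaceI) (simp add: space_point_measure emeasure_point_measure_finite finite_configs)
qed

lemma sets_ergm: "sets (ergm s \<beta> G n) = Pow (configs n)"
  by (simp add: ergm_def sets_point_measure)

end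

theory Submission
  imports Defs
begin

text \<open>By ferromagnetism the edge indicators are positively associated (FKG), so Newman's inequality
  bounds the distance between the characteristic function of the sum and the product of the
  marginal ones by \<open>2 t\<^sup>2\<close> times the sum of the covariances. It therefore suffices that
  disjoint edges have covariance \<open>O(1/n)\<close>, since then the normalised error is \<open>O(m/n)\<close>.

  By exchangeability this follows once the number of edges has variance \<open>O(n\<^sup>3)\<close>. Resampling the
  edges one by one compares the Gibbs measure with a product measure of parameter \<open>Phi u\<close>,
  with an error governed by the mean excess of the local fields over \<open>u\<close>. Hence an excess of order
  \<open>1/n\<close> over \<open>u\<close> propagates to every threshold above \<open>Psi (Phi u)\<close>; iterating from above and from
  below, uniqueness of the fixed point confines the local fields to any neighbourhood of it, up to
  \<open>O(1/n)\<close> in mean. There the conditional edge probabilities have total slope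
  \<open>phi' p < 1\<close>, and the covariance of the number of edges with itself is contracted.\<close>

section \<open>The four functions theorem and positive association\<close>

text \<open>The rate \<open>1/n\<close> is dictated by Newman's bound: after normalisation it is of
  order \<open>k * m\<close> for covariances at most \<open>k\<close>, so for \<open>m\<close> only
  just below \<open>n\<close> mere decay of covariances would not do. The obstacle is to reach this
  rate without exponential concentration. The excess
  \<open>max 0 (\<sigma> * (F - \<kappa>))\<close> is the controlled quantity for three reasons. It
  is monotone, with influences no larger than those of \<open>F\<close>, so the comparison with
  independent edges applies to it again. Under independent edges a second moment is enough, since
  \<open>z - g \<le> z\<^sup>2 / (4 * g)\<close> turns a variance of order \<open>1/n\<close> and a
  fixed gap \<open>g\<close> into a mean of order \<open>1/n\<close>. And it is just what must be
  added to a linear bound to make a difference of observables increasing; it is then paid for in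
  first moment: \<open>n\<^sup>2\<close> edges with excess \<open>1/n\<close> each, against an edge
  count of at most \<open>n\<^sup>2\<close>, cost \<open>n\<^sup>3\<close>, the order allowed. The
  edge count suffices because pair covariances are nonnegative and cannot cancel, while there are
  about \<open>n ^ 4\<close> disjoint pairs.\<close>

lemma sum_Pow_insert:
  fixes f :: "'a set \<Rightarrow> 'b::comm_monoid_add"
  assumes "finite E" "a \<notin> E"
  shows "sum f (Pow (insert a E)) = (\<Sum>A\<in>Pow E. f A + f (insert a A))"
proof -
  have "sum f (Pow (insert a E)) = sum f (Pow E) + sum f (insert a ` Pow E)"
    unfolding Pow_insert using assms by (intro sum.union_disjoint) auto
  also have "sum f (insert a ` Pow E) = (\<Sum>A\<in>Pow E. f (insert a A))"
  proof (subst sum.reindex)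
    show "inj_on (insert a) (Pow E)"
      using assms by (auto intro!: inj_onI simp: insert_ident)
  qed (simp add: o_def)
  finally show ?thesis by (simp add: sum.distrib)
qed

text \<open>The one-point case of the four functions theorem. Products with equal indices are
  bounded directly; the mixed ones, \<open>P\<close> and \<open>Q\<close>, are at most
  \<open>u\<close> and satisfy \<open>P * Q \<le> u * (c0 * d1)\<close>, so
  \<open>(u - P) * (u - Q) \<ge> 0\<close> yields \<open>P + Q \<le> u + c0 * d1\<close>.\<close>

lemma four_numbers:
  fixes a0 a1 b0 b1 c0 c1 d0 d1 :: real
  assumes nn: "0 \<le> a0" "0 \<le> a1" "0 \<le> b0" "0 \<le> b1" "0 \<le> c0" "0 \<le> c1" "0 \<le> d0" "0 \<le> d1"
    and le: "a0 * b0 \<le> c0 * d0" "a0 * b1 \<le> c1 * d0" "a1 * b0 \<le> c1 * d0" "a1 * b1 \<le> c1 * d1"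
  shows "(a0 + a1) * (b0 + b1) \<le> (c0 + c1) * (d0 + d1)"
proof -
  define u P Q where "u = c1 * d0" and "P = a0 * b1" and "Q = a1 * b0"
  have u: "0 \<le> u" "P \<le> u" "Q \<le> u" "0 \<le> P" "0 \<le> Q"
    using nn le by (auto simp: u_def P_def Q_def)
  have "P + Q \<le> u + c0 * d1"
  proof (cases "u = 0")
    case True
    then show ?thesis using u nn by auto
  next
    case False
    have "P * Q = (a0 * b0) * (a1 * b1)" by (simp add: P_def Q_def)
    also have "\<dots> \<le> (c0 * d0) * (c1 * d1)" using nn by (intro mult_mono[OF le(1) le(4)]) auto
    finally have PQ: "P * Q \<le> u * (c0 * d1)" by (simp add: u_def algebra_simps)
    have "0 \<le> (u - P) * (u - Q)" using u by simp
    then have "u * (P + Q) \<le> u * u + P * Q" by (simp add: algebra_simps)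
    also have "\<dots> \<le> u * (u + c0 * d1)" using PQ by (simp add: algebra_simps)
    finally show ?thesis using u False by simp
  qed
  then show ?thesis using le by (simp add: u_def P_def Q_def algebra_simps)
qed

text \<open>The Ahlswede--Daykin theorem. Summing out one element preserves the hypothesis, by the
  one-point case at each pair of sets, so the ground set shrinks element by element while the four
  functions change.\<close>

theorem four_functions:
  fixes \<alpha> \<beta> \<gamma> \<delta> :: "'a set \<Rightarrow> real"
  assumes "finite E"
    and "\<And>A. A \<subseteq> E \<Longrightarrow> 0 \<le> \<alpha> A" "\<And>A. A \<subseteq> E \<Longrightarrow> 0 \<le> \<beta> A"
    and "\<And>A. A \<subseteq> E \<Longrightarrow> 0 \<le> \<gamma> A" "\<And>A. A \<subseteq> E \<Longrightarrow> 0 \<le> \<delta> A"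
    and "\<And>A B. A \<subseteq> E \<Longrightarrow> B \<subseteq> E \<Longrightarrow> \<alpha> A * \<beta> B \<le> \<gamma> (A \<union> B) * \<delta> (A \<inter> B)"
  shows "sum \<alpha> (Pow E) * sum \<beta> (Pow E) \<le> sum \<gamma> (Pow E) * sum \<delta> (Pow E)"
  using assms
proof (induction E arbitrary: \<alpha> \<beta> \<gamma> \<delta> rule: finite_induct)
  case empty
  then show ?case by simp
next
  case (insert a E)
  note nn = insert.prems(1-4) and le = insert.prems(5)
  define f where "f = (\<lambda>(\<alpha>::'a set \<Rightarrow> real) A. \<alpha> A + \<alpha> (insert a A))"
  have "sum (f \<alpha>) (Pow E) * sum (f \<beta>) (Pow E) \<le> sum (f \<gamma>) (Pow E) * sum (f \<delta>) (Pow E)"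
  proof (rule insert.IH)
    fix A B assume AB: "A \<subseteq> E" "B \<subseteq> E"
    have sub: "A \<subseteq> insert a E" "B \<subseteq> insert a E" "insert a A \<subseteq> insert a E" "insert a B \<subseteq> insert a E"
      "A \<union> B \<subseteq> insert a E" "A \<inter> B \<subseteq> insert a E" "insert a (A \<union> B) \<subseteq> insert a E"
      "insert a (A \<inter> B) \<subseteq> insert a E"
      using AB by auto
    have a: "A \<inter> insert a B = A \<inter> B" "insert a A \<inter> B = A \<inter> B"
      using insert.hyps AB by auto
    show "f \<alpha> A * f \<beta> B \<le> f \<gamma> (A \<union> B) * f \<delta> (A \<inter> B)"
      unfolding f_def
      using le[OF sub(1) sub(2)] le[OF sub(1) sub(4)] le[OF sub(3) sub(2)] le[OF sub(3) sub(4)]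
      by (intro four_numbers nn sub) (simp_all add: a)
  next
    fix A assume "A \<subseteq> E"
    then have s: "A \<subseteq> insert a E" "insert a A \<subseteq> insert a E" by auto
    show "0 \<le> f \<alpha> A" "0 \<le> f \<beta> A" "0 \<le> f \<gamma> A" "0 \<le> f \<delta> A"
      unfolding f_def by (intro add_nonneg_nonneg nn s)+
  qed
  then show ?case
    by (simp add: sum_Pow_insert insert.hyps f_def)
qed

section \<open>Expectation and covariance for finite Gibbs measures\<close>

locale gibbs =
  fixes E :: "'e set" and H :: "'e set \<Rightarrow> real"
  assumes finite_E [simp, intro]: "finite E"
begin

definition pr :: "'e set \<Rightarrow> real" where
  "pr A = exp (H A) / (\<Sum>B\<in>Pow E. exp (H B))"

text \<open>Vector valued, so that one calculus covers real observables and complex characteristic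
  functions.\<close>

definition ex :: "('e set \<Rightarrow> 'b::real_normed_vector) \<Rightarrow> 'b" where
  "ex f = (\<Sum>A\<in>Pow E. pr A *\<^sub>R f A)"

definition cov :: "('e set \<Rightarrow> real) \<Rightarrow> ('e set \<Rightarrow> real) \<Rightarrow> real" where
  "cov f g = ex (\<lambda>A. f A * g A) - ex f * ex g"

lemma Z_pos: "0 < (\<Sum>B\<in>Pow E. exp (H B))"
  by (intro sum_pos) auto

lemma pr_pos: "0 < pr A"
  using Z_pos by (simp add: pr_def)

lemma sum_pr: "(\<Sum>A\<in>Pow E. pr A) = 1"
  using Z_pos by (simp add: pr_def flip: sum_divide_distrib)

lemma ex_cong: "(\<And>A. A \<subseteq> E \<Longrightarrow> f A = g A) \<Longrightarrow> ex f = ex g"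
  unfolding ex_def by (intro sum.cong) auto

lemma ex_add: "ex (\<lambda>A. f A + g A) = ex f + ex g"
  by (simp add: ex_def scaleR_add_right sum.distrib)

lemma ex_diff: "ex (\<lambda>A. f A - g A) = ex f - ex g"
  by (simp add: ex_def scaleR_diff_right sum_subtractf)

lemma ex_cmult: "ex (\<lambda>A. c * f A) = c * ex f"
  for c :: "'b::real_normed_algebra"
  by (simp add: ex_def sum_distrib_left)

lemma ex_cmult_right: "ex (\<lambda>A. f A * c) = ex f * c"
  for c :: "'b::real_normed_algebra"
  by (simp add: ex_def sum_distrib_right)

lemma ex_const: "ex (\<lambda>A. c) = c"
  by (simp add: ex_def sum_pr flip: scaleR_sum_left)

lemma ex_sum: "ex (\<lambda>A. \<Sum>i\<in>K. f i A) = (\<Sum>i\<in>K. ex (f i))"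
  unfolding ex_def by (simp add: scaleR_sum_right) (rule sum.swap)

lemma ex_mono:
  fixes f g :: "'e set \<Rightarrow> real"
  shows "(\<And>A. A \<subseteq> E \<Longrightarrow> f A \<le> g A) \<Longrightarrow> ex f \<le> ex g"
  unfolding ex_def by (intro sum_mono) (auto intro!: mult_left_mono less_imp_le[OF pr_pos])

lemma ex_le_const:
  fixes f :: "'e set \<Rightarrow> real"
  shows "(\<And>A. A \<subseteq> E \<Longrightarrow> f A \<le> c) \<Longrightarrow> ex f \<le> c"
  using ex_mono[of f "\<lambda>_. c"] by (simp add: ex_const)

lemma ex_ge_const:
  fixes f :: "'e set \<Rightarrow> real"
  shows "(\<And>A. A \<subseteq> E \<Longrightarrow> c \<le> f A) \<Longrightarrow> c \<le> ex f"
  using ex_mono[of "\<lambda>_. c" f] by (simp add: ex_const)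

lemma norm_ex_le: "norm (ex f) \<le> ex (\<lambda>A. norm (f A))"
  unfolding ex_def by (rule order_trans[OF norm_sum]) (simp add: less_imp_le[OF pr_pos])

lemma Re_ex: "Re (ex f) = ex (\<lambda>A. Re (f A))"
  by (simp add: ex_def)

lemma Im_ex: "Im (ex f) = ex (\<lambda>A. Im (f A))"
  by (simp add: ex_def)

lemma cov_diff_left: "cov (\<lambda>A. f A - g A) h = cov f h - cov g h"
  by (simp add: cov_def ex_diff left_diff_distrib)

lemma cov_add_left: "cov (\<lambda>A. f A + g A) h = cov f h + cov g h"
  by (simp add: cov_def ex_add distrib_right)

lemma cov_cmult_left: "cov (\<lambda>A. c * f A) h = c * cov f h"
  by (simp add: cov_def ex_cmult mult.assoc right_diff_distrib)

lemma cov_const_left: "cov (\<lambda>A. c) h = 0"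
  by (simp add: cov_def ex_cmult ex_const)

lemma cov_commute: "cov f g = cov g f"
  by (simp add: cov_def mult.commute)

lemma cov_sum_left: "cov (\<lambda>A. \<Sum>i\<in>K. f i A) h = (\<Sum>i\<in>K. cov (f i) h)"
  by (simp add: cov_def ex_sum sum_distrib_right sum_subtractf)

lemma cov_sum_right: "cov h (\<lambda>A. \<Sum>i\<in>K. f i A) = (\<Sum>i\<in>K. cov h (f i))"
  by (subst (1 2) cov_commute) (rule cov_sum_left)

text \<open>The factor 2 covers the product moment and the product of the means. This is how
  corrections that are small only in first moment are paid for.\<close>

lemma cov_le_ex_abs:
  assumes "\<And>A. A \<subseteq> E \<Longrightarrow> \<bar>g A\<bar> \<le> b"
  shows "cov f g \<le> 2 * b * ex (\<lambda>A. \<bar>f A\<bar>)"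
proof -
  have "ex (\<lambda>A. f A * g A) \<le> ex (\<lambda>A. \<bar>f A\<bar> * b)"
  proof (rule ex_mono)
    fix A assume "A \<subseteq> E"
    have "f A * g A \<le> \<bar>f A\<bar> * \<bar>g A\<bar>" by (metis abs_ge_self abs_mult)
    also have "\<dots> \<le> \<bar>f A\<bar> * b" using assms[OF \<open>A \<subseteq> E\<close>] by (intro mult_left_mono) auto
    finally show "f A * g A \<le> \<bar>f A\<bar> * b" .
  qed
  moreover have "\<bar>ex f\<bar> \<le> ex (\<lambda>A. \<bar>f A\<bar>)" using norm_ex_le[of f] by simp
  moreover have "\<bar>ex g\<bar> \<le> b"
  proof -
    have "\<bar>ex g\<bar> \<le> ex (\<lambda>A. \<bar>g A\<bar>)" using norm_ex_le[of g] by simp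
    also have "\<dots> \<le> b" by (intro ex_le_const assms)
    finally show ?thesis .
  qed
  then have "\<bar>ex f\<bar> * \<bar>ex g\<bar> \<le> ex (\<lambda>A. \<bar>f A\<bar>) * b"
    using \<open>\<bar>ex f\<bar> \<le> _\<close> by (intro mult_mono) auto
  moreover have "- (ex f * ex g) \<le> \<bar>ex f\<bar> * \<bar>ex g\<bar>"
    by (metis abs_ge_minus_self abs_mult)
  ultimately show ?thesis
    unfolding cov_def ex_cmult_right by (simp add: mult.commute)
qed

end

text \<open>Supermodularity of \<open>H\<close> is the FKG lattice condition for the weights
  \<open>exp (H A)\<close>.\<close>

locale ferromagnetic_gibbs = gibbs E H for E :: "'e set" and H +
  assumes supermodular: "\<And>A B. A \<subseteq> E \<Longrightarrow> B \<subseteq> E \<Longrightarrow> H A + H B \<le> H (A \<union> B) + H (A \<inter> B)"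
begin

text \<open>The four functions are \<open>pr\<close> times \<open>f'\<close>, \<open>pr\<close>
  times \<open>g'\<close>, \<open>pr\<close> times \<open>f' * g'\<close>, and \<open>pr\<close>:
  the lattice condition for \<open>pr\<close> and the monotonicity of \<open>f'\<close> and
  \<open>g'\<close> multiply. Subtracting the values at \<open>{}\<close> makes the functions
  nonnegative and does not change the covariance.\<close>

theorem cov_nonneg:
  assumes "mono_on (Pow E) f" "mono_on (Pow E) g"
  shows "0 \<le> cov f g"
proof -
  define f' g' where "f' = (\<lambda>A. f A - f {})" and "g' = (\<lambda>A. g A - g {})"
  have f'0: "0 \<le> f' A" "0 \<le> g' A" if "A \<subseteq> E" for A
    using that assms by (auto simp: f'_def g'_def mono_on_def)
  have mono: "f' A \<le> f' B" "g' A \<le> g' B" if "A \<subseteq> B" "B \<subseteq> E" for A B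
    using that assms by (auto simp: f'_def g'_def mono_on_def)
  have "(\<Sum>A\<in>Pow E. pr A * f' A) * (\<Sum>A\<in>Pow E. pr A * g' A)
      \<le> (\<Sum>A\<in>Pow E. pr A * (f' A * g' A)) * (\<Sum>A\<in>Pow E. pr A)"
  proof (rule four_functions)
    fix A B assume AB: "A \<subseteq> E" "B \<subseteq> E"
    define Z where "Z = (\<Sum>B\<in>Pow E. exp (H B))"
    have "pr A * pr B = exp (H A + H B) / (Z * Z)" by (simp add: pr_def exp_add Z_def)
    also have "\<dots> \<le> exp (H (A \<union> B) + H (A \<inter> B)) / (Z * Z)"
      using supermodular[OF AB] by (intro divide_right_mono) auto
    finally have 1: "pr A * pr B \<le> pr (A \<union> B) * pr (A \<inter> B)"
      by (simp add: pr_def exp_add Z_def)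
    have 2: "f' A * g' B \<le> f' (A \<union> B) * g' (A \<union> B)"
      using AB by (intro mult_mono mono f'0) auto
    have "(pr A * pr B) * (f' A * g' B) \<le> (pr (A \<union> B) * pr (A \<inter> B)) * (f' (A \<union> B) * g' (A \<union> B))"
      using AB by (intro mult_mono 1 2 mult_nonneg_nonneg f'0 less_imp_le[OF pr_pos]) auto
    then show "pr A * f' A * (pr B * g' B) \<le> pr (A \<union> B) * (f' (A \<union> B) * g' (A \<union> B)) * pr (A \<inter> B)"
      by (simp add: mult_ac)
  qed (auto intro!: mult_nonneg_nonneg f'0 less_imp_le[OF pr_pos])
  then have "0 \<le> cov f' g'"
    by (simp add: sum_pr cov_def ex_def)
  also have "cov f' g' = cov f g"
    by (simp add: f'_def g'_def cov_diff_left cov_const_left cov_commute[of _ "\<lambda>A. g A - g {}"]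
        cov_commute[of g])
  finally show ?thesis .
qed

text \<open>The form in which positive association is used below: against an increasing
  \<open>h\<close>, covariances are compared through the increments of \<open>f\<close> and
  \<open>g\<close>, not through their values.\<close>

lemma cov_mono_left:
  assumes "mono_on (Pow E) (\<lambda>A. g A - f A)" "mono_on (Pow E) h"
  shows "cov f h \<le> cov g h"
  using cov_nonneg[OF assms] by (simp add: cov_diff_left)

end

section \<open>Comparison with product measures\<close>

definition smooth1 :: "real \<Rightarrow> 'a \<Rightarrow> ('a set \<Rightarrow> real) \<Rightarrow> 'a set \<Rightarrow> real" where
  "smooth1 q a f A = q * f (insert a A) + (1 - q) * f (A - {a})"

text \<open>Once \<open>as\<close> exhausts the ground set, \<open>smooth q as f\<close> is constant and equal to the
  expectation of \<open>f\<close> under independent Bernoulli coordinates with parameter \<open>q\<close>.\<close>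

primrec smooth :: "real \<Rightarrow> 'a list \<Rightarrow> ('a set \<Rightarrow> real) \<Rightarrow> 'a set \<Rightarrow> real" where
  "smooth q [] f = f"
| "smooth q (a # as) f = smooth q as (smooth1 q a f)"

text \<open>The sign \<open>\<sigma>\<close>, 1 or -1, marks an increasing or a decreasing function,
  so that excesses above and below a threshold share their proofs.\<close>

definition influence :: "real \<Rightarrow> ('a \<Rightarrow> real) \<Rightarrow> ('a set \<Rightarrow> real) \<Rightarrow> bool" where
  "influence \<sigma> c f \<longleftrightarrow>
     (\<forall>e A. 0 \<le> \<sigma> * (f (insert e A) - f (A - {e})) \<and> \<sigma> * (f (insert e A) - f (A - {e})) \<le> c e)"

lemma smooth_add: "smooth q as (\<lambda>A. f A + g A) = (\<lambda>A. smooth q as f A + smooth q as g A)"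
proof (induction as arbitrary: f g)
  case (Cons a as)
  have "smooth1 q a (\<lambda>A. f A + g A) = (\<lambda>A. smooth1 q a f A + smooth1 q a g A)"
    by (auto simp: smooth1_def algebra_simps)
  then show ?case using Cons by simp
qed simp

lemma smooth_cmult: "smooth q as (\<lambda>A. k * f A) = (\<lambda>A. k * smooth q as f A)"
proof (induction as arbitrary: f)
  case (Cons a as)
  have "smooth1 q a (\<lambda>A. k * f A) = (\<lambda>A. k * smooth1 q a f A)"
    by (auto simp: smooth1_def algebra_simps)
  then show ?case using Cons by simp
qed simp

lemma smooth_const: "smooth q as (\<lambda>A. k) = (\<lambda>A. k)"
proof (induction as)
  case (Cons a as)
  have "smooth1 q a (\<lambda>A. k) = (\<lambda>A. k)"
    by (auto simp: smooth1_def algebra_simps)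
  then show ?case using Cons by simp
qed simp

lemma smooth_sum:
  "finite K \<Longrightarrow> smooth q as (\<lambda>A. \<Sum>k\<in>K. f k A) = (\<lambda>A. \<Sum>k\<in>K. smooth q as (f k) A)"
  by (induction K rule: finite_induct) (auto simp: smooth_const smooth_add)

lemma smooth_mono:
  assumes "0 \<le> q" "q \<le> 1" "\<And>A. f A \<le> g A"
  shows "smooth q as f A \<le> smooth q as g A"
  using assms(3)
proof (induction as arbitrary: f g)
  case (Cons a as)
  have "smooth1 q a f A \<le> smooth1 q a g A" for A
    unfolding smooth1_def using assms(1,2) Cons.prems by (intro add_mono mult_left_mono) auto
  then show ?case using Cons.IH by simp
qed simp

text \<open>The part of \<open>D\<close> not yet averaged stays as a condition on \<open>A\<close>,
  which makes the induction over \<open>as\<close> work. Once \<open>as\<close> covers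
  \<open>D\<close> only the product probability \<open>q ^ card D\<close> is left.\<close>

lemma smooth_subset_indicator:
  assumes "finite D" "distinct as"
  shows "smooth q as (\<lambda>A. of_bool (D \<subseteq> A)) =
    (\<lambda>A. q ^ card (D \<inter> set as) * of_bool (D - set as \<subseteq> A))"
  using assms
proof (induction as arbitrary: D)
  case (Cons a as)
  show ?case
  proof (cases "a \<in> D")
    case True
    have "smooth1 q a (\<lambda>A. of_bool (D \<subseteq> A)) = (\<lambda>A. q * of_bool (D - {a} \<subseteq> A))"
      using True by (auto simp: smooth1_def fun_eq_iff)
    moreover have "D \<inter> set (a # as) = insert a ((D - {a}) \<inter> set as)"
      using True by auto
    then have "card (D \<inter> set (a # as)) = Suc (card ((D - {a}) \<inter> set as))"
      using Cons.prems by simp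
    moreover have "D - set (a # as) = D - {a} - set as" by auto
    ultimately show ?thesis
      using Cons.IH[of "D - {a}"] Cons.prems by (simp add: smooth_cmult mult.assoc)
  next
    case False
    have "smooth1 q a (\<lambda>A. of_bool (D \<subseteq> A)) = (\<lambda>A. of_bool (D \<subseteq> A))"
      using False by (auto simp: smooth1_def fun_eq_iff of_bool_def)
    moreover have "D \<inter> set (a # as) = D \<inter> set as" "D - set (a # as) = D - set as"
      using False by auto
    ultimately show ?thesis
      using Cons by simp
  qed
qed (auto simp: fun_eq_iff)

text \<open>Smoothing in \<open>a\<close> averages the jumps in every other coordinate and makes the
  jump in \<open>a\<close> itself vanish.\<close>

lemma influence_smooth1:
  assumes "influence \<sigma> c f" "0 \<le> q" "q \<le> 1"
  shows "influence \<sigma> c (smooth1 q a f)"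
  unfolding influence_def
proof (intro allI)
  fix e A
  define d where "d = (\<lambda>A. \<sigma> * (f (insert e A) - f (A - {e})))"
  have d: "0 \<le> d A" "d A \<le> c e" for A
    using assms(1) by (auto simp: influence_def d_def)
  have c: "0 \<le> c e" using d[of A] by simp
  show "0 \<le> \<sigma> * (smooth1 q a f (insert e A) - smooth1 q a f (A - {e})) \<and>
    \<sigma> * (smooth1 q a f (insert e A) - smooth1 q a f (A - {e})) \<le> c e"
  proof (cases "e = a")
    case True
    have "smooth1 q a f (insert e A) = smooth1 q a f (A - {e})"
      by (simp add: smooth1_def True)
    then show ?thesis using c by simp
  next
    case False
    have "insert a (A - {e}) = insert a A - {e}" "insert e A - {a} = insert e (A - {a})"
      "A - {e} - {a} = A - {a} - {e}" "insert a (insert e A) = insert e (insert a A)"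
      using False by auto
    then have eq: "\<sigma> * (smooth1 q a f (insert e A) - smooth1 q a f (A - {e}))
        = q * d (insert a A) + (1 - q) * d (A - {a})"
      by (simp add: smooth1_def d_def algebra_simps)
    have "q * d (insert a A) + (1 - q) * d (A - {a}) \<le> q * c e + (1 - q) * c e"
      using assms(2,3) d by (intro add_mono mult_left_mono) auto
    moreover have "0 \<le> q * d (insert a A) + (1 - q) * d (A - {a})"
      using assms(2,3) d by (intro add_nonneg_nonneg mult_nonneg_nonneg) auto
    ultimately show ?thesis
      unfolding eq by (simp add: algebra_simps)
  qed
qed

text \<open>Tensorisation of the variance: averaging out one coordinate adds at most the Bernoulli
  variance \<open>q * (1 - q) * (x - y)\<^sup>2 \<le> (c a)\<^sup>2 / 4\<close>, and the averaged
  function keeps its influences.\<close>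

lemma efron_stein_smooth:
  assumes "influence \<sigma> c f" "\<bar>\<sigma>\<bar> = 1" "0 \<le> q" "q \<le> 1"
  shows "smooth q as (\<lambda>A. (f A)\<^sup>2) A \<le> (smooth q as f A)\<^sup>2 + (\<Sum>e\<leftarrow>as. (c e)\<^sup>2) / 4"
  using assms(1)
proof (induction as arbitrary: f)
  case (Cons a as)
  have step: "smooth1 q a (\<lambda>A. (f A)\<^sup>2) A \<le> (smooth1 q a f A)\<^sup>2 + (c a)\<^sup>2 / 4" for A
  proof -
    define x y where "x = f (insert a A)" and "y = f (A - {a})"
    have "\<bar>\<sigma> * (x - y)\<bar> \<le> c a"
      using Cons.prems by (auto simp: influence_def x_def y_def)
    then have "(x - y)\<^sup>2 \<le> (c a)\<^sup>2"
      using assms(2) by (intro abs_le_square_iff[THEN iffD1]) (simp add: abs_mult)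
    moreover have "q * (1 - q) \<le> 1 / 4"
      using sum_squares_ge_zero[of "q - 1/2" 0] by (simp add: power2_eq_square algebra_simps)
    ultimately have "q * (1 - q) * (x - y)\<^sup>2 \<le> 1 / 4 * (c a)\<^sup>2"
      using assms by (intro mult_mono) auto
    moreover have "q * x\<^sup>2 + (1 - q) * y\<^sup>2 = (q * x + (1 - q) * y)\<^sup>2 + q * (1 - q) * (x - y)\<^sup>2"
      by (simp add: power2_eq_square algebra_simps)
    ultimately show ?thesis
      by (simp add: smooth1_def x_def y_def)
  qed
  have "smooth q (a # as) (\<lambda>A. (f A)\<^sup>2) A \<le> smooth q as (\<lambda>A. (smooth1 q a f A)\<^sup>2 + (c a)\<^sup>2 / 4) A"
    using smooth_mono[OF assms(3,4) step] by simp
  also have "\<dots> = smooth q as (\<lambda>A. (smooth1 q a f A)\<^sup>2) A + (c a)\<^sup>2 / 4"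
    by (simp add: smooth_add smooth_const)
  also have "\<dots> \<le> (smooth q as (smooth1 q a f) A)\<^sup>2 + (\<Sum>e\<leftarrow>as. (c e)\<^sup>2) / 4 + (c a)\<^sup>2 / 4"
    using Cons.IH[OF influence_smooth1[OF Cons.prems assms(3,4)]] by simp
  finally show ?case by (simp add: add_divide_distrib)
qed simp

section \<open>The logistic function\<close>

lemma Phi_bounds: "0 < Phi u" "Phi u < 1"
  by (auto simp: Phi_def divide_simps add_pos_pos)

lemma one_minus_Phi: "1 - Phi u = 1 / (1 + exp u)"
proof -
  have "1 + exp u \<noteq> 0" by (metis add_pos_pos exp_gt_zero less_numeral_extra(1) less_irrefl)
  then show ?thesis by (simp add: Phi_def field_simps)
qed

lemma Phi_times: "Phi u * (1 + exp u) = exp u"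
proof -
  have "1 + exp u \<noteq> 0" by (metis add_pos_pos exp_gt_zero less_numeral_extra(1) less_irrefl)
  then show ?thesis by (simp add: Phi_def)
qed

lemma has_real_derivative_Phi: "(Phi has_real_derivative Phi u * (1 - Phi u)) (at u)"
proof -
  have nz: "1 + exp u \<noteq> 0" by (metis add_pos_pos exp_gt_zero less_numeral_extra(1) less_irrefl)
  have "((\<lambda>u. exp u / (1 + exp u)) has_real_derivative
      (exp u * (1 + exp u) - exp u * exp u) / ((1 + exp u) * (1 + exp u))) (at u)"
    using nz by (auto intro!: derivative_eq_intros)
  moreover have "(exp u * (1 + exp u) - exp u * exp u) / ((1 + exp u) * (1 + exp u))
      = Phi u * (1 - Phi u)"
    unfolding one_minus_Phi by (simp add: Phi_def algebra_simps)
  ultimately show ?thesis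
    unfolding Phi_def[abs_def] by simp
qed

lemma isCont_Phi: "isCont Phi u"
  by (rule DERIV_isCont[OF has_real_derivative_Phi])

lemma Phi_mono: "u \<le> v \<Longrightarrow> Phi u \<le> Phi v"
  by (rule DERIV_nonneg_imp_nondecreasing)
    (auto intro!: exI has_real_derivative_Phi mult_nonneg_nonneg less_imp_le[OF Phi_bounds(1)]
       less_imp_le[OF Phi_bounds(2)])

lemma Phi_diff_le: "u \<le> v \<Longrightarrow> Phi v - Phi u \<le> v - u"
proof -
  assume "u \<le> v"
  have "v - Phi v \<ge> u - Phi u"
  proof (rule DERIV_nonneg_imp_nondecreasing[OF \<open>u \<le> v\<close>])
    fix x
    have "Phi x * (1 - Phi x) \<le> 1 * 1"
      using Phi_bounds[of x] by (intro mult_mono) auto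
    then show "\<exists>y. ((\<lambda>u. u - Phi u) has_real_derivative y) (at x) \<and> 0 \<le> y"
      by (intro exI[of _ "1 - Phi x * (1 - Phi x)"])
        (auto intro!: derivative_eq_intros has_real_derivative_Phi)
  qed
  then show ?thesis by simp
qed

section \<open>Ferromagnetic interactions\<close>

text \<open>A ferromagnet with many-body terms: the hyperedge \<open>C j\<close> contributes
  \<open>b j\<close> when it is fully occupied. In the random graph model the hyperedges are the
  labelled copies of the given graphs.\<close>

locale interaction =
  fixes E :: "'e set" and J :: "'j set" and b :: "'j \<Rightarrow> real" and C :: "'j \<Rightarrow> 'e set"
  assumes finite_E': "finite E" and finite_J [simp, intro]: "finite J"
    and b_nonneg: "\<And>j. j \<in> J \<Longrightarrow> 0 \<le> b j" and C_subset: "\<And>j. j \<in> J \<Longrightarrow> C j \<subseteq> E"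
begin

definition Ham :: "'e set \<Rightarrow> real" where
  "Ham A = (\<Sum>j\<in>J. b j * of_bool (C j \<subseteq> A))"

text \<open>The local field: the conditional log odds of \<open>e\<close> given the other
  coordinates.\<close>

definition dH :: "'e \<Rightarrow> 'e set \<Rightarrow> real" where
  "dH e A = (\<Sum>j\<in>{j\<in>J. e \<in> C j}. b j * of_bool (C j - {e} \<subseteq> A))"

text \<open>For \<open>e' \<noteq> e\<close> this is the largest possible influence of
  \<open>e'\<close> on the field \<open>dH e\<close>, reached when all other members of the
  hyperedges are present.\<close>

definition coupling :: "'e \<Rightarrow> 'e \<Rightarrow> real" where
  "coupling e e' = (\<Sum>j\<in>{j\<in>J. e \<in> C j \<and> e' \<in> C j}. b j)"

sublocale ferromagnetic_gibbs E Ham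
proof
  fix A B assume "A \<subseteq> E" "B \<subseteq> E"
  \<comment> \<open>Containment in \<open>A\<close> or in \<open>B\<close> passes to the union and
    containment in both to the intersection, so each hyperedge alone is supermodular.\<close>
  have "b j * of_bool (C j \<subseteq> A) + b j * of_bool (C j \<subseteq> B)
      \<le> b j * of_bool (C j \<subseteq> A \<union> B) + b j * of_bool (C j \<subseteq> A \<inter> B)" if "j \<in> J" for j
    using b_nonneg[OF that] by (auto simp: of_bool_def)
  then show "Ham A + Ham B \<le> Ham (A \<union> B) + Ham (A \<inter> B)"
    unfolding Ham_def by (simp only: flip: sum.distrib) (rule sum_mono, simp)
qed (rule finite_E')

lemma Ham_insert_diff: "Ham (insert e A) - Ham (A - {e}) = dH e A"
proof -
  have "Ham (insert e A) - Ham (A - {e})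
      = (\<Sum>j\<in>J. if e \<in> C j then b j * of_bool (C j - {e} \<subseteq> A) else 0)"
    unfolding Ham_def by (subst sum_subtractf[symmetric], rule sum.cong) auto
  also have "\<dots> = dH e A"
    by (subst sum.inter_filter[symmetric]) (auto simp: dH_def)
  finally show ?thesis .
qed

section \<open>Resampling single coordinates and comparison with independent ones\<close>

lemma dH_insert: "dH e (insert e A) = dH e A"
  unfolding dH_def by (intro sum.cong) (auto simp: of_bool_def)

lemma pr_insert: "e \<notin> A \<Longrightarrow> pr (insert e A) = pr A * exp (dH e A)"
  using Ham_insert_diff[of e A] by (simp add: pr_def flip: exp_add)

text \<open>The Gibbs measure is invariant under redrawing one coordinate from its conditional law:
  within a pair \<open>A\<close>, \<open>insert e A\<close> the weights are in the ratio
  \<open>1 : exp (dH e A)\<close>, and the field is the same on both sets.\<close>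

lemma ex_resample:
  fixes f :: "'e set \<Rightarrow> real"
  assumes "e \<in> E"
  shows "ex f = ex (\<lambda>A. Phi (dH e A) * f (insert e A) + (1 - Phi (dH e A)) * f (A - {e}))"
    (is "_ = ex ?g")
proof -
  have E: "E = insert e (E - {e})" using assms by auto
  have "ex f = (\<Sum>A\<in>Pow (E - {e}). pr A *\<^sub>R f A + pr (insert e A) *\<^sub>R f (insert e A))"
    unfolding ex_def by (subst E, subst sum_Pow_insert) auto
  also have "\<dots> = (\<Sum>A\<in>Pow (E - {e}). pr A *\<^sub>R ?g A + pr (insert e A) *\<^sub>R ?g (insert e A))"
  proof (rule sum.cong)
    fix A assume "A \<in> Pow (E - {e})"
    then have eA: "e \<notin> A" "A - {e} = A" by auto
    define h p where "h = exp (dH e A)" and "p = Phi (dH e A)"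
    have "p * (1 + h) = h" unfolding h_def p_def by (rule Phi_times)
    then have h: "(1 - p) * (1 + h) = 1" by (simp add: algebra_simps)
    have "x + h * y = (1 + h) * (p * y + (1 - p) * x)" for x y
    proof -
      have "(1 + h) * (p * y + (1 - p) * x) = (p * (1 + h)) * y + ((1 - p) * (1 + h)) * x"
        by (simp add: algebra_simps)
      then show ?thesis using h \<open>p * (1 + h) = h\<close> by simp
    qed
    then have "pr A * f A + pr A * h * f (insert e A)
       = pr A * ((1 + h) * (p * f (insert e A) + (1 - p) * f A))"
      by (metis (no_types, opaque_lifting) distrib_left mult.assoc)
    then show "pr A *\<^sub>R f A + pr (insert e A) *\<^sub>R f (insert e A)
       = pr A *\<^sub>R ?g A + pr (insert e A) *\<^sub>R ?g (insert e A)"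
      using eA by (simp add: pr_insert dH_insert algebra_simps h_def p_def)
  qed simp
  also have "\<dots> = ex ?g"
    unfolding ex_def by (subst (3) E, subst sum_Pow_insert) auto
  finally show ?thesis .
qed

text \<open>Redrawing \<open>e\<close> with probability \<open>Phi u\<close> in place of
  \<open>Phi (dH e A)\<close> costs the jump of \<open>f\<close> times
  \<open>Phi (dH e A) - Phi u\<close>. The jump has the sign \<open>\<sigma>\<close>, so only fields
  beyond \<open>u\<close> in the direction \<open>\<sigma>\<close> can raise the bound, and
  \<open>Phi\<close> is 1-Lipschitz.\<close>

lemma ex_le_ex_smooth1:
  assumes "influence \<sigma> c f" "\<bar>\<sigma>\<bar> = 1" "e \<in> E"
  shows "ex f \<le> ex (smooth1 (Phi u) e f) + c e * ex (\<lambda>A. max 0 (\<sigma> * (dH e A - u)))"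
proof -
  have "ex f = ex (\<lambda>A. Phi (dH e A) * f (insert e A) + (1 - Phi (dH e A)) * f (A - {e}))"
    by (rule ex_resample[OF assms(3)])
  also have "\<dots> \<le> ex (\<lambda>A. smooth1 (Phi u) e f A + c e * max 0 (\<sigma> * (dH e A - u)))"
  proof (rule ex_mono)
    fix A assume "A \<subseteq> E"
    define d where "d = f (insert e A) - f (A - {e})"
    define h where "h = dH e A"
    have d: "0 \<le> \<sigma> * d" "\<sigma> * d \<le> c e"
      using assms(1) by (auto simp: influence_def d_def)
    have s: "\<sigma> = 1 \<or> \<sigma> = -1" using assms(2) by auto
    have "\<sigma> * (Phi h - Phi u) \<le> max 0 (\<sigma> * (h - u))"
      using s Phi_mono[of h u] Phi_mono[of u h] Phi_diff_le[of h u] Phi_diff_le[of u h]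
      by (cases "h \<le> u") (auto simp: max_def)
    then have "(\<sigma> * d) * (\<sigma> * (Phi h - Phi u)) \<le> (\<sigma> * d) * max 0 (\<sigma> * (h - u))"
      using d by (intro mult_left_mono) auto
    also have "\<dots> \<le> c e * max 0 (\<sigma> * (h - u))"
      using d by (intro mult_right_mono) auto
    finally have "d * (Phi h - Phi u) \<le> c e * max 0 (\<sigma> * (h - u))"
      using s by (auto simp: algebra_simps)
    then show "Phi (dH e A) * f (insert e A) + (1 - Phi (dH e A)) * f (A - {e})
        \<le> smooth1 (Phi u) e f A + c e * max 0 (\<sigma> * (dH e A - u))"
      by (simp add: smooth1_def d_def h_def algebra_simps)
  qed
  finally show ?thesis by (simp add: ex_add ex_cmult)
qed

text \<open>The outer expectation stays the Gibbs one throughout and smoothing keeps the influences,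
  so each coordinate costs its own \<open>c e\<close> times the Gibbs excess of its field.\<close>

lemma ex_le_ex_smooth:
  assumes "influence \<sigma> c f" "\<bar>\<sigma>\<bar> = 1" "set as \<subseteq> E"
  shows "ex f \<le> ex (smooth (Phi u) as f) + (\<Sum>e\<leftarrow>as. c e * ex (\<lambda>A. max 0 (\<sigma> * (dH e A - u))))"
  using assms(1,3)
proof (induction as arbitrary: f)
  case (Cons a as)
  have "ex f \<le> ex (smooth1 (Phi u) a f) + c a * ex (\<lambda>A. max 0 (\<sigma> * (dH a A - u)))"
    using Cons.prems by (intro ex_le_ex_smooth1 assms) auto
  moreover have "influence \<sigma> c (smooth1 (Phi u) a f)"
    using Cons.prems Phi_bounds[of u] by (intro influence_smooth1) auto
  ultimately show ?case
    using Cons.IH[of "smooth1 (Phi u) a f"] Cons.prems by simp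
qed simp

lemma influence_subset_sum:
  assumes "finite K" "\<And>k. k \<in> K \<Longrightarrow> 0 \<le> a k"
  shows "influence 1 (\<lambda>e. \<Sum>k\<in>{k\<in>K. e \<in> D k}. a k) (\<lambda>A. \<Sum>k\<in>K. a k * of_bool (D k \<subseteq> A))"
  unfolding influence_def
proof (intro allI)
  fix e A
  have "(\<Sum>k\<in>K. a k * of_bool (D k \<subseteq> insert e A)) - (\<Sum>k\<in>K. a k * of_bool (D k \<subseteq> A - {e}))
      = (\<Sum>k\<in>K. if e \<in> D k then a k * of_bool (D k - {e} \<subseteq> A) else 0)"
    by (subst sum_subtractf[symmetric], rule sum.cong) auto
  also have "\<dots> = (\<Sum>k\<in>{k\<in>K. e \<in> D k}. a k * of_bool (D k - {e} \<subseteq> A))"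
    using assms by (subst sum.inter_filter[symmetric]) auto
  finally have eq: "(\<Sum>k\<in>K. a k * of_bool (D k \<subseteq> insert e A))
      - (\<Sum>k\<in>K. a k * of_bool (D k \<subseteq> A - {e}))
      = (\<Sum>k\<in>{k\<in>K. e \<in> D k}. a k * of_bool (D k - {e} \<subseteq> A))" .
  show "0 \<le> 1 * ((\<Sum>k\<in>K. a k * of_bool (D k \<subseteq> insert e A)) - (\<Sum>k\<in>K. a k * of_bool (D k \<subseteq> A - {e}))) \<and>
    1 * ((\<Sum>k\<in>K. a k * of_bool (D k \<subseteq> insert e A)) - (\<Sum>k\<in>K. a k * of_bool (D k \<subseteq> A - {e})))
      \<le> (\<Sum>k\<in>{k\<in>K. e \<in> D k}. a k)"
    unfolding eq using assms
    by (auto intro!: sum_nonneg sum_mono simp del: sum_mult_of_bool_eq simp: mult_left_le)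
qed

text \<open>Clipping is 1-Lipschitz and monotone in the direction \<open>\<sigma>\<close>; hence
  excesses belong to the class of functions that can be compared with a product measure.\<close>

lemma influence_clip:
  assumes "influence 1 c F" "\<bar>\<sigma>\<bar> = 1"
  shows "influence \<sigma> c (\<lambda>A. max 0 (\<sigma> * (F A - \<kappa>)))"
  unfolding influence_def
proof (intro allI)
  fix e A
  have "0 \<le> F (insert e A) - F (A - {e})" "F (insert e A) - F (A - {e}) \<le> c e"
    using assms(1) by (auto simp: influence_def)
  moreover have "\<sigma> = 1 \<or> \<sigma> = -1" using assms(2) by auto
  ultimately show "0 \<le> \<sigma> * (max 0 (\<sigma> * (F (insert e A) - \<kappa>)) - max 0 (\<sigma> * (F (A - {e}) - \<kappa>))) \<and>
    \<sigma> * (max 0 (\<sigma> * (F (insert e A) - \<kappa>)) - max 0 (\<sigma> * (F (A - {e}) - \<kappa>))) \<le> c e"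
    by (auto simp: max_def)
qed

text \<open>The mean of \<open>F\<close> under the product measure with parameter \<open>Phi u\<close> is \<open>\<mu>\<close>, and its variance
  there is bounded by Efron--Stein; passing from the Gibbs measure to the product measure costs
  an error governed by the local fields beyond \<open>u\<close>.\<close>

lemma ex_excess_le:
  fixes a :: "'k \<Rightarrow> real"
  defines "F \<equiv> \<lambda>D K A. \<Sum>k\<in>K. a k * of_bool (D k \<subseteq> A)"
  assumes K: "finite K" "\<And>k. k \<in> K \<Longrightarrow> 0 \<le> a k" "\<And>k. k \<in> K \<Longrightarrow> D k \<subseteq> E"
    and \<sigma>: "\<bar>\<sigma>\<bar> = 1"
    and d: "\<And>e. e \<in> E \<Longrightarrow> (\<Sum>k\<in>{k\<in>K. e \<in> D k}. a k) \<le> d e"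
    and \<eta>: "\<And>e. e \<in> E \<Longrightarrow> ex (\<lambda>A. max 0 (\<sigma> * (dH e A - u))) \<le> \<eta>"
    and gap: "0 < g" "g \<le> \<sigma> * (\<kappa> - (\<Sum>k\<in>K. a k * Phi u ^ card (D k)))"
  shows "ex (\<lambda>A. max 0 (\<sigma> * (F D K A - \<kappa>))) \<le> (\<Sum>e\<in>E. (d e)\<^sup>2) / (16 * g) + (\<Sum>e\<in>E. d e) * \<eta>"
proof -
  define \<mu> where "\<mu> = (\<Sum>k\<in>K. a k * Phi u ^ card (D k))"
  define c where "c = (\<lambda>e. \<Sum>k\<in>{k\<in>K. e \<in> D k}. a k)"
  define f where "f = (\<lambda>A. max 0 (\<sigma> * (F D K A - \<kappa>)))"
  obtain as where as: "set as = E" "distinct as"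
    using finite_distinct_list[OF finite_E] by auto
  have c0: "0 \<le> c e" for e using K by (auto simp: c_def intro!: sum_nonneg)
  have cd: "c e \<le> d e" if "e \<in> E" for e using d[OF that] by (simp add: c_def)
  have infl: "influence 1 c (F D K)"
    unfolding c_def F_def using K by (intro influence_subset_sum) auto
  then have infl\<mu>: "influence 1 c (\<lambda>A. F D K A - \<mu>)"
    by (simp add: influence_def)
  have q: "0 \<le> Phi u" "Phi u \<le> 1" using Phi_bounds[of u] by auto
  have mean: "smooth (Phi u) as (F D K) A = \<mu>" for A
  proof -
    have "smooth (Phi u) as (\<lambda>A. a k * of_bool (D k \<subseteq> A)) A = a k * Phi u ^ card (D k)"
      if "k \<in> K" for k
    proof -
      have "D k \<subseteq> set as" "finite (D k)" using K(3)[OF that] as finite_subset[OF _ finite_E] by auto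
      then have "D k \<inter> E = D k" "D k - E = {}" using as by auto
      then show ?thesis
        using \<open>finite (D k)\<close> as by (auto simp add: smooth_cmult smooth_subset_indicator)
    qed
    then show ?thesis
      unfolding F_def \<mu>_def using K by (simp add: smooth_sum del: sum_mult_of_bool_eq)
  qed
  have "smooth (Phi u) as f A \<le> (\<Sum>e\<in>E. (d e)\<^sup>2) / (16 * g)" for A
  proof -
    \<comment> \<open>The bound \<open>z - g \<le> z\<^sup>2 / (4 * g)\<close> is
      \<open>(z - 2 * g)\<^sup>2 \<ge> 0\<close>. Its 4 and the 4 of Efron--Stein make the
      \<open>16 * g\<close> of the conclusion.\<close>
    have f_le: "f A \<le> 1 / (4 * g) * (F D K A - \<mu>)\<^sup>2" for A
    proof -
      define z where "z = \<sigma> * (F D K A - \<mu>)"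
      have "\<sigma> * (F D K A - \<kappa>) \<le> z - g"
        using gap(2) by (simp add: z_def \<mu>_def algebra_simps)
      also have "\<dots> \<le> 1 / (4 * g) * z\<^sup>2"
      proof -
        have "0 \<le> (z - 2 * g)\<^sup>2" by simp
        then have "4 * g * (z - g) \<le> z\<^sup>2" by (simp add: power2_eq_square algebra_simps)
        then show ?thesis using gap(1) by (simp add: field_simps)
      qed
      also have "z\<^sup>2 = (F D K A - \<mu>)\<^sup>2"
        using \<sigma> by (metis abs_mult mult_1 power2_abs z_def)
      finally show ?thesis using gap(1) by (simp add: f_def)
    qed
    have "smooth (Phi u) as f A \<le> 1 / (4 * g) * smooth (Phi u) as (\<lambda>A. (F D K A - \<mu>)\<^sup>2) A"
      using smooth_mono[OF q f_le] by (simp only: smooth_cmult)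
    also have "\<dots> \<le> 1 / (4 * g) * ((smooth (Phi u) as (\<lambda>A. F D K A - \<mu>) A)\<^sup>2 + (\<Sum>e\<leftarrow>as. (c e)\<^sup>2) / 4)"
      using gap(1) by (intro mult_left_mono efron_stein_smooth[OF infl\<mu>] q) auto
    also have "smooth (Phi u) as (\<lambda>A. F D K A - \<mu>) A = 0"
      using smooth_add[of "Phi u" as "F D K" "\<lambda>_. - \<mu>"] by (simp add: mean smooth_const)
    also have "(\<Sum>e\<leftarrow>as. (c e)\<^sup>2) = (\<Sum>e\<in>E. (c e)\<^sup>2)"
      using as by (simp add: sum_list_distinct_conv_sum_set)
    also have "1 / (4 * g) * (0\<^sup>2 + (\<Sum>e\<in>E. (c e)\<^sup>2) / 4) \<le> 1 / (4 * g) * (0\<^sup>2 + (\<Sum>e\<in>E. (d e)\<^sup>2) / 4)"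
      using gap(1) c0 cd by (intro mult_left_mono add_mono divide_right_mono sum_mono power_mono) auto
    finally show ?thesis by simp
  qed
  then have 1: "ex (smooth (Phi u) as f) \<le> (\<Sum>e\<in>E. (d e)\<^sup>2) / (16 * g)"
    by (rule ex_le_const)
  have "(\<Sum>e\<leftarrow>as. c e * ex (\<lambda>A. max 0 (\<sigma> * (dH e A - u)))) = (\<Sum>e\<in>E. c e * ex (\<lambda>A. max 0 (\<sigma> * (dH e A - u))))"
    using as by (simp add: sum_list_distinct_conv_sum_set)
  also have "\<dots> \<le> (\<Sum>e\<in>E. d e * \<eta>)"
  proof (rule sum_mono)
    fix e assume "e \<in> E"
    then show "c e * ex (\<lambda>A. max 0 (\<sigma> * (dH e A - u))) \<le> d e * \<eta>"
      using c0[of e] cd[of e] \<eta>[of e] by (intro mult_mono ex_ge_const) auto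
  qed
  finally have 2: "(\<Sum>e\<leftarrow>as. c e * ex (\<lambda>A. max 0 (\<sigma> * (dH e A - u)))) \<le> (\<Sum>e\<in>E. d e) * \<eta>"
    by (simp add: sum_distrib_right)
  show ?thesis
    using ex_le_ex_smooth[OF influence_clip[OF infl \<sigma>, of \<kappa>] \<sigma>, of as u] as 1 2
    by (simp add: f_def)
qed

end

section \<open>The variance of the number of edges\<close>

lemma mono_on_Pow_insertI:
  fixes f :: "'a set \<Rightarrow> real"
  assumes "finite E" "\<And>A e. A \<subseteq> E \<Longrightarrow> e \<in> E \<Longrightarrow> e \<notin> A \<Longrightarrow> f A \<le> f (insert e A)"
  shows "mono_on (Pow E) f"
proof (rule mono_onI)
  fix A B assume AB: "A \<in> Pow E" "B \<in> Pow E" "A \<le> B"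
  have "f A \<le> f (A \<union> D)" if "finite D" "D \<subseteq> E" for D
    using that
  proof (induction D rule: finite_induct)
    case (insert x D)
    have "f (A \<union> D) \<le> f (insert x (A \<union> D))"
      using insert.prems AB assms(2)[of "A \<union> D" x] by (cases "x \<in> A \<union> D") (auto simp: insert_absorb)
    with insert show ?case by (auto intro: order_trans)
  qed simp
  from this[of B] show "f A \<le> f B"
    using AB finite_subset[OF _ assms(1), of B] by (auto simp: Un_absorb1)
qed

definition size_in :: "'a set \<Rightarrow> 'a set \<Rightarrow> real" where
  "size_in D A = (\<Sum>e\<in>D. of_bool (e \<in> A))"

context ferromagnetic_gibbs begin

lemma mono_size_in: "mono_on X (size_in D)"
  unfolding size_in_def by (intro mono_onI sum_mono) auto

lemma mono_indicator: "mono_on X (\<lambda>A. of_bool (e \<in> A) :: real)"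
  by (intro mono_onI) auto

lemma cov_size_in: "cov f (size_in D) = (\<Sum>e\<in>D. cov f (\<lambda>A. of_bool (e \<in> A)))"
  unfolding size_in_def[abs_def] by (rule cov_sum_right)

lemma cov_size_in_left: "cov (size_in D) f = (\<Sum>e\<in>D. cov (\<lambda>A. of_bool (e \<in> A)) f)"
  unfolding size_in_def[abs_def] by (rule cov_sum_left)

lemma abs_size_in_le: "\<bar>size_in D A\<bar> \<le> real (card D)"
proof -
  have "\<bar>size_in D A\<bar> \<le> (\<Sum>e\<in>D. \<bar>of_bool (e \<in> A)\<bar>)"
    unfolding size_in_def by (rule sum_abs)
  also have "\<dots> \<le> of_nat (card D) * 1"
    by (rule sum_bounded_above) simp
  finally show ?thesis by simp
qed

end

text \<open>Used to replace the logistic function by a linear one of slope \<open>\<alpha>\<close>, at the price of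
  the excess of the argument over the interval on which the slope bound holds.\<close>

lemma Phi_clip_mono:
  assumes \<alpha>: "0 \<le> \<alpha>" "\<And>u. u0 \<le> u \<Longrightarrow> u \<le> u1 \<Longrightarrow> Phi u * (1 - Phi u) \<le> \<alpha>" and u: "u0 \<le> u1"
    and "x \<le> y"
  shows "\<alpha> * x + (max 0 (x - u1) - max 0 (u0 - x)) - Phi x
    \<le> \<alpha> * y + (max 0 (y - u1) - max 0 (u0 - y)) - Phi y" (is "?f x \<le> ?f y")
proof -
  have 1: "?f x \<le> ?f y" if "x \<le> y" "y \<le> u0" for x y
    using Phi_diff_le[OF that(1)] mult_left_mono[OF that(1) \<alpha>(1)] that u by (simp add: max_def)
  have 3: "?f x \<le> ?f y" if "x \<le> y" "u1 \<le> x" for x y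
    using Phi_diff_le[OF that(1)] mult_left_mono[OF that(1) \<alpha>(1)] that u by (simp add: max_def)
  have 2: "?f x \<le> ?f y" if "x \<le> y" "u0 \<le> x" "y \<le> u1" for x y
  proof -
    have "\<alpha> * x - Phi x \<le> \<alpha> * y - Phi y"
    proof (rule DERIV_nonneg_imp_nondecreasing[OF that(1)])
      fix z assume "x \<le> z" "z \<le> y"
      then show "\<exists>d. ((\<lambda>u. \<alpha> * u - Phi u) has_real_derivative d) (at z) \<and> 0 \<le> d"
        using \<alpha>(2)[of z] that
        by (intro exI[of _ "\<alpha> - Phi z * (1 - Phi z)"])
          (auto intro!: derivative_eq_intros has_real_derivative_Phi)
    qed
    moreover have "max 0 (z - u1) = 0" "max 0 (u0 - z) = 0" if "u0 \<le> z" "z \<le> u1" for z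
      using that by auto
    ultimately show ?thesis using that by simp
  qed
  \<comment> \<open>Both points are clipped to \<open>[u0, u1]\<close>. On the stretches outside,
    the correction terms grow with slope 1, which is at least that of \<open>Phi\<close>; inside,
    the slope \<open>\<alpha>\<close> is enough.\<close>
  define x' y' where "x' = max u0 (min u1 x)" and "y' = max u0 (min u1 y)"
  have "?f x' \<le> ?f y'"
    using u \<open>x \<le> y\<close> by (intro 2) (auto simp: x'_def y'_def)
  show ?thesis
  proof (cases "y \<le> u0 \<or> u1 \<le> x")
    case True
    then show ?thesis using 1[of x y] 3[of x y] \<open>x \<le> y\<close> by auto
  next
    case False
    then have "?f x \<le> ?f x'" "?f y' \<le> ?f y"
      using 1[of x x'] 3[of y' y] by (cases "x \<le> u0"; cases "u1 \<le> y"; simp add: x'_def y'_def)+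
    then show ?thesis using \<open>?f x' \<le> ?f y'\<close> by linarith
  qed
qed

section \<open>Second differences of the Hamiltonian and contraction of the covariance\<close>

context interaction begin

text \<open>The total rise of the fields \<open>dH f\<close>, \<open>f \<noteq> e\<close>, when
  \<open>e\<close> is added. Its mean under independent coordinates is the derivative of the mean
  field in the density, which is how the slope of \<open>phi\<close> enters.\<close>

definition ddH :: "'e \<Rightarrow> 'e set \<Rightarrow> real" where
  "ddH e A = (\<Sum>f\<in>E - {e}. \<Sum>j\<in>{j\<in>J. e \<in> C j \<and> f \<in> C j}. b j * of_bool (C j - {e, f} \<subseteq> A))"

text \<open>Double counting: an interaction through \<open>e\<close> is met once for each of its
  other \<open>card (C j) - 1\<close> members.\<close>

lemma sum_coupling_swap:
  fixes g :: "'j \<Rightarrow> real"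
  assumes "e \<in> E"
  shows "(\<Sum>f\<in>E - {e}. \<Sum>j\<in>{j\<in>J. e \<in> C j \<and> f \<in> C j}. g j)
    = (\<Sum>j\<in>{j\<in>J. e \<in> C j}. real (card (C j) - 1) * g j)"
proof -
  have "(\<Sum>f\<in>E - {e}. \<Sum>j\<in>{j\<in>J. e \<in> C j \<and> f \<in> C j}. g j)
      = (\<Sum>j\<in>{j\<in>J. e \<in> C j}. \<Sum>f\<in>{f\<in>E - {e}. f \<in> C j}. g j)"
    using sum.swap_restrict[of "E - {e}" "{j\<in>J. e \<in> C j}" "\<lambda>f j. g j" "\<lambda>f j. f \<in> C j"]
    by (simp add: conj_assoc)
  also have "\<dots> = (\<Sum>j\<in>{j\<in>J. e \<in> C j}. real (card (C j) - 1) * g j)"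
  proof (rule sum.cong)
    fix j assume j: "j \<in> {j\<in>J. e \<in> C j}"
    then have "{f\<in>E - {e}. f \<in> C j} = C j - {e}" using C_subset by auto
    moreover have "card (C j - {e}) = card (C j) - 1" using j by simp
    ultimately show "(\<Sum>f\<in>{f\<in>E - {e}. f \<in> C j}. g j) = real (card (C j) - 1) * g j" by simp
  qed simp
  finally show ?thesis .
qed

lemma mono_dH: "A \<subseteq> B \<Longrightarrow> dH e A \<le> dH e B"
  unfolding dH_def by (intro sum_mono mult_left_mono) (auto intro: b_nonneg)

lemma mono_ddH: "A \<subseteq> B \<Longrightarrow> ddH e A \<le> ddH e B"
  unfolding ddH_def by (intro sum_mono mult_left_mono) (auto intro: b_nonneg)

lemma sum_dH_insert:
  assumes "e \<in> E" "e \<notin> A"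
  shows "(\<Sum>f\<in>E. dH f (insert e A)) = (\<Sum>f\<in>E. dH f A) + ddH e A"
proof -
  have *: "dH f (insert e A) = dH f A + (\<Sum>j\<in>{j\<in>J. e \<in> C j \<and> f \<in> C j}. b j * of_bool (C j - {e, f} \<subseteq> A))"
    if "f \<noteq> e" for f
  proof -
    have "dH f (insert e A) = (\<Sum>j\<in>{j\<in>J. f \<in> C j}. b j * of_bool (C j - {f} \<subseteq> A)
        + (if e \<in> C j then b j * of_bool (C j - {e, f} \<subseteq> A) else 0))"
      unfolding dH_def using that \<open>e \<notin> A\<close> by (intro sum.cong) (auto simp: of_bool_def)
    also have "\<dots> = dH f A + (\<Sum>j\<in>{j\<in>{j\<in>J. f \<in> C j}. e \<in> C j}. b j * of_bool (C j - {e, f} \<subseteq> A))"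
      unfolding dH_def sum.distrib by (subst sum.inter_filter) auto
    also have "{j\<in>{j\<in>J. f \<in> C j}. e \<in> C j} = {j\<in>J. e \<in> C j \<and> f \<in> C j}" by auto
    finally show ?thesis .
  qed
  have "(\<Sum>f\<in>E. dH f (insert e A)) = dH e (insert e A) + (\<Sum>f\<in>E-{e}. dH f (insert e A))"
    using assms by (intro sum.remove) auto
  also have "\<dots> = (dH e A + (\<Sum>f\<in>E-{e}. dH f A)) + ddH e A"
    by (simp add: dH_insert * ddH_def sum.distrib)
  also have "dH e A + (\<Sum>f\<in>E-{e}. dH f A) = (\<Sum>f\<in>E. dH f A)"
    using assms by (intro sum.remove[symmetric]) auto
  finally show ?thesis .
qed

text \<open>Redrawing \<open>e\<close> replaces its indicator by the conditional probability; the
  \<open>+ 1\<close> is what \<open>e\<close> itself adds to the size when it is drawn.\<close>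

lemma cov_indicator_size_le:
  assumes "e \<in> E"
  shows "cov (\<lambda>A. of_bool (e \<in> A)) (size_in E) \<le> cov (\<lambda>A. Phi (dH e A)) (size_in E) + 1"
proof -
  let ?x = "\<lambda>A. of_bool (e \<in> A) :: real" and ?L = "\<lambda>A. Phi (dH e A)"
  have "ex ?x = ex ?L"
    by (subst ex_resample[OF assms]) simp
  moreover have "ex (\<lambda>A. ?x A * size_in E A) \<le> ex (\<lambda>A. ?L A * size_in E A + 1)"
  proof (subst ex_resample[OF assms], rule ex_mono)
    fix A
    have "size_in E (insert e A) \<le> (\<Sum>f\<in>E. of_bool (f \<in> A) + of_bool (f = e))"
      unfolding size_in_def by (intro sum_mono) auto
    also have "\<dots> = size_in E A + 1"
      using assms by (simp add: sum.distrib size_in_def)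
    finally have "?L A * size_in E (insert e A) \<le> ?L A * (size_in E A + 1)"
      using Phi_bounds[of "dH e A"] by (intro mult_left_mono) auto
    also have "\<dots> \<le> ?L A * size_in E A + 1"
      using Phi_bounds[of "dH e A"] by (simp add: algebra_simps)
    finally show "?L A * (?x (insert e A) * size_in E (insert e A))
        + (1 - ?L A) * (?x (A - {e}) * size_in E (A - {e})) \<le> ?L A * size_in E A + 1"
      by simp
  qed
  ultimately show ?thesis
    by (simp add: cov_def ex_add ex_const)
qed

text \<open>Both steps compare covariances with the increasing function \<open>size_in E\<close>: adding a
  correction that is small in mean makes the difference of the two sides monotone, and positive
  association applies.\<close>

theorem variance_size_le:
  assumes \<alpha>: "0 \<le> \<alpha>" "\<And>u. u0 \<le> u \<Longrightarrow> u \<le> u1 \<Longrightarrow> Phi u * (1 - Phi u) \<le> \<alpha>" and u: "u0 \<le> u1"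
    and upper: "\<And>e. e \<in> E \<Longrightarrow> ex (\<lambda>A. max 0 (dH e A - u1)) \<le> \<eta>"
    and lower: "\<And>e. e \<in> E \<Longrightarrow> ex (\<lambda>A. max 0 (u0 - dH e A)) \<le> \<eta>"
    and second: "\<And>e. e \<in> E \<Longrightarrow> ex (\<lambda>A. max 0 (ddH e A - \<kappa>)) \<le> \<eta>"
  shows "(1 - \<alpha> * \<kappa>) * cov (size_in E) (size_in E)
    \<le> real (card E) + (4 + 2 * \<alpha>) * (real (card E))\<^sup>2 * \<eta>"
proof -
  define M T where "M = real (card E)" and "T = size_in E"
  \<comment> \<open>The correction for large second differences. The indicator lets \<open>R\<close>
    rise by at least \<open>max 0 (ddH e A - \<kappa>)\<close> when \<open>e\<close> is added, as
    \<open>ddH\<close> is monotone; so \<open>\<kappa> * T + R\<close> grows at least as fast as the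
    sum of all fields.\<close>
  define R where "R = (\<lambda>A. \<Sum>e\<in>E. of_bool (e \<in> A) * max 0 (ddH e A - \<kappa>))"
  define \<rho> where "\<rho> = (\<lambda>u. max 0 (u - u1) - max 0 (u0 - u))"
  have monoT: "mono_on (Pow E) T" unfolding T_def by (rule mono_size_in)
  have absT: "\<bar>T A\<bar> \<le> M" for A unfolding T_def M_def by (rule abs_size_in_le)
  have M0: "0 \<le> M" by (simp add: M_def)

  have K: "(\<Sum>e\<in>E. cov (dH e) T) \<le> \<kappa> * cov T T + 2 * M * (M * \<eta>)"
  proof -
    have "(\<Sum>e\<in>E. cov (dH e) T) = cov (\<lambda>A. \<Sum>e\<in>E. dH e A) T"
      by (simp add: cov_sum_left)
    also have "\<dots> \<le> cov (\<lambda>A. \<kappa> * T A + R A) T"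
    proof (rule cov_mono_left[OF mono_on_Pow_insertI monoT])
      fix A e assume A: "A \<subseteq> E" "e \<in> E" "e \<notin> A"
      have T: "T (insert e A) = T A + 1"
      proof -
        have "T (insert e A) = (\<Sum>f\<in>E. of_bool (f \<in> A) + of_bool (f = e))"
          unfolding size_in_def T_def using A by (intro sum.cong) auto
        then show ?thesis using A by (simp add: sum.distrib size_in_def T_def)
      qed
      have "R A + max 0 (ddH e A - \<kappa>) \<le> R (insert e A)"
      proof -
        have "R A + max 0 (ddH e A - \<kappa>)
            = (\<Sum>f\<in>E. of_bool (f \<in> A) * max 0 (ddH f A - \<kappa>) + of_bool (f = e) * max 0 (ddH f A - \<kappa>))"
          using A by (simp add: R_def sum.distrib)
        also have "\<dots> \<le> R (insert e A)"
          unfolding R_def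
        proof (rule sum_mono)
          fix f
          show "of_bool (f \<in> A) * max 0 (ddH f A - \<kappa>) + of_bool (f = e) * max 0 (ddH f A - \<kappa>)
              \<le> of_bool (f \<in> insert e A) * max 0 (ddH f (insert e A) - \<kappa>)"
            using A mono_ddH[of A "insert e A" f] by (auto simp: subset_insertI)
        qed
        finally show ?thesis .
      qed
      then show "\<kappa> * T A + R A - (\<Sum>e\<in>E. dH e A)
          \<le> \<kappa> * T (insert e A) + R (insert e A) - (\<Sum>f\<in>E. dH f (insert e A))"
        using sum_dH_insert[OF A(2,3)] by (simp add: T algebra_simps)
    qed simp
    also have "\<dots> = \<kappa> * cov T T + cov R T"
      by (simp add: cov_add_left cov_cmult_left)
    also have "cov R T \<le> 2 * M * ex (\<lambda>A. \<bar>R A\<bar>)"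
      by (rule cov_le_ex_abs) (rule absT)
    also have "ex (\<lambda>A. \<bar>R A\<bar>) \<le> ex (\<lambda>A. \<Sum>e\<in>E. max 0 (ddH e A - \<kappa>))"
      unfolding R_def
      by (intro ex_mono order_trans[OF sum_abs] sum_mono) (auto simp: abs_mult)
    also have "\<dots> = (\<Sum>e\<in>E. ex (\<lambda>A. max 0 (ddH e A - \<kappa>)))"
      by (rule ex_sum)
    also have "\<dots> \<le> M * \<eta>"
      unfolding M_def by (rule sum_bounded_above[OF second])
    finally show ?thesis using M0 by (simp add: mult_left_mono)
  qed

  have L: "cov (\<lambda>A. Phi (dH e A)) T \<le> \<alpha> * cov (dH e) T + 2 * M * (2 * \<eta>)" if e: "e \<in> E" for e
  proof -
    have "cov (\<lambda>A. Phi (dH e A)) T \<le> cov (\<lambda>A. \<alpha> * dH e A + \<rho> (dH e A)) T"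
    proof (rule cov_mono_left[OF _ monoT], rule mono_onI)
      fix A B :: "'e set" assume "A \<le> B"
      then have "dH e A \<le> dH e B" by (rule mono_dH)
      from Phi_clip_mono[OF \<alpha> u this]
      show "\<alpha> * dH e A + \<rho> (dH e A) - Phi (dH e A) \<le> \<alpha> * dH e B + \<rho> (dH e B) - Phi (dH e B)"
        by (simp add: \<rho>_def)
    qed
    also have "\<dots> = \<alpha> * cov (dH e) T + cov (\<lambda>A. \<rho> (dH e A)) T"
      by (simp add: cov_add_left cov_cmult_left)
    also have "cov (\<lambda>A. \<rho> (dH e A)) T \<le> 2 * M * ex (\<lambda>A. \<bar>\<rho> (dH e A)\<bar>)"
      by (rule cov_le_ex_abs) (rule absT)
    also have "ex (\<lambda>A. \<bar>\<rho> (dH e A)\<bar>) \<le> ex (\<lambda>A. max 0 (dH e A - u1) + max 0 (u0 - dH e A))"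
      by (intro ex_mono) (auto simp: \<rho>_def)
    also have "\<dots> \<le> \<eta> + \<eta>"
      unfolding ex_add by (intro add_mono upper lower e)
    finally show ?thesis using M0 by (simp add: mult_left_mono)
  qed

  \<comment> \<open>Summing over \<open>e\<close> brings \<open>cov T T\<close> back on the right
    with the factor \<open>\<alpha> * \<kappa>\<close>; moving it to the left is the
    contraction.\<close>
  have "cov T T = (\<Sum>e\<in>E. cov (\<lambda>A. of_bool (e \<in> A)) T)"
    unfolding T_def by (rule cov_size_in_left)
  also have "\<dots> \<le> (\<Sum>e\<in>E. \<alpha> * cov (dH e) T + 4 * M * \<eta> + 1)"
    using cov_indicator_size_le L unfolding T_def by (intro sum_mono) fastforce
  also have "\<dots> = \<alpha> * (\<Sum>e\<in>E. cov (dH e) T) + 4 * M\<^sup>2 * \<eta> + M"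
    by (simp add: sum.distrib sum_distrib_left M_def power2_eq_square algebra_simps)
  also have "\<dots> \<le> \<alpha> * (\<kappa> * cov T T + 2 * M * (M * \<eta>)) + 4 * M\<^sup>2 * \<eta> + M"
    using K \<alpha>(1) by (intro add_mono mult_left_mono) auto
  finally show ?thesis
    unfolding T_def[symmetric] M_def[symmetric] by (simp add: power2_eq_square algebra_simps)
qed

end

section \<open>Newman's inequality\<close>

lemma norm_cis_minus_one_le: "norm (cis t - 1) \<le> \<bar>t\<bar>"
  using iexp_approx1[of t 0] by (simp add: cis_conv_exp)

lemma norm_cis_diff_le: "norm (cis s - cis t) \<le> \<bar>s - t\<bar>"
proof -
  have "cis s - cis t = cis t * (cis (s - t) - 1)"
    by (simp add: right_diff_distrib cis_mult)
  then show ?thesis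
    using norm_cis_minus_one_le[of "s - t"] by (simp add: norm_mult)
qed

context ferromagnetic_gibbs begin

text \<open>Since \<open>\<phi>\<close> varies at most \<open>t\<close> times as fast as its
  argument, \<open>t * N\<close> plus or minus \<open>\<phi>\<close> of \<open>N\<close> is
  increasing, and positive association bounds both signs.\<close>

lemma abs_cov_le_of_lipschitz:
  assumes "mono_on (Pow E) N" "mono_on (Pow E) g" "0 \<le> t" and lip: "\<And>x y. \<bar>\<phi> x - \<phi> y\<bar> \<le> t * \<bar>x - y\<bar>"
  shows "\<bar>cov (\<lambda>A. \<phi> (N A)) g\<bar> \<le> t * cov N g"
proof -
  have "cov (\<lambda>A. \<phi> (N A)) g \<le> cov (\<lambda>A. t * N A) g"
  proof (rule cov_mono_left[OF mono_onI assms(2)])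
    fix A B :: "'e set" assume "A \<in> Pow E" "B \<in> Pow E" "A \<le> B"
    then have "N A \<le> N B" using assms(1) by (auto simp: mono_on_def)
    then show "t * N A - \<phi> (N A) \<le> t * N B - \<phi> (N B)"
      using lip[of "N B" "N A"] by (simp add: algebra_simps)
  qed
  moreover have "cov (\<lambda>A. - 1 * \<phi> (N A)) g \<le> cov (\<lambda>A. t * N A) g"
  proof (rule cov_mono_left[OF mono_onI assms(2)])
    fix A B :: "'e set" assume "A \<in> Pow E" "B \<in> Pow E" "A \<le> B"
    then have "N A \<le> N B" using assms(1) by (auto simp: mono_on_def)
    then show "t * N A - - 1 * \<phi> (N A) \<le> t * N B - - 1 * \<phi> (N B)"
      using lip[of "N B" "N A"] by (simp add: algebra_simps)
  qed
  ultimately show ?thesis unfolding cov_cmult_left by linarith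
qed

text \<open>Elements are split off one at a time. An indicator \<open>x\<close> enters through
  \<open>cis (t * x) = 1 + (cis t - 1) * x\<close>: the factor \<open>cis t - 1\<close> gives one
  \<open>\<bar>t\<bar>\<close>, the Lipschitz constant of cosine and sine in the other factor gives
  the second, and the 2 adds real and imaginary part.\<close>

theorem newman_inequality:
  assumes "finite D" "0 \<le> k"
    and "\<And>e f. e \<in> D \<Longrightarrow> f \<in> D \<Longrightarrow> e \<noteq> f \<Longrightarrow> cov (\<lambda>A. of_bool (e \<in> A)) (\<lambda>A. of_bool (f \<in> A)) \<le> k"
  shows "norm (ex (\<lambda>A. cis (t * size_in D A)) - (\<Prod>e\<in>D. ex (\<lambda>A. cis (t * of_bool (e \<in> A)))))
    \<le> 2 * t\<^sup>2 * k * (real (card D))\<^sup>2"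
  using assms(1,3)
proof (induction D rule: finite_induct)
  case empty
  then show ?case by (simp add: size_in_def ex_const)
next
  case (insert a D)
  let ?x = "\<lambda>A. of_bool (a \<in> A) :: real"
  define F where "F = (\<lambda>A. cis (t * size_in D A))"
  define G where "G = (\<lambda>A. cis (t * ?x A))"
  define P where "P = (\<Prod>e\<in>D. ex (\<lambda>A. cis (t * of_bool (e \<in> A))))"
  have FG: "cis (t * size_in (insert a D) A) = F A * G A" for A
    using insert.hyps by (simp add: F_def G_def size_in_def cis_mult algebra_simps)
  have G: "G A = 1 + (cis t - 1) * of_real (?x A)" for A
    by (simp add: G_def)
  \<comment> \<open>The covariance of the complex \<open>F\<close> with the new indicator; its real
    and imaginary part are genuine covariances.\<close>
  define \<Delta> where "\<Delta> = ex (\<lambda>A. F A * of_real (?x A)) - ex F * of_real (ex ?x)"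
  have ofr: "ex (\<lambda>A. of_real (?x A)) = (of_real (ex ?x) :: complex)"
    by (simp add: complex_eq_iff Re_ex Im_ex)
      (simp add: ex_def)
  have eq: "ex (\<lambda>A. F A * G A) - ex F * ex G = (cis t - 1) * \<Delta>"
  proof -
    have "ex (\<lambda>A. F A * G A) = ex (\<lambda>A. F A + (cis t - 1) * (F A * of_real (?x A)))"
      unfolding G by (simp add: algebra_simps)
    also have "\<dots> = ex F + (cis t - 1) * ex (\<lambda>A. F A * of_real (?x A))"
      by (simp only: ex_add ex_cmult)
    finally have 1: "ex (\<lambda>A. F A * G A) = ex F + (cis t - 1) * ex (\<lambda>A. F A * of_real (?x A))" .
    have "ex G = 1 + (cis t - 1) * of_real (ex ?x)"
      unfolding G by (simp only: ex_add ex_cmult ex_const ofr)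
    then have "ex F * ex G = ex F + (cis t - 1) * (ex F * of_real (ex ?x))"
      by (simp only: distrib_left mult_1_right mult.left_commute)
    with 1 show ?thesis by (simp only: \<Delta>_def right_diff_distrib add_diff_add) simp
  qed
  have covs: "cov (size_in D) ?x \<le> k * real (card D)"
  proof -
    have "cov (size_in D) ?x = (\<Sum>e\<in>D. cov (\<lambda>A. of_bool (e \<in> A)) ?x)"
      by (rule cov_size_in_left)
    also have "\<dots> \<le> (\<Sum>e\<in>D. k)"
      using insert.hyps by (intro sum_mono insert.prems) auto
    finally show ?thesis by (simp add: mult.commute)
  qed
  have "\<bar>Re \<Delta>\<bar> \<le> \<bar>t\<bar> * cov (size_in D) ?x"
  proof -
    have "Re \<Delta> = cov (\<lambda>A. cos (t * size_in D A)) ?x"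
      by (simp add: \<Delta>_def Re_ex cov_def F_def)
    moreover have "\<bar>cos (t * x) - cos (t * y)\<bar> \<le> \<bar>t\<bar> * \<bar>x - y\<bar>" for x y
      using norm_cis_diff_le[of "t * x" "t * y"] abs_Re_le_cmod[of "cis (t * x) - cis (t * y)"]
      by (simp flip: right_diff_distrib abs_mult)
    ultimately show ?thesis
      using abs_cov_le_of_lipschitz[OF mono_size_in mono_indicator, of "\<bar>t\<bar>" "\<lambda>x. cos (t * x)" D a]
      by simp
  qed
  moreover have "\<bar>Im \<Delta>\<bar> \<le> \<bar>t\<bar> * cov (size_in D) ?x"
  proof -
    have "Im \<Delta> = cov (\<lambda>A. sin (t * size_in D A)) ?x"
      by (simp add: \<Delta>_def Im_ex cov_def F_def)
    moreover have "\<bar>sin (t * x) - sin (t * y)\<bar> \<le> \<bar>t\<bar> * \<bar>x - y\<bar>" for x y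
      using norm_cis_diff_le[of "t * x" "t * y"] abs_Im_le_cmod[of "cis (t * x) - cis (t * y)"]
      by (simp flip: right_diff_distrib abs_mult)
    ultimately show ?thesis
      using abs_cov_le_of_lipschitz[OF mono_size_in mono_indicator, of "\<bar>t\<bar>" "\<lambda>x. sin (t * x)" D a]
      by simp
  qed
  ultimately have "norm \<Delta> \<le> 2 * \<bar>t\<bar> * cov (size_in D) ?x"
    using cmod_le[of \<Delta>] by linarith
  also have "\<dots> \<le> 2 * \<bar>t\<bar> * (k * real (card D))"
    using covs by (intro mult_left_mono) auto
  finally have "norm ((cis t - 1) * \<Delta>) \<le> \<bar>t\<bar> * (2 * \<bar>t\<bar> * (k * real (card D)))"
    unfolding norm_mult by (intro mult_mono norm_cis_minus_one_le) auto
  then have 1: "norm (ex (\<lambda>A. F A * G A) - ex F * ex G) \<le> 2 * t\<^sup>2 * k * real (card D)"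
    unfolding eq by (simp add: power2_eq_square mult_ac flip: abs_mult)
  have "norm (ex G) \<le> ex (\<lambda>A. norm (G A))" by (rule norm_ex_le)
  then have "norm (ex G) \<le> 1" by (simp add: G_def ex_const)
  have "norm (ex F - P) \<le> 2 * t\<^sup>2 * k * (real (card D))\<^sup>2"
    unfolding F_def P_def using insert.prems by (intro insert.IH) auto
  then have 2: "norm ((ex F - P) * ex G) \<le> 2 * t\<^sup>2 * k * (real (card D))\<^sup>2"
    unfolding norm_mult
    using mult_mono[of "norm (ex F - P)" "2 * t\<^sup>2 * k * (real (card D))\<^sup>2" "norm (ex G)" 1]
      \<open>norm (ex G) \<le> 1\<close> assms(2) by simp
  have "ex (\<lambda>A. cis (t * size_in (insert a D) A)) - (\<Prod>e\<in>insert a D. ex (\<lambda>A. cis (t * of_bool (e \<in> A))))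
      = (ex (\<lambda>A. F A * G A) - ex F * ex G) + (ex F - P) * ex G"
    using insert.hyps unfolding FG P_def G_def by (simp add: algebra_simps)
  then have "norm (ex (\<lambda>A. cis (t * size_in (insert a D) A)) - (\<Prod>e\<in>insert a D. ex (\<lambda>A. cis (t * of_bool (e \<in> A)))))
      \<le> 2 * t\<^sup>2 * k * real (card D) + 2 * t\<^sup>2 * k * (real (card D))\<^sup>2"
    using norm_triangle_mono[OF 1 2] by simp
  also have "\<dots> = 2 * t\<^sup>2 * k * (real (card D) + (real (card D))\<^sup>2)"
    by (simp add: algebra_simps)
  \<comment> \<open>With \<open>d = card D\<close> this is
    \<open>d + d\<^sup>2 \<le> (d + 1)\<^sup>2\<close>.\<close>
  also have "\<dots> \<le> 2 * t\<^sup>2 * k * (real (card (insert a D)))\<^sup>2"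
    using insert.hyps assms(2)
    by (intro mult_left_mono) (auto simp: power2_eq_square algebra_simps)
  finally show ?case .
qed

end

section \<open>Excess bounds for the local fields\<close>

context interaction begin

text \<open>Removing \<open>e\<close> from the hyperedges through it makes \<open>dH e\<close> a sum
  of subset indicators, to which \<open>ex_excess_le\<close> applies. The squared influences sum to
  at most \<open>c * B\<close>; with \<open>c\<close> of order \<open>1/n\<close> and
  \<open>B\<close> bounded, the bound is of order \<open>1/n\<close> whenever \<open>\<eta>\<close>
  is.\<close>

lemma ex_dH_excess_le:
  assumes e: "e \<in> E" and \<sigma>: "\<bar>\<sigma>\<bar> = 1"
    and B: "(\<Sum>f\<in>E - {e}. coupling e f) \<le> B"
    and c: "\<And>f. f \<in> E - {e} \<Longrightarrow> coupling e f \<le> c"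
    and \<eta>: "\<And>e. e \<in> E \<Longrightarrow> ex (\<lambda>A. max 0 (\<sigma> * (dH e A - u))) \<le> \<eta>" "0 \<le> \<eta>"
    and gap: "0 < g"
      "g \<le> \<sigma> * (\<kappa> - (\<Sum>j\<in>{j\<in>J. e \<in> C j}. b j * Phi u ^ (card (C j) - 1)))"
    and "0 \<le> c"
  shows "ex (\<lambda>A. max 0 (\<sigma> * (dH e A - \<kappa>))) \<le> c * B / (16 * g) + B * \<eta>"
proof -
  define K where "K = {j\<in>J. e \<in> C j}"
  \<comment> \<open>An element has no influence on its own field.\<close>
  define d where "d = (\<lambda>f. if f = e then 0 else coupling e f)"
  have nn: "0 \<le> coupling e f" for f
    unfolding coupling_def by (intro sum_nonneg) (auto intro: b_nonneg)
  have sum_d: "(\<Sum>f\<in>E. d f) = (\<Sum>f\<in>E - {e}. coupling e f)"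
    using e by (subst sum.remove[of _ e]) (auto simp: d_def)
  have "(\<Sum>f\<in>E. (d f)\<^sup>2) \<le> (\<Sum>f\<in>E. c * d f)"
    using nn c \<open>0 \<le> c\<close> by (intro sum_mono) (auto simp: d_def power2_eq_square intro!: mult_right_mono)
  also have "\<dots> \<le> c * B"
    unfolding sum_distrib_left[symmetric] sum_d using B \<open>0 \<le> c\<close> by (intro mult_left_mono)
  finally have sum_d2: "(\<Sum>f\<in>E. (d f)\<^sup>2) \<le> c * B" .
  have card_K: "card (C j - {e}) = card (C j) - 1" if "j \<in> K" for j
    using that by (simp add: K_def)
  have "ex (\<lambda>A. max 0 (\<sigma> * ((\<Sum>j\<in>K. b j * of_bool (C j - {e} \<subseteq> A)) - \<kappa>)))
      \<le> (\<Sum>f\<in>E. (d f)\<^sup>2) / (16 * g) + (\<Sum>f\<in>E. d f) * \<eta>"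
  proof (rule ex_excess_le)
    show "finite K" "\<And>j. j \<in> K \<Longrightarrow> 0 \<le> b j" "\<And>j. j \<in> K \<Longrightarrow> C j - {e} \<subseteq> E"
      using C_subset b_nonneg by (auto simp: K_def)
    show "(\<Sum>k | k \<in> K \<and> f \<in> C k - {e}. b k) \<le> d f" if "f \<in> E" for f
      unfolding d_def coupling_def K_def
      by (auto intro!: sum_mono2 b_nonneg)
    show "g \<le> \<sigma> * (\<kappa> - (\<Sum>k\<in>K. b k * Phi u ^ card (C k - {e})))"
      using gap(2) by (simp add: card_K K_def[symmetric])
  qed fact+
  also have "\<dots> \<le> c * B / (16 * g) + B * \<eta>"
    using sum_d2 B gap(1) \<eta>(2) by (intro add_mono divide_right_mono mult_right_mono) (auto simp: sum_d)
  finally show ?thesis by (simp add: dH_def K_def)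
qed

text \<open>Here the subset indicators are indexed by pairs of an element \<open>f\<close> and an
  interaction through \<open>e\<close> and \<open>f\<close>, with sets \<open>C j - {e, f}\<close>.
  An interaction occurs for at most \<open>m\<close> choices of \<open>f\<close>, which multiplies
  the influences by at most \<open>m\<close>.\<close>

lemma ex_ddH_excess_le:
  assumes e: "e \<in> E"
    and B: "(\<Sum>f\<in>E - {e}. coupling e f) \<le> B"
    and c: "\<And>f. f \<in> E - {e} \<Longrightarrow> coupling e f \<le> c"
    and m: "\<And>j. j \<in> J \<Longrightarrow> card (C j) \<le> m"
    and \<eta>: "\<And>e. e \<in> E \<Longrightarrow> ex (\<lambda>A. max 0 (dH e A - u)) \<le> \<eta>" "0 \<le> \<eta>"
    and gap: "0 < g"
      "g \<le> \<kappa> - (\<Sum>j\<in>{j\<in>J. e \<in> C j}. real (card (C j) - 1) * (b j * Phi u ^ (card (C j) - 2)))"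
    and "0 \<le> c"
  shows "ex (\<lambda>A. max 0 (ddH e A - \<kappa>)) \<le> (real m)\<^sup>2 * c * B / (16 * g) + real m * B * \<eta>"
proof -
  define K where "K = Sigma (E - {e}) (\<lambda>f. {j\<in>J. e \<in> C j \<and> f \<in> C j})"
  define d where "d = (\<lambda>f. if f = e then 0 else real m * coupling e f)"
  define D where "D = (\<lambda>k::'e \<times> 'j. C (snd k) - {e, fst k})"
  have fin: "finite K" unfolding K_def by (intro finite_SigmaI) auto
  have nn: "0 \<le> coupling e f" for f
    unfolding coupling_def by (intro sum_nonneg) (auto intro: b_nonneg)
  have sumK: "(\<Sum>k\<in>K. h (fst k) (snd k)) = (\<Sum>f\<in>E - {e}. \<Sum>j\<in>{j\<in>J. e \<in> C j \<and> f \<in> C j}. h f j)"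
    for h :: "'e \<Rightarrow> 'j \<Rightarrow> real"
    unfolding K_def by (subst sum.Sigma) (auto simp: case_prod_beta)
  have sum_d: "(\<Sum>f\<in>E. d f) = real m * (\<Sum>f\<in>E - {e}. coupling e f)"
    using e by (subst sum.remove[of _ e]) (auto simp: d_def sum_distrib_left)
  have "(\<Sum>f\<in>E. (d f)\<^sup>2) \<le> (\<Sum>f\<in>E. (real m * c) * d f)"
    using nn c \<open>0 \<le> c\<close>
    by (intro sum_mono) (auto simp: d_def power2_eq_square intro!: mult_mono)
  also have "\<dots> \<le> (real m * c) * (real m * B)"
    unfolding sum_distrib_left[symmetric] sum_d using B \<open>0 \<le> c\<close> by (intro mult_left_mono) auto
  finally have sum_d2: "(\<Sum>f\<in>E. (d f)\<^sup>2) \<le> (real m)\<^sup>2 * c * B"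
    by (simp add: power2_eq_square mult_ac)
  have mean: "(\<Sum>k\<in>K. b (snd k) * Phi u ^ card (D k))
      = (\<Sum>j\<in>{j\<in>J. e \<in> C j}. real (card (C j) - 1) * (b j * Phi u ^ (card (C j) - 2)))"
  proof -
    have "(\<Sum>k\<in>K. b (snd k) * Phi u ^ card (D k))
        = (\<Sum>f\<in>E - {e}. \<Sum>j\<in>{j\<in>J. e \<in> C j \<and> f \<in> C j}. b j * Phi u ^ (card (C j) - 2))"
      unfolding D_def sumK[of "\<lambda>f j. b j * Phi u ^ card (C j - {e, f})"]
    proof (intro sum.cong refl)
      fix f j assume "f \<in> E - {e}" "j \<in> {j\<in>J. e \<in> C j \<and> f \<in> C j}"
      then have "card (C j - {e, f}) = card (C j) - card {e, f}" "card {e, f} = 2"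
        by (auto intro!: card_Diff_subset)
      then show "b j * Phi u ^ card (C j - {e, f}) = b j * Phi u ^ (card (C j) - 2)" by simp
    qed
    then show ?thesis by (simp only: sum_coupling_swap[OF e])
  qed
  have "ex (\<lambda>A. max 0 (1 * ((\<Sum>k\<in>K. b (snd k) * of_bool (D k \<subseteq> A)) - \<kappa>)))
      \<le> (\<Sum>f\<in>E. (d f)\<^sup>2) / (16 * g) + (\<Sum>f\<in>E. d f) * \<eta>"
  proof (rule ex_excess_le[where u = u])
    show "\<And>k. k \<in> K \<Longrightarrow> 0 \<le> b (snd k)" "\<And>k. k \<in> K \<Longrightarrow> D k \<subseteq> E"
      using C_subset b_nonneg by (force simp: K_def D_def)+
    show "(\<Sum>k\<in>{k\<in>K. f \<in> D k}. b (snd k)) \<le> d f" if "f \<in> E" for f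
    proof (cases "f = e")
      case True
      then have "{k\<in>K. f \<in> D k} = {}" by (auto simp: D_def)
      then show ?thesis by (simp add: d_def True del: Collect_empty_eq empty_Collect_eq)
    next
      case False
      have "(\<Sum>k\<in>{k\<in>K. f \<in> D k}. b (snd k)) = (\<Sum>k\<in>K. b (snd k) * of_bool (f \<in> D k))"
        by (subst sum.inter_filter[OF fin]) (auto intro!: sum.cong)
      also have "\<dots> \<le> (\<Sum>k\<in>K. b (snd k) * of_bool (f \<in> C (snd k)))"
        using b_nonneg by (intro sum_mono mult_left_mono) (auto simp: K_def D_def)
      also have "\<dots> = (\<Sum>j\<in>{j\<in>J. e \<in> C j}. real (card (C j) - 1) * (b j * of_bool (f \<in> C j)))"
        unfolding sumK[of "\<lambda>_ j. b j * of_bool (f \<in> C j)"] by (rule sum_coupling_swap[OF e])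
      also have "\<dots> \<le> (\<Sum>j\<in>{j\<in>J. e \<in> C j}. real m * (b j * of_bool (f \<in> C j)))"
      proof (intro sum_mono mult_right_mono)
        fix j assume "j \<in> {j\<in>J. e \<in> C j}"
        then show "real (card (C j) - 1) \<le> real m" "0 \<le> b j * of_bool (f \<in> C j)"
          using m[of j] b_nonneg[of j] by auto
      qed
      also have "\<dots> = real m * (\<Sum>j\<in>{j\<in>J. e \<in> C j}. b j * of_bool (f \<in> C j))"
        by (rule sum_distrib_left[symmetric])
      also have "(\<Sum>j\<in>{j\<in>J. e \<in> C j}. b j * of_bool (f \<in> C j))
          = (\<Sum>j\<in>{j\<in>J. e \<in> C j}. if f \<in> C j then b j else 0)"
        by (intro sum.cong) auto
      also have "\<dots> = coupling e f"
        unfolding coupling_def by (subst sum.inter_filter[symmetric]) (auto intro!: sum.cong)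
      finally show ?thesis using False by (simp add: d_def)
    qed
    show "ex (\<lambda>A. max 0 (1 * (dH f A - u))) \<le> \<eta>" if "f \<in> E" for f
      using \<eta>(1)[OF that] by simp
    show "g \<le> 1 * (\<kappa> - (\<Sum>k\<in>K. b (snd k) * Phi u ^ card (D k)))"
      using gap(2) by (simp add: mean)
  qed (use fin gap in auto)
  also have "\<dots> \<le> (real m)\<^sup>2 * c * B / (16 * g) + (real m * B) * \<eta>"
    using sum_d2 B gap(1) \<eta>(2)
    by (intro add_mono divide_right_mono mult_right_mono) (auto simp: sum_d mult_left_mono)
  finally have "ex (\<lambda>A. max 0 (1 * ((\<Sum>k\<in>K. b (snd k) * of_bool (D k \<subseteq> A)) - \<kappa>)))
      \<le> (real m)\<^sup>2 * c * B / (16 * g) + (real m * B) * \<eta>" .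
  moreover have "(\<Sum>k\<in>K. b (snd k) * of_bool (D k \<subseteq> A)) = ddH e A" for A
    unfolding ddH_def D_def by (rule sumK[of "\<lambda>f j. b j * of_bool (C j - {e, f} \<subseteq> A)"])
  ultimately show ?thesis by simp
qed

lemma ex_invariant:
  fixes f :: "'e set \<Rightarrow> 'c::real_normed_vector"
  assumes "bij_betw \<tau> E E" "\<And>A. A \<subseteq> E \<Longrightarrow> Ham (\<tau> ` A) = Ham A"
  shows "ex (\<lambda>A. f (\<tau> ` A)) = ex f"
proof -
  have "ex f = (\<Sum>A\<in>Pow E. pr (\<tau> ` A) *\<^sub>R f (\<tau> ` A))"
    unfolding ex_def by (rule sum.reindex_bij_betw[OF bij_betw_Pow[OF assms(1)], symmetric])
  also have "\<dots> = ex (\<lambda>A. f (\<tau> ` A))"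
    unfolding ex_def pr_def by (intro sum.cong) (auto simp: assms(2))
  finally show ?thesis by simp
qed

end

section \<open>Counting injections\<close>

definition inj_maps :: "'a set \<Rightarrow> 'b set \<Rightarrow> ('a \<Rightarrow> 'b) set" where
  "inj_maps A B = {\<psi> \<in> A \<rightarrow>\<^sub>E B. inj_on \<psi> A}"

lemma finite_inj_maps: "finite A \<Longrightarrow> finite B \<Longrightarrow> finite (inj_maps A B)"
  unfolding inj_maps_def by (rule finite_subset[OF _ finite_PiE[of A "\<lambda>_. B"]]) auto

lemma card_inj_maps_fixed:
  assumes "v \<notin> A" "x \<in> B"
  shows "card {\<psi> \<in> inj_maps (insert v A) B. \<psi> v = x} = card (inj_maps A (B - {x}))"
proof (rule bij_betw_same_card[of "\<lambda>\<psi>. restrict \<psi> A"],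
    rule bij_betw_byWitness[where f' = "\<lambda>g. g(v := x)"])
  show "\<forall>\<psi>\<in>{\<psi> \<in> inj_maps (insert v A) B. \<psi> v = x}. (restrict \<psi> A)(v := x) = \<psi>"
    using assms by (auto simp: inj_maps_def fun_eq_iff PiE_def extensional_def restrict_def)
  show "\<forall>g\<in>inj_maps A (B - {x}). restrict (g(v := x)) A = g"
    using assms by (auto simp: inj_maps_def fun_eq_iff PiE_def extensional_def restrict_def)
  show "(\<lambda>\<psi>. restrict \<psi> A) ` {\<psi> \<in> inj_maps (insert v A) B. \<psi> v = x} \<subseteq> inj_maps A (B - {x})"
    using assms by (auto simp: inj_maps_def inj_on_def PiE_def Pi_def)
  show "(\<lambda>g. g(v := x)) ` inj_maps A (B - {x}) \<subseteq> {\<psi> \<in> inj_maps (insert v A) B. \<psi> v = x}"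
  proof (intro image_subsetI)
    fix g assume "g \<in> inj_maps A (B - {x})"
    then have g: "g \<in> A \<rightarrow>\<^sub>E B - {x}" "inj_on g A" by (auto simp: inj_maps_def)
    have "g(v := x) \<in> insert v A \<rightarrow>\<^sub>E B"
      using g(1) assms by (intro PiE_fun_upd) auto
    moreover have "inj_on (g(v := x)) (insert v A)"
      using g assms(1) by (auto intro: inj_on_fun_updI)
    ultimately show "g(v := x) \<in> {\<psi> \<in> inj_maps (insert v A) B. \<psi> v = x}"
      by (simp add: inj_maps_def)
  qed
qed

lemma card_inj_maps_insert:
  assumes "finite A" "finite B" "v \<notin> A"
  shows "card (inj_maps (insert v A) B) = (\<Sum>x\<in>B. card (inj_maps A (B - {x})))"
proof -
  have "inj_maps (insert v A) B = (\<Union>x\<in>B. {\<psi> \<in> inj_maps (insert v A) B. \<psi> v = x})"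
    by (auto simp: inj_maps_def PiE_def Pi_def)
  then have "card (inj_maps (insert v A) B) = card (\<Union>x\<in>B. {\<psi> \<in> inj_maps (insert v A) B. \<psi> v = x})"
    by simp
  also have "\<dots> = (\<Sum>x\<in>B. card {\<psi> \<in> inj_maps (insert v A) B. \<psi> v = x})"
    using assms by (intro card_UN_disjoint) (auto simp: finite_inj_maps)
  finally show ?thesis using assms by (simp add: card_inj_maps_fixed)
qed

lemma card_inj_maps_bounds:
  assumes "finite A" "finite B"
  shows "card (inj_maps A B) \<le> card B ^ card A" "(card B - card A) ^ card A \<le> card (inj_maps A B)"
proof -
  have "card (inj_maps A B) \<le> card (A \<rightarrow>\<^sub>E B)"
    unfolding inj_maps_def using assms by (intro card_mono finite_PiE) auto
  then show "card (inj_maps A B) \<le> card B ^ card A"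
    using assms by (simp add: card_PiE)
  show "(card B - card A) ^ card A \<le> card (inj_maps A B)"
    using assms
  proof (induction A arbitrary: B rule: finite_induct)
    case empty
    then show ?case by (simp add: inj_maps_def)
  next
    case (insert v A)
    have "(card B - card (insert v A)) ^ card (insert v A)
        = (card B - card (insert v A)) * (card B - card (insert v A)) ^ card A"
      using insert.hyps by simp
    also have "\<dots> \<le> card B * (card B - 1 - card A) ^ card A"
      using insert.hyps by (intro mult_mono power_mono) auto
    also have "\<dots> = (\<Sum>x\<in>B. (card (B - {x}) - card A) ^ card A)"
      by simp
    also have "\<dots> \<le> (\<Sum>x\<in>B. card (inj_maps A (B - {x})))"
      using insert.prems by (intro sum_mono insert.IH) auto
    also have "\<dots> = card (inj_maps (insert v A) B)"
      using insert by (simp add: card_inj_maps_insert)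
    finally show ?case .
  qed
qed

lemma card_inj_maps_two_fixed:
  assumes "finite V" "v \<in> V" "w \<in> V" "v \<noteq> w" "x \<in> B" "y \<in> B" "x \<noteq> y"
  shows "card {\<psi> \<in> inj_maps V B. \<psi> v = x \<and> \<psi> w = y} = card (inj_maps (V - {v, w}) (B - {x, y}))"
proof (rule bij_betw_same_card[of "\<lambda>\<psi>. restrict \<psi> (V - {v, w})"],
    rule bij_betw_byWitness[where f' = "\<lambda>g. g(v := x, w := y)"])
  show "\<forall>\<psi>\<in>{\<psi> \<in> inj_maps V B. \<psi> v = x \<and> \<psi> w = y}. (restrict \<psi> (V - {v, w}))(v := x, w := y) = \<psi>"
    by (auto simp: inj_maps_def fun_eq_iff PiE_def extensional_def restrict_def)
  show "\<forall>g\<in>inj_maps (V - {v, w}) (B - {x, y}). restrict (g(v := x, w := y)) (V - {v, w}) = g"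
    by (auto simp: inj_maps_def fun_eq_iff PiE_def extensional_def restrict_def)
  show "(\<lambda>\<psi>. restrict \<psi> (V - {v, w})) ` {\<psi> \<in> inj_maps V B. \<psi> v = x \<and> \<psi> w = y}
      \<subseteq> inj_maps (V - {v, w}) (B - {x, y})"
  proof (intro image_subsetI)
    fix \<psi> assume \<psi>: "\<psi> \<in> {\<psi> \<in> inj_maps V B. \<psi> v = x \<and> \<psi> w = y}"
    then have "inj_on \<psi> V" by (simp add: inj_maps_def)
    then have "inj_on \<psi> (V - {v, w})" by (rule inj_on_subset) simp
    moreover have "\<psi> u \<in> B - {x, y}" if "u \<in> V - {v, w}" for u
      using that \<psi> inj_onD[of \<psi> V u v] inj_onD[of \<psi> V u w] assms(2,3)
      by (auto simp: inj_maps_def)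
    ultimately show "restrict \<psi> (V - {v, w}) \<in> inj_maps (V - {v, w}) (B - {x, y})"
      by (simp add: inj_maps_def inj_on_restrict_eq)
  qed
  show "(\<lambda>g. g(v := x, w := y)) ` inj_maps (V - {v, w}) (B - {x, y})
      \<subseteq> {\<psi> \<in> inj_maps V B. \<psi> v = x \<and> \<psi> w = y}"
  proof (intro image_subsetI)
    fix g assume g: "g \<in> inj_maps (V - {v, w}) (B - {x, y})"
    have "g(v := x, w := y) \<in> V \<rightarrow>\<^sub>E B"
      using g assms by (auto simp: inj_maps_def PiE_def Pi_def extensional_def)
    moreover have "inj_on (g(v := x, w := y)) V"
    proof (rule inj_onI)
      fix s t assume st: "s \<in> V" "t \<in> V" "(g(v := x, w := y)) s = (g(v := x, w := y)) t"
      have inj: "inj_on g (V - {v, w})" and ne: "\<And>u. u \<in> V - {v, w} \<Longrightarrow> g u \<noteq> x \<and> g u \<noteq> y"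
        using g by (auto simp: inj_maps_def)
      show "s = t"
        by (cases "s = w"; cases "s = v"; cases "t = w"; cases "t = v")
          (use st ne[of s] ne[of t] inj_onD[OF inj, of s t] assms(4,7) in auto)
    qed
    ultimately show "g(v := x, w := y) \<in> {\<psi> \<in> inj_maps V B. \<psi> v = x \<and> \<psi> w = y}"
      using assms(4) by (simp add: inj_maps_def)
  qed
qed

text \<open>The 2 counts the ways to map the end points of \<open>a\<close> onto those of
  \<open>e\<close>; \<open>N\<close> consists of the remaining vertices.\<close>

lemma card_inj_maps_edge:
  assumes "finite V" "a \<in> edges_on V" "e \<in> edges_on B"
  shows "\<exists>N. card N = card V - 2 \<and> N \<subseteq> V \<and>
    card {\<psi> \<in> inj_maps V B. \<psi> ` a = e} = 2 * card (inj_maps N (B - e))"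
proof -
  obtain v w where a: "a = {v, w}" "v \<noteq> w" using assms(2) by (auto simp: edges_on_def card_2_iff)
  obtain x y where e: "e = {x, y}" "x \<noteq> y" using assms(3) by (auto simp: edges_on_def card_2_iff)
  have vw: "v \<in> V" "w \<in> V" "x \<in> B" "y \<in> B" using assms a e by (auto simp: edges_on_def)
  have eq: "{\<psi> \<in> inj_maps V B. \<psi> ` a = e}
      = {\<psi> \<in> inj_maps V B. \<psi> v = x \<and> \<psi> w = y} \<union> {\<psi> \<in> inj_maps V B. \<psi> v = y \<and> \<psi> w = x}"
    by (auto simp: a e doubleton_eq_iff)
  have two: "card {\<psi> \<in> inj_maps V B. \<psi> v = x \<and> \<psi> w = y} = card (inj_maps (V - {v, w}) (B - {x, y}))"
    "card {\<psi> \<in> inj_maps V B. \<psi> v = y \<and> \<psi> w = x} = card (inj_maps (V - {v, w}) (B - {y, x}))"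
    using assms(1) vw a e by (intro card_inj_maps_two_fixed; simp)+
  have "card {\<psi> \<in> inj_maps V B. \<psi> ` a = e} = 2 * card (inj_maps (V - {v, w}) (B - e))"
  proof (cases "finite {\<psi> \<in> inj_maps V B. \<psi> ` a = e}")
    case True
    then have "card {\<psi> \<in> inj_maps V B. \<psi> ` a = e} = card {\<psi> \<in> inj_maps V B. \<psi> v = x \<and> \<psi> w = y}
        + card {\<psi> \<in> inj_maps V B. \<psi> v = y \<and> \<psi> w = x}"
      unfolding eq using e(2) by (intro card_Un_disjoint) auto
    then show ?thesis using two by (simp add: e insert_commute)
  next
    \<comment> \<open>Reached only for infinite \<open>B\<close>, where both cardinals are 0 by
      convention.\<close>
    case False
    then have "infinite {\<psi> \<in> inj_maps V B. \<psi> v = x \<and> \<psi> w = y} \<or> infinite {\<psi> \<in> inj_maps V B. \<psi> v = y \<and> \<psi> w = x}"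
      unfolding eq by auto
    then have "card (inj_maps (V - {v, w}) (B - e)) = 0"
      using two by (auto simp: e insert_commute)
    with False show ?thesis by simp
  qed
  moreover have "card (V - {v, w}) = card V - 2"
    using card_Diff_subset[of "{v, w}" V] a(2) vw by simp
  ultimately show ?thesis by blast
qed

lemma card_inj_maps_edge_bounds:
  assumes "finite V" "a \<in> edges_on V" "e \<in> edges_on {1..n::nat}"
  shows "card {\<psi> \<in> inj_maps V {1..n}. \<psi> ` a = e} \<le> 2 * n ^ (card V - 2)"
    "2 * (n - card V) ^ (card V - 2) \<le> card {\<psi> \<in> inj_maps V {1..n}. \<psi> ` a = e}"
proof -
  obtain N where N: "card N = card V - 2" "N \<subseteq> V"
    "card {\<psi> \<in> inj_maps V {1..n}. \<psi> ` a = e} = 2 * card (inj_maps N ({1..n} - e))"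
    using card_inj_maps_edge[OF assms] by blast
  have fin: "finite N" using N(2) assms(1) by (rule finite_subset)
  have "e \<subseteq> {1..n}" "card e = 2" using assms(3) by (auto simp: edges_on_def)
  then have card: "card ({1..n} - e) = n - 2" by (simp add: card_Diff_subset finite_subset)
  have V2: "2 \<le> card V" using assms(1,2) by (auto simp: edges_on_def dest: card_mono)
  note b = card_inj_maps_bounds[OF fin, of "{1..n} - e", OF finite_Diff[OF finite_atLeastAtMost]]
  have "card (inj_maps N ({1..n} - e)) \<le> (n - 2) ^ (card V - 2)"
    using b(1) unfolding card N(1) .
  also have "\<dots> \<le> n ^ (card V - 2)" by (intro power_mono) auto
  finally show "card {\<psi> \<in> inj_maps V {1..n}. \<psi> ` a = e} \<le> 2 * n ^ (card V - 2)"
    unfolding N(3) by simp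
  have "n - card V \<le> n - 2 - (card V - 2)" using V2 by simp
  then have "(n - card V) ^ (card V - 2) \<le> (n - 2 - (card V - 2)) ^ (card V - 2)"
    by (intro power_mono) auto
  then show "2 * (n - card V) ^ (card V - 2) \<le> card {\<psi> \<in> inj_maps V {1..n}. \<psi> ` a = e}"
    using b(2) unfolding card N(1,3) by simp
qed

text \<open>Two distinct edges cover at least three vertices; \<open>4 ^ 4\<close> bounds the number of maps from
  their at most four end points to those of \<open>e\<close> and \<open>f\<close>.\<close>

lemma card_inj_maps_two_edges_le:
  assumes "finite V" "a \<in> edges_on V" "a' \<in> edges_on V" "a \<noteq> a'"
    and "e \<in> edges_on {1..n}" "f \<in> edges_on {1..n::nat}"
  shows "card {\<psi> \<in> inj_maps V {1..n}. \<psi> ` a = e \<and> \<psi> ` a' = f} \<le> 4 ^ 4 * n ^ (card V - 3)"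
    and "3 \<le> card V"
proof -
  define U where "U = a \<union> a'"
  have sub: "a \<subseteq> V" "a' \<subseteq> V" "card a = 2" "card a' = 2" "e \<subseteq> {1..n}" "f \<subseteq> {1..n}" "card e = 2" "card f = 2"
    using assms by (auto simp: edges_on_def)
  have fin: "finite a" "finite a'" "finite e" "finite f"
    using sub by (auto intro: card_ge_0_finite)
  have U4: "card U \<le> 4" using card_Un_le[of a a'] sub by (simp add: U_def)
  have ef4: "card (e \<union> f) \<le> 4" "1 \<le> card (e \<union> f)"
    using card_Un_le[of e f] sub fin card_mono[of "e \<union> f" e] by auto
  have U3: "3 \<le> card U"
  proof (rule ccontr)
    assume "\<not> 3 \<le> card U"
    then have "card U \<le> 2" by simp
    then have "a = U" "a' = U"
      using sub fin by (intro card_seteq; simp add: U_def)+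
    then show False using assms(4) by simp
  qed
  have UV: "U \<subseteq> V" using sub by (simp add: U_def)
  then show "3 \<le> card V" using U3 card_mono[OF assms(1), of U] by simp
  have n1: "1 \<le> n" using sub by (cases n) auto
  \<comment> \<open>The end points of the two edges must land in \<open>e \<union> f\<close>; all
    other vertices are left free and injectivity is dropped.\<close>
  define T where "T = (\<lambda>v. if v \<in> U then e \<union> f else {1..n})"
  have "card {\<psi> \<in> inj_maps V {1..n}. \<psi> ` a = e \<and> \<psi> ` a' = f} \<le> card (PiE V T)"
  proof (rule card_mono)
    show "finite (PiE V T)" using assms(1) fin by (intro finite_PiE) (auto simp: T_def)
    show "{\<psi> \<in> inj_maps V {1..n}. \<psi> ` a = e \<and> \<psi> ` a' = f} \<subseteq> PiE V T"
      by (auto simp: inj_maps_def PiE_def Pi_def T_def U_def)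
  qed
  also have "\<dots> = (\<Prod>v\<in>V. card (T v))" by (rule card_PiE[OF assms(1)])
  also have "\<dots> = (\<Prod>v\<in>U. card (T v)) * (\<Prod>v\<in>V - U. card (T v))"
    using prod.subset_diff[OF UV assms(1), of "\<lambda>v. card (T v)"] by (simp add: mult.commute)
  also have "\<dots> = card (e \<union> f) ^ card U * n ^ (card V - card U)"
    using UV finite_subset[OF UV assms(1)] by (simp add: T_def card_Diff_subset)
  also have "\<dots> \<le> 4 ^ 4 * n ^ (card V - 3)"
  proof (rule mult_mono)
    have "card (e \<union> f) ^ card U \<le> card (e \<union> f) ^ 4"
      using ef4 U4 by (intro power_increasing) auto
    also have "\<dots> \<le> 4 ^ 4" using ef4 by (intro power_mono) auto
    finally show "card (e \<union> f) ^ card U \<le> 4 ^ 4" .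
    show "n ^ (card V - card U) \<le> n ^ (card V - 3)"
      using n1 U3 by (intro power_increasing) auto
  qed auto
  finally show "card {\<psi> \<in> inj_maps V {1..n}. \<psi> ` a = e \<and> \<psi> ` a' = f} \<le> 4 ^ 4 * n ^ (card V - 3)" .
qed

lemma ex_permutes_extending:
  assumes "finite S" "D \<subseteq> S" "inj_on f D" "f ` D \<subseteq> S"
  shows "\<exists>\<tau>. \<tau> permutes S \<and> (\<forall>x\<in>D. \<tau> x = f x)"
proof -
  have fin: "finite D" using assms finite_subset by auto
  have "card (S - D) = card (S - f ` D)"
    using assms fin by (simp add: card_Diff_subset card_image)
  then obtain g where g: "bij_betw g (S - D) (S - f ` D)"
    using assms(1) by (metis finite_Diff finite_same_card_bij)
  define \<tau> where "\<tau> = (\<lambda>x. if x \<in> D then f x else if x \<in> S then g x else x)"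
  have "bij_betw \<tau> D (f ` D)"
    using assms(3) by (intro bij_betw_imageI) (auto simp: \<tau>_def inj_on_def)
  moreover have "bij_betw \<tau> (S - D) (S - f ` D)"
    using g by (subst bij_betw_cong[of _ _ g]) (auto simp: \<tau>_def)
  ultimately have "bij_betw \<tau> (D \<union> (S - D)) (f ` D \<union> (S - f ` D))"
    by (intro bij_betw_combine) auto
  then have "bij_betw \<tau> S S" using assms by (simp add: Un_absorb1)
  then have "\<tau> permutes S"
    using assms(2) by (intro bij_imp_permutes) (auto simp: \<tau>_def)
  then show ?thesis by (auto simp: \<tau>_def)
qed

section \<open>The exponential random graph model\<close>

text \<open>Descent to a threshold from above: the infimum of the admissible thresholds cannot exceed
  \<open>l\<close>, because \<open>F\<close> would map it strictly below itself.\<close>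

lemma threshold_descent:
  fixes F :: "real \<Rightarrow> real"
  assumes cont: "\<And>u. isCont F u" and "P b"
    and step: "\<And>u v. P u \<Longrightarrow> F u < v \<Longrightarrow> P v"
    and up: "\<And>u v. P u \<Longrightarrow> u \<le> v \<Longrightarrow> P v"
    and below: "\<And>u. l < u \<Longrightarrow> F u < u"
    and "l < u"
  shows "P u"
proof (rule ccontr)
  assume not: "\<not> P u"
  have lower: "u < v" if "P v" for v
    using up[OF that] not by (meson not_le)
  define i where "i = Inf {v. P v}"
  have bdd: "bdd_below {v. P v}" using lower by (auto intro!: bdd_belowI[of _ u] less_imp_le)
  have "u \<le> i" unfolding i_def using \<open>P b\<close> lower by (intro cInf_greatest) (auto intro: less_imp_le)
  then have "F i < i" using \<open>l < u\<close> by (intro below) simp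
  \<comment> \<open>By continuity \<open>F v < w\<close> for admissible \<open>v\<close> close
    enough to the infimum \<open>i\<close>, so \<open>w < i\<close> would be admissible too.\<close>
  define w where "w = (F i + i) / 2"
  have w: "F i < w" "w < i" using \<open>F i < i\<close> by (auto simp: w_def)
  have "eventually (\<lambda>v. F v < w) (nhds i)"
    using order_tendstoD(2)[OF cont[of i, unfolded continuous_at] w(1)] w(1)
    by (auto simp: eventually_at_filter elim: eventually_mono)
  then obtain d where d: "d > 0" "\<And>v. dist v i < d \<Longrightarrow> F v < w"
    by (auto simp: eventually_nhds_metric)
  have "Inf {v. P v} < i + d" using d(1) by (simp add: i_def)
  then obtain v where v: "P v" "v < i + d"
    using cInf_lessD[of "{v. P v}" "i + d"] \<open>P b\<close> by auto
  have "i \<le> v" unfolding i_def using v(1) bdd by (intro cInf_lower) auto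
  then have "F v < w" using v(2) by (intro d(2)) (auto simp: dist_real_def)
  then have "P w" by (rule step[OF v(1)])
  then have "i \<le> w" unfolding i_def using bdd by (intro cInf_lower) auto
  then show False using w by simp
qed

section \<open>The random graph model as a ferromagnetic interaction of edges\<close>

locale ergm_model =
  fixes s :: nat and \<beta> :: "nat \<Rightarrow> real" and G :: "nat \<Rightarrow> 'v graph"
  assumes simple: "\<And>i. i \<in> {1..s} \<Longrightarrow> finite_simple_graph (G i)"
    and \<beta>_pos: "\<And>i. i \<in> {1..s} \<Longrightarrow> 0 < \<beta> i"
begin

text \<open>Indexed by injections and not by edge sets, since injections with the same image count
  separately in the Hamiltonian.\<close>

definition copies :: "nat \<Rightarrow> (nat \<times> ('v \<Rightarrow> nat)) set" where
  "copies n = Sigma {1..s} (\<lambda>i. inj_maps (verts (G i)) {1..n})"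

definition weight :: "nat \<Rightarrow> nat \<times> ('v \<Rightarrow> nat) \<Rightarrow> real" where
  "weight n j = \<beta> (fst j) / real n powi (int (card (verts (G (fst j)))) - 2)"

definition copy :: "nat \<times> ('v \<Rightarrow> nat) \<Rightarrow> nat set set" where
  "copy j = (\<lambda>a. snd j ` a) ` edges (G (fst j))"


lemma fin: "i \<in> {1..s} \<Longrightarrow> finite (verts (G i))" "i \<in> {1..s} \<Longrightarrow> finite (edges (G i))"
  using simple[of i] finite_edges_on[of "verts (G i)"]
    finite_subset[of "edges (G i)" "edges_on (verts (G i))"]
  by (auto simp: finite_simple_graph_def)

lemma edge_in: "i \<in> {1..s} \<Longrightarrow> a \<in> edges (G i) \<Longrightarrow> a \<in> edges_on (verts (G i))"
  using simple[of i] by (auto simp: finite_simple_graph_def)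

lemma copy_edge_eq_iff:
  assumes "i \<in> {1..s}" "\<psi> \<in> inj_maps (verts (G i)) B" "a \<in> edges (G i)" "a' \<in> edges (G i)"
  shows "\<psi> ` a = \<psi> ` a' \<longleftrightarrow> a = a'"
  using assms edge_in[OF assms(1,3)] edge_in[OF assms(1,4)]
  by (intro inj_on_image_eq_iff[of _ "verts (G i)"]) (auto simp: inj_maps_def edges_on_def)

lemma card_copy:
  assumes "j \<in> copies n"
  shows "card (copy j) = card (edges (G (fst j)))"
  unfolding copy_def using assms copy_edge_eq_iff[of "fst j" "snd j"]
  by (intro card_image inj_onI) (auto simp: copies_def)

lemma weight_nonneg: "j \<in> copies n \<Longrightarrow> 0 \<le> weight n j"
  using \<beta>_pos[of "fst j"] by (auto simp: copies_def weight_def intro!: divide_nonneg_nonneg)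

lemma interaction: "interaction (complete_edges n) (copies n) (weight n) copy"
proof
  show "finite (complete_edges n)" by (intro finite_edges_on) simp
  show "finite (copies n)"
    unfolding copies_def by (intro finite_SigmaI finite_inj_maps fin) auto
  fix j assume j: "j \<in> copies n"
  show "0 \<le> weight n j" by (rule weight_nonneg[OF j])
  show "copy j \<subseteq> complete_edges n"
  proof
    fix e assume "e \<in> copy j"
    then obtain a where a: "a \<in> edges (G (fst j))" "e = snd j ` a" by (auto simp: copy_def)
    have i: "fst j \<in> {1..s}" "snd j \<in> inj_maps (verts (G (fst j))) {1..n}"
      using j by (auto simp: copies_def)
    have "a \<subseteq> verts (G (fst j))" "card a = 2" using edge_in[OF i(1) a(1)] by (auto simp: edges_on_def)
    moreover have "inj_on (snd j) (verts (G (fst j)))" "snd j \<in> verts (G (fst j)) \<rightarrow> {1..n}"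
      using i(2) by (auto simp: inj_maps_def)
    ultimately have "snd j ` a \<subseteq> {1..n}" "card (snd j ` a) = 2"
      using card_image[OF inj_on_subset[of "snd j" _ a]] by (auto simp: Pi_def)
    then show "e \<in> complete_edges n" by (simp add: a(2) edges_on_def)
  qed
qed

sublocale gm: interaction "complete_edges n" "copies n" "weight n" copy for n
  by (rule interaction)

text \<open>Tends to twice the number of edges of \<open>G i\<close>: any of them may land on
  \<open>e\<close>, in two orientations, and each other vertex has about \<open>n\<close> choices.
  This is the 2 in \<open>Psi\<close>.\<close>

definition mult :: "nat \<Rightarrow> nat \<Rightarrow> nat set \<Rightarrow> real" where
  "mult n i e = real (card {\<psi> \<in> inj_maps (verts (G i)) {1..n}. e \<in> copy (i, \<psi>)})
     / real n powi (int (card (verts (G i))) - 2)"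

lemma sum_copies:
  "(\<Sum>j\<in>{j\<in>copies n. e \<in> copy j}. weight n j * h (fst j)) = (\<Sum>i=1..s. \<beta> i * mult n i e * h i)"
proof -
  have "{j\<in>copies n. e \<in> copy j} = Sigma {1..s} (\<lambda>i. {\<psi> \<in> inj_maps (verts (G i)) {1..n}. e \<in> copy (i, \<psi>)})"
    by (auto simp: copies_def)
  then have "(\<Sum>j\<in>{j\<in>copies n. e \<in> copy j}. weight n j * h (fst j))
      = (\<Sum>i=1..s. \<Sum>\<psi>\<in>{\<psi> \<in> inj_maps (verts (G i)) {1..n}. e \<in> copy (i, \<psi>)}. weight n (i, \<psi>) * h i)"
    by (subst sum.Sigma) (auto simp: finite_inj_maps fin case_prod_beta)
  also have "\<dots> = (\<Sum>i=1..s. \<beta> i * mult n i e * h i)"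
    by (intro sum.cong) (auto simp: weight_def mult_def)
  finally show ?thesis .
qed

lemma card_copies_through_edge:
  assumes i: "i \<in> {1..s}"
  shows "card {\<psi> \<in> inj_maps (verts (G i)) {1..n}. e \<in> copy (i, \<psi>)}
    = (\<Sum>a\<in>edges (G i). card {\<psi> \<in> inj_maps (verts (G i)) {1..n}. \<psi> ` a = e})"
proof -
  have "{\<psi> \<in> inj_maps (verts (G i)) {1..n}. e \<in> copy (i, \<psi>)}
      = (\<Union>a\<in>edges (G i). {\<psi> \<in> inj_maps (verts (G i)) {1..n}. \<psi> ` a = e})"
    by (auto simp: copy_def)
  also have "card \<dots> = (\<Sum>a\<in>edges (G i). card {\<psi> \<in> inj_maps (verts (G i)) {1..n}. \<psi> ` a = e})"
    using fin[OF i] copy_edge_eq_iff[OF i]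
    by (intro card_UN_disjoint) (auto simp: finite_inj_maps)
  finally show ?thesis .
qed

lemma pos_of_edge: "e \<in> complete_edges n \<Longrightarrow> 0 < n"
  by (cases n) (auto simp: edges_on_def)

lemma two_le_card_verts:
  assumes "i \<in> {1..s}" "a \<in> edges (G i)"
  shows "2 \<le> card (verts (G i))"
  using edge_in[OF assms] fin(1)[OF assms(1)] by (auto simp: edges_on_def dest: card_mono)

lemma powi_card_verts:
  assumes "i \<in> {1..s}" "a \<in> edges (G i)"
  shows "real n powi (int (card (verts (G i))) - 2) = real n ^ (card (verts (G i)) - 2)"
  using two_le_card_verts[OF assms] by (simp add: power_int_def nat_diff_distrib)

text \<open>Injectivity only removes maps, so the limit is an upper bound for every
  \<open>n\<close>; the lower bound carries a factor that tends to 1.\<close>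

lemma mult_bounds:
  assumes i: "i \<in> {1..s}" and e: "e \<in> complete_edges n"
  shows "mult n i e \<le> 2 * real (card (edges (G i)))" (is ?upper)
    "2 * real (card (edges (G i))) * (real (n - card (verts (G i))) / real n) ^ card (verts (G i)) \<le> mult n i e"
      (is ?lower)
proof -
  define V where "V = card (verts (G i))"
  have "?upper \<and> ?lower"
  proof (cases "edges (G i) = {}")
    case True
    then show ?thesis by (simp add: mult_def copy_def)
  next
    case False
    then obtain a0 where a0: "a0 \<in> edges (G i)" by auto
    have n: "0 < real n" using pos_of_edge[OF e] by simp
    note b = card_inj_maps_edge_bounds[OF fin(1)[OF i] edge_in[OF i] e]
    let ?S = "\<Sum>a\<in>edges (G i). real (card {\<psi> \<in> inj_maps (verts (G i)) {1..n}. \<psi> ` a = e})"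
    have m: "mult n i e = ?S / real n ^ (V - 2)"
      unfolding mult_def card_copies_through_edge[OF i] powi_card_verts[OF i a0] V_def by simp
    have "?S \<le> (\<Sum>a\<in>edges (G i). 2 * real n ^ (V - 2))"
    proof (rule sum_mono)
      fix a assume "a \<in> edges (G i)"
      from of_nat_mono[OF b(1)[OF this], where 'a = real]
      show "real (card {\<psi> \<in> inj_maps (verts (G i)) {1..n}. \<psi> ` a = e}) \<le> 2 * real n ^ (V - 2)"
        by (simp add: V_def)
    qed
    then have ?upper using n by (simp add: m divide_le_eq mult_ac)
    have "(\<Sum>a\<in>edges (G i). 2 * real (n - V) ^ (V - 2)) \<le> ?S"
    proof (rule sum_mono)
      fix a assume "a \<in> edges (G i)"
      from of_nat_mono[OF b(2)[OF this], where 'a = real]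
      show "2 * real (n - V) ^ (V - 2) \<le> real (card {\<psi> \<in> inj_maps (verts (G i)) {1..n}. \<psi> ` a = e})"
        by (simp add: V_def)
    qed
    then have "2 * real (card (edges (G i))) * (real (n - V) / real n) ^ (V - 2) \<le> mult n i e"
      using n by (simp add: m power_divide divide_right_mono mult_ac)
    \<comment> \<open>Enlarging the exponent from \<open>V - 2\<close> to \<open>V\<close> is
      harmless, as the base is at most 1, and gives the simpler form used in
      \<open>Psi_lower\<close>.\<close>
    moreover have "(real (n - V) / real n) ^ V \<le> (real (n - V) / real n) ^ (V - 2)"
      using n by (intro power_decreasing) (auto simp: divide_le_eq)
    then have "2 * real (card (edges (G i))) * (real (n - V) / real n) ^ V
        \<le> 2 * real (card (edges (G i))) * (real (n - V) / real n) ^ (V - 2)"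
      by (intro mult_left_mono) auto
    ultimately have ?lower unfolding V_def by linarith
    with \<open>?upper\<close> show ?thesis ..
  qed
  then show ?upper ?lower by auto
qed

section \<open>Mean local fields under independent edges, and their slopes\<close>

definition dPsi :: "real \<Rightarrow> real" where
  "dPsi p = (\<Sum>i=1..s. 2 * \<beta> i * real (card (edges (G i))) *
     (real (card (edges (G i)) - 1) * p ^ (card (edges (G i)) - 2)))"

lemma DERIV_Psi: "(Psi s \<beta> G has_real_derivative dPsi p) (at p)"
  unfolding Psi_def[abs_def] dPsi_def
proof (intro DERIV_sum)
  fix i
  have "((\<lambda>p. p ^ (card (edges (G i)) - 1)) has_real_derivative
      real (card (edges (G i)) - 1) * p ^ (card (edges (G i)) - 2)) (at p)"
    using DERIV_pow[of "card (edges (G i)) - 1" p] by (simp add: numeral_2_eq_2)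
  then show "((\<lambda>p. 2 * \<beta> i * real (card (edges (G i))) * p ^ (card (edges (G i)) - 1)) has_real_derivative
      2 * \<beta> i * real (card (edges (G i))) *
        (real (card (edges (G i)) - 1) * p ^ (card (edges (G i)) - 2))) (at p)"
    by (rule DERIV_cmult)
qed

lemma isCont_Psi: "isCont (Psi s \<beta> G) p"
  by (rule DERIV_isCont[OF DERIV_Psi])

lemma isCont_dPsi: "isCont dPsi p"
  unfolding dPsi_def[abs_def] by (intro continuous_intros)

lemma dPsi_nonneg: "0 \<le> p \<Longrightarrow> 0 \<le> dPsi p"
  unfolding dPsi_def using \<beta>_pos by (intro sum_nonneg mult_nonneg_nonneg) (auto intro: less_imp_le)

lemma Psi_nonneg: "0 \<le> p \<Longrightarrow> 0 \<le> Psi s \<beta> G p"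
  unfolding Psi_def using \<beta>_pos by (intro sum_nonneg mult_nonneg_nonneg) (auto intro: less_imp_le)

lemma Psi_mono: "0 \<le> p \<Longrightarrow> p \<le> q \<Longrightarrow> Psi s \<beta> G p \<le> Psi s \<beta> G q"
  unfolding Psi_def using \<beta>_pos
  by (intro sum_mono mult_left_mono power_mono mult_nonneg_nonneg) (auto intro: less_imp_le)

lemma sum_copies_le:
  assumes e: "e \<in> complete_edges n" and h: "\<And>i. 0 \<le> h i"
  shows "(\<Sum>j\<in>{j\<in>copies n. e \<in> copy j}. weight n j * h (fst j))
    \<le> (\<Sum>i=1..s. 2 * \<beta> i * real (card (edges (G i))) * h i)"
  unfolding sum_copies
proof (rule sum_mono)
  fix i assume i: "i \<in> {1..s}"
  have "\<beta> i * mult n i e * h i \<le> \<beta> i * (2 * real (card (edges (G i)))) * h i"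
    using mult_bounds(1)[OF i e] \<beta>_pos[OF i] h[of i] by (intro mult_right_mono mult_left_mono) auto
  then show "\<beta> i * mult n i e * h i \<le> 2 * \<beta> i * real (card (edges (G i))) * h i"
    by (simp add: mult_ac)
qed

text \<open>The left-hand side is the mean of \<open>gm.dH n e\<close> under independent edges of
  density \<open>q\<close>: \<open>Psi\<close> is the mean-field map from densities to
  fields.\<close>

lemma mean_DH_le:
  assumes "e \<in> complete_edges n" "0 \<le> q"
  shows "(\<Sum>j\<in>{j\<in>copies n. e \<in> copy j}. weight n j * q ^ (card (copy j) - 1)) \<le> Psi s \<beta> G q"
proof -
  have "(\<Sum>j\<in>{j\<in>copies n. e \<in> copy j}. weight n j * q ^ (card (copy j) - 1))
      = (\<Sum>j\<in>{j\<in>copies n. e \<in> copy j}. weight n j * q ^ (card (edges (G (fst j))) - 1))"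
    by (intro sum.cong) (auto simp: card_copy)
  also have "\<dots> \<le> Psi s \<beta> G q"
    unfolding Psi_def using assms by (intro sum_copies_le) auto
  finally show ?thesis .
qed

definition Psi_lower :: "nat \<Rightarrow> real \<Rightarrow> real" where
  "Psi_lower n p = (\<Sum>i=1..s. 2 * \<beta> i * real (card (edges (G i))) *
     (real (n - card (verts (G i))) / real n) ^ card (verts (G i)) * p ^ (card (edges (G i)) - 1))"

lemma mean_DH_ge:
  assumes e: "e \<in> complete_edges n" and q: "0 \<le> q"
  shows "Psi_lower n q \<le> (\<Sum>j\<in>{j\<in>copies n. e \<in> copy j}. weight n j * q ^ (card (copy j) - 1))"
proof -
  have "(\<Sum>j\<in>{j\<in>copies n. e \<in> copy j}. weight n j * q ^ (card (copy j) - 1))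
      = (\<Sum>j\<in>{j\<in>copies n. e \<in> copy j}. weight n j * q ^ (card (edges (G (fst j))) - 1))"
    by (intro sum.cong) (auto simp: card_copy)
  also have "\<dots> = (\<Sum>i=1..s. \<beta> i * mult n i e * q ^ (card (edges (G i)) - 1))"
    by (rule sum_copies)
  also have "\<dots> \<ge> Psi_lower n q"
    unfolding Psi_lower_def
  proof (rule sum_mono)
    fix i assume i: "i \<in> {1..s}"
    let ?r = "(real (n - card (verts (G i))) / real n) ^ card (verts (G i))"
    have "\<beta> i * (2 * real (card (edges (G i))) * ?r) * q ^ (card (edges (G i)) - 1)
        \<le> \<beta> i * mult n i e * q ^ (card (edges (G i)) - 1)"
      using mult_bounds(2)[OF i e] \<beta>_pos[OF i] q by (intro mult_right_mono mult_left_mono) auto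
    then show "2 * \<beta> i * real (card (edges (G i))) * ?r * q ^ (card (edges (G i)) - 1)
        \<le> \<beta> i * mult n i e * q ^ (card (edges (G i)) - 1)"
      by (simp add: mult_ac)
  qed
  finally show ?thesis .
qed

lemma Psi_lower_tendsto: "(\<lambda>n. Psi_lower n q) \<longlonglongrightarrow> Psi s \<beta> G q"
proof -
  have r: "(\<lambda>n. real (n - V) / real n) \<longlonglongrightarrow> 1" for V
  proof -
    have "(\<lambda>n. 1 - real V / real n) \<longlonglongrightarrow> 1 - 0"
      by (intro tendsto_intros lim_const_over_n)
    moreover have "\<forall>\<^sub>F n in sequentially. 1 - real V / real n = real (n - V) / real n"
      using eventually_ge_at_top[of "V + 1"] by eventually_elim (auto simp: of_nat_diff field_simps)
    ultimately show ?thesis by (simp add: tendsto_cong)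
  qed
  have "(\<lambda>n. Psi_lower n q) \<longlonglongrightarrow> (\<Sum>i=1..s. 2 * \<beta> i * real (card (edges (G i))) *
      1 ^ card (verts (G i)) * q ^ (card (edges (G i)) - 1))"
    unfolding Psi_lower_def by (intro tendsto_intros r)
  then show ?thesis by (simp add: Psi_def)
qed

text \<open>The left-hand side is the mean of \<open>gm.ddH n e\<close> under independent edges of
  density \<open>q\<close>; the factor \<open>card (copy j) - 1\<close> appears on both sides, once
  from counting and once from differentiating.\<close>

lemma mean_DDH_le:
  assumes "e \<in> complete_edges n" "0 \<le> q"
  shows "(\<Sum>j\<in>{j\<in>copies n. e \<in> copy j}. real (card (copy j) - 1) * (weight n j * q ^ (card (copy j) - 2)))
    \<le> dPsi q"
proof -
  have "(\<Sum>j\<in>{j\<in>copies n. e \<in> copy j}. real (card (copy j) - 1) * (weight n j * q ^ (card (copy j) - 2)))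
      = (\<Sum>j\<in>{j\<in>copies n. e \<in> copy j}. weight n j *
          (real (card (edges (G (fst j))) - 1) * q ^ (card (edges (G (fst j))) - 2)))"
    by (intro sum.cong) (auto simp: card_copy)
  also have "\<dots> \<le> dPsi q"
    unfolding dPsi_def using assms
    by (intro sum_copies_le[where h = "\<lambda>i. real (card (edges (G i)) - 1) * q ^ (card (edges (G i)) - 2)"]) auto
  finally show ?thesis .
qed

text \<open>At density 1 all indicators in the mean second difference equal 1, which leaves the
  plain sum of the couplings.\<close>

lemma sum_coupling_le:
  assumes e: "e \<in> complete_edges n"
  shows "(\<Sum>f\<in>complete_edges n - {e}. gm.coupling n e f) \<le> dPsi 1"
  using mean_DDH_le[OF e, of 1] unfolding gm.coupling_def gm.sum_coupling_swap[OF e] by simp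

definition coupling_const :: real where
  "coupling_const = (\<Sum>i=1..s. \<beta> i * (4 ^ 4 * (real (card (edges (G i))))\<^sup>2))"

lemma coupling_const_nonneg: "0 \<le> coupling_const"
  unfolding coupling_const_def
  using \<beta>_pos by (intro sum_nonneg mult_nonneg_nonneg) (auto intro: less_imp_le)

text \<open>Two distinct edges have at least three end points, so only order
  \<open>n ^ (V - 3)\<close> copies contain both, against a weight of order
  \<open>1 / n ^ (V - 2)\<close>. The squared number of edges counts the possible pairs of
  preimages.\<close>

lemma coupling_le:
  assumes e: "e \<in> complete_edges n" and f: "f \<in> complete_edges n" and "e \<noteq> f"
  shows "gm.coupling n e f \<le> coupling_const / real n"
proof -
  have n: "0 < real n" using pos_of_edge[OF e] by simp
  define S where "S = (\<lambda>i. {\<psi> \<in> inj_maps (verts (G i)) {1..n}. e \<in> copy (i, \<psi>) \<and> f \<in> copy (i, \<psi>)})"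
  have "{j\<in>copies n. e \<in> copy j \<and> f \<in> copy j} = Sigma {1..s} S"
    by (auto simp: copies_def S_def)
  then have "gm.coupling n e f = (\<Sum>i=1..s. \<Sum>\<psi>\<in>S i. weight n (i, \<psi>))"
    unfolding gm.coupling_def by (subst sum.Sigma) (auto simp: finite_inj_maps fin S_def)
  also have "\<dots> = (\<Sum>i=1..s. real (card (S i)) * (\<beta> i / real n powi (int (card (verts (G i))) - 2)))"
    by (simp add: weight_def)
  also have "\<dots> \<le> (\<Sum>i=1..s. \<beta> i * (4 ^ 4 * (real (card (edges (G i))))\<^sup>2) / real n)"
  proof (rule sum_mono)
    fix i assume i: "i \<in> {1..s}"
    show "real (card (S i)) * (\<beta> i / real n powi (int (card (verts (G i))) - 2))
      \<le> \<beta> i * (4 ^ 4 * (real (card (edges (G i))))\<^sup>2) / real n"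
    proof (cases "S i = {}")
      case True
      then show ?thesis using \<beta>_pos[OF i] by simp
    next
      case False
      then obtain \<psi> a a' where \<psi>: "a \<in> edges (G i)" "a' \<in> edges (G i)" "e = \<psi> ` a" "f = \<psi> ` a'"
        by (auto simp: S_def copy_def)
      then have "a \<noteq> a'" using \<open>e \<noteq> f\<close> by auto
      define V where "V = card (verts (G i))"
      have V3: "3 \<le> V"
        unfolding V_def
        by (rule card_inj_maps_two_edges_le(2)[OF fin(1)[OF i] edge_in[OF i \<psi>(1)] edge_in[OF i \<psi>(2)]
              \<open>a \<noteq> a'\<close> e f])
      define Q where "Q = {(a, a'). a \<in> edges (G i) \<and> a' \<in> edges (G i) \<and> a \<noteq> a'}"
      have Q: "Q \<subseteq> edges (G i) \<times> edges (G i)" "finite (edges (G i) \<times> edges (G i))"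
        using fin[OF i] by (auto simp: Q_def)
      define R where "R = (\<lambda>p. {\<psi> \<in> inj_maps (verts (G i)) {1..n}. \<psi> ` fst p = e \<and> \<psi> ` snd p = f})"
      have finQ: "finite Q" by (rule finite_subset[OF Q])
      have finR: "finite (R p)" for p
        unfolding R_def using fin[OF i] by (simp add: finite_inj_maps)
      have "S i \<subseteq> (\<Union>p\<in>Q. R p)"
        using \<open>e \<noteq> f\<close> by (auto simp: S_def Q_def R_def copy_def)
      then have "card (S i) \<le> card (\<Union>p\<in>Q. R p)"
        using finQ finR by (intro card_mono finite_UN_I) auto
      also have "\<dots> \<le> (\<Sum>p\<in>Q. card (R p))"
        by (rule card_UN_le[OF finQ])
      also have "\<dots> \<le> (\<Sum>p\<in>Q. 4 ^ 4 * n ^ (V - 3))"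
      proof (rule sum_mono)
        fix p assume "p \<in> Q"
        then show "card (R p) \<le> 4 ^ 4 * n ^ (V - 3)"
          unfolding R_def V_def using e f
          by (intro card_inj_maps_two_edges_le(1) fin[OF i] edge_in[OF i]) (auto simp: Q_def)
      qed
      also have "\<dots> \<le> card (edges (G i) \<times> edges (G i)) * (4 ^ 4 * n ^ (V - 3))"
        using card_mono[OF Q(2,1)] by simp
      finally have "real (card (S i)) \<le> real (card (edges (G i) \<times> edges (G i)) * (4 ^ 4 * n ^ (V - 3)))"
        by (rule of_nat_mono)
      then have "real (card (S i)) \<le> (4 ^ 4 * (real (card (edges (G i))))\<^sup>2) * real n ^ (V - 3)"
        by (simp add: card_cartesian_product power2_eq_square mult_ac)
      then have "real (card (S i)) * (\<beta> i / real n ^ (V - 2))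
          \<le> (4 ^ 4 * (real (card (edges (G i))))\<^sup>2) * real n ^ (V - 3) * (\<beta> i / real n ^ (V - 2))"
        using \<beta>_pos[OF i] by (intro mult_right_mono) auto
      also have "\<dots> = \<beta> i * (4 ^ 4 * (real (card (edges (G i))))\<^sup>2) / real n"
      proof -
        have "V - 2 = Suc (V - 3)" using V3 by simp
        then have "real n ^ (V - 2) = real n ^ (V - 3) * real n" by simp
        then show ?thesis using n by simp
      qed
      finally show ?thesis
        unfolding powi_card_verts[OF i \<psi>(1)] V_def .
    qed
  qed
  finally show ?thesis by (simp add: coupling_const_def sum_divide_distrib)
qed

text \<open>With \<open>\<sigma> = 1\<close> the local fields rarely exceed \<open>u\<close>, with \<open>\<sigma> = -1\<close> they rarely fall below.\<close>

definition good :: "real \<Rightarrow> real \<Rightarrow> bool" where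
  "good \<sigma> u \<longleftrightarrow> (\<exists>c. \<forall>\<^sub>F n in sequentially. \<forall>e\<in>complete_edges n.
     gm.ex n (\<lambda>A. max 0 (\<sigma> * (gm.dH n e A - u))) \<le> c / real n)"

lemma good_obtain:
  assumes "good \<sigma> u"
  obtains c where "0 \<le> c" "\<forall>\<^sub>F n in sequentially. \<forall>e\<in>complete_edges n.
     gm.ex n (\<lambda>A. max 0 (\<sigma> * (gm.dH n e A - u))) \<le> c / real n"
proof -
  from assms obtain c where c: "\<forall>\<^sub>F n in sequentially. \<forall>e\<in>complete_edges n.
     gm.ex n (\<lambda>A. max 0 (\<sigma> * (gm.dH n e A - u))) \<le> c / real n" by (auto simp: good_def)
  have "\<forall>\<^sub>F n in sequentially. \<forall>e\<in>complete_edges n.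
     gm.ex n (\<lambda>A. max 0 (\<sigma> * (gm.dH n e A - u))) \<le> \<bar>c\<bar> / real n"
    using c
  proof eventually_elim
    case (elim n)
    have "c / real n \<le> \<bar>c\<bar> / real n" by (intro divide_right_mono) auto
    with elim show ?case by (auto intro: order_trans)
  qed
  then show thesis by (intro that[of "\<bar>c\<bar>"]) auto
qed

lemma good_mono:
  assumes "good \<sigma> u" "\<sigma> * u \<le> \<sigma> * v"
  shows "good \<sigma> v"
proof -
  from assms(1) obtain c where c: "\<forall>\<^sub>F n in sequentially. \<forall>e\<in>complete_edges n.
     gm.ex n (\<lambda>A. max 0 (\<sigma> * (gm.dH n e A - u))) \<le> c / real n" by (auto simp: good_def)
  have le: "gm.ex n (\<lambda>A. max 0 (\<sigma> * (gm.dH n e A - v))) \<le> gm.ex n (\<lambda>A. max 0 (\<sigma> * (gm.dH n e A - u)))" for n e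
    using assms(2) by (intro gm.ex_mono) (auto simp: algebra_simps max_def)
  have "\<forall>\<^sub>F n in sequentially. \<forall>e\<in>complete_edges n.
     gm.ex n (\<lambda>A. max 0 (\<sigma> * (gm.dH n e A - v))) \<le> c / real n"
    using c by eventually_elim (blast intro: order_trans[OF le])
  then show ?thesis by (auto simp: good_def)
qed

text \<open>Under independent edges of density \<open>Phi u\<close> the field has mean close to
  \<open>Psi s \<beta> G (Phi u)\<close> and variance of order \<open>1/n\<close>. A threshold at
  fixed distance beyond that mean has excess of order \<open>1/n\<close>, and the comparison adds
  only a bounded multiple of the excess over \<open>u\<close>.\<close>

lemma good_step:
  assumes good: "good \<sigma> u" and \<sigma>: "\<bar>\<sigma>\<bar> = 1" and gap: "0 < \<sigma> * (\<kappa> - Psi s \<beta> G (Phi u))"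
  shows "good \<sigma> \<kappa>"
proof -
  \<comment> \<open>Half of the gap is kept in reserve: for \<open>\<sigma> = -1\<close> the lower
    bound on the mean field reaches \<open>Psi\<close> only in the limit.\<close>
  define g where "g = \<sigma> * (\<kappa> - Psi s \<beta> G (Phi u)) / 2"
  have g: "0 < g" using gap by (simp add: g_def)
  define q where "q = Phi u"
  have q: "0 \<le> q" using Phi_bounds[of u] by (simp add: q_def)
  define B where "B = dPsi 1"
  obtain c where c: "0 \<le> c" "\<forall>\<^sub>F n in sequentially. \<forall>e\<in>complete_edges n.
     gm.ex n (\<lambda>A. max 0 (\<sigma> * (gm.dH n e A - u))) \<le> c / real n"
    by (rule good_obtain[OF good])
  have mean: "\<forall>\<^sub>F n in sequentially. \<forall>e\<in>complete_edges n. g \<le> \<sigma> * (\<kappa> -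
      (\<Sum>j\<in>{j\<in>copies n. e \<in> copy j}. weight n j * q ^ (card (copy j) - 1)))"
  proof (cases "\<sigma> = 1")
    case True
    show ?thesis
    proof (intro always_eventually allI ballI)
      fix n e assume "e \<in> complete_edges n"
      from mean_DH_le[OF this q] show "g \<le> \<sigma> * (\<kappa> -
          (\<Sum>j\<in>{j\<in>copies n. e \<in> copy j}. weight n j * q ^ (card (copy j) - 1)))"
        using gap by (simp add: True g_def q_def)
    qed
  next
    case False
    then have \<sigma>1: "\<sigma> = -1" using \<sigma> by auto
    have "\<kappa> + g < Psi s \<beta> G q" using gap by (simp add: \<sigma>1 g_def q_def field_simps)
    then have "\<forall>\<^sub>F n in sequentially. \<kappa> + g < Psi_lower n q"
      using Psi_lower_tendsto[of q] by (rule order_tendstoD(1)[rotated])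
    then show ?thesis
    proof eventually_elim
      case (elim n)
      show ?case
      proof
        fix e assume "e \<in> complete_edges n"
        from mean_DH_ge[OF this q] show "g \<le> \<sigma> * (\<kappa> -
            (\<Sum>j\<in>{j\<in>copies n. e \<in> copy j}. weight n j * q ^ (card (copy j) - 1)))"
          using elim by (simp add: \<sigma>1)
      qed
    qed
  qed
  have "\<forall>\<^sub>F n in sequentially. \<forall>e\<in>complete_edges n.
     gm.ex n (\<lambda>A. max 0 (\<sigma> * (gm.dH n e A - \<kappa>))) \<le> (coupling_const * B / (16 * g) + B * c) / real n"
    using c(2) mean
  proof eventually_elim
    case (elim n)
    show ?case
    proof
      fix e assume e: "e \<in> complete_edges n"
      have "gm.ex n (\<lambda>A. max 0 (\<sigma> * (gm.dH n e A - \<kappa>)))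
          \<le> coupling_const / real n * B / (16 * g) + B * (c / real n)"
      proof (rule gm.ex_dH_excess_le[OF e \<sigma>])
        show "(\<Sum>f\<in>complete_edges n - {e}. gm.coupling n e f) \<le> B"
          unfolding B_def by (rule sum_coupling_le[OF e])
        show "gm.coupling n e f \<le> coupling_const / real n" if "f \<in> complete_edges n - {e}" for f
          using that e by (intro coupling_le) auto
        show "0 < g" by (rule g)
        show "g \<le> \<sigma> * (\<kappa> - (\<Sum>j\<in>{j\<in>copies n. e \<in> copy j}. weight n j * Phi u ^ (card (copy j) - 1)))"
          using elim(2) e by (simp add: q_def)
      qed (use elim c(1) coupling_const_nonneg in auto)
      also have "\<dots> = (coupling_const * B / (16 * g) + B * c) / real n"
        by (simp add: add_divide_distrib mult_ac)
      finally show "gm.ex n (\<lambda>A. max 0 (\<sigma> * (gm.dH n e A - \<kappa>))) \<le> (coupling_const * B / (16 * g) + B * c) / real n" .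
    qed
  qed
  then show ?thesis by (auto simp: good_def)
qed

section \<open>Descent of the thresholds to the unique fixed point\<close>

lemma DH_bounds:
  assumes "e \<in> complete_edges n"
  shows "0 \<le> gm.dH n e A" "gm.dH n e A \<le> Psi s \<beta> G 1"
proof -
  show "0 \<le> gm.dH n e A"
    unfolding gm.dH_def by (intro sum_nonneg mult_nonneg_nonneg weight_nonneg) auto
  have "gm.dH n e A \<le> (\<Sum>j\<in>{j\<in>copies n. e \<in> copy j}. weight n j * 1 ^ (card (copy j) - 1))"
    unfolding gm.dH_def by (intro sum_mono mult_left_mono weight_nonneg) auto
  also have "\<dots> \<le> Psi s \<beta> G 1" by (rule mean_DH_le[OF assms]) simp
  finally show "gm.dH n e A \<le> Psi s \<beta> G 1" .
qed

text \<open>The descent starts from \<open>Psi s \<beta> G 1\<close>, which no local field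
  exceeds.\<close>

lemma good_upper:
  assumes "\<And>u. l < u \<Longrightarrow> Psi s \<beta> G (Phi u) < u" "l < u"
  shows "good 1 u"
proof (rule threshold_descent[where F = "\<lambda>u. Psi s \<beta> G (Phi u)" and P = "good 1" and l = l])
  show "isCont (\<lambda>u. Psi s \<beta> G (Phi u)) u" for u
    by (rule isCont_o2[OF isCont_Phi isCont_Psi])
  show "good 1 (Psi s \<beta> G 1)"
    unfolding good_def
  proof (intro exI[of _ 0] always_eventually allI ballI)
    fix n e assume "e \<in> complete_edges n"
    then show "gm.ex n (\<lambda>A. max 0 (1 * (gm.dH n e A - Psi s \<beta> G 1))) \<le> 0 / real n"
      by (intro gm.ex_le_const) (simp add: DH_bounds)
  qed
  show "good 1 v" if "good 1 u" "Psi s \<beta> G (Phi u) < v" for u v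
    using that by (intro good_step[OF that(1)]) auto
  show "good 1 v" if "good 1 u" "u \<le> v" for u v
    using that by (intro good_mono[OF that(1)]) auto
qed (fact assms)+

text \<open>The mirror image under \<open>u \<mapsto> - u\<close>, started from 0 because the fields
  are nonnegative.\<close>

lemma good_lower:
  assumes "\<And>u. u < l \<Longrightarrow> u < Psi s \<beta> G (Phi u)" "u < l"
  shows "good (-1) u"
proof -
  have "good (-1) (- (- u))"
  proof (rule threshold_descent[where F = "\<lambda>u. - Psi s \<beta> G (Phi (- u))" and P = "\<lambda>u. good (-1) (- u)"
        and l = "- l"])
    show "isCont (\<lambda>u. - Psi s \<beta> G (Phi (- u))) u" for u
    proof -
      have "isCont (\<lambda>u::real. - u) u" by (intro continuous_intros)
      from isCont_minus[OF isCont_o2[OF isCont_o2[OF this isCont_Phi] isCont_Psi]] show ?thesis .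
    qed
    show "good (-1) (- 0)"
      unfolding good_def
    proof (intro exI[of _ 0] always_eventually allI ballI)
      fix n e assume "e \<in> complete_edges n"
      then show "gm.ex n (\<lambda>A. max 0 (- 1 * (gm.dH n e A - - 0))) \<le> 0 / real n"
        by (intro gm.ex_le_const) (simp add: DH_bounds)
    qed
    show "good (-1) (- v)" if "good (-1) (- u)" "- Psi s \<beta> G (Phi (- u)) < v" for u v
      using that by (intro good_step[OF that(1)]) auto
    show "good (-1) (- v)" if "good (-1) (- u)" "u \<le> v" for u v
      using that by (intro good_mono[OF that(1)]) auto
    show "- Psi s \<beta> G (Phi (- v)) < v" if "- l < v" for v
      using assms(1)[of "- v"] that by simp
    show "- l < - u" using assms(2) by simp
  qed
  then show ?thesis by simp
qed

text \<open>Passing from the density \<open>p\<close> to the field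
  \<open>l = Psi s \<beta> G p\<close> turns fixed points of \<open>phi\<close> into fixed points of
  \<open>\<lambda>u. Psi s \<beta> G (Phi u)\<close>, with the same slope there. The latter map
  takes values between 0 and \<open>Psi s \<beta> G 1\<close>, so a wrong sign on either side of
  \<open>l\<close> would create a second fixed point by the intermediate value theorem.\<close>

lemma high_temperature_field:
  assumes "high_temperature s \<beta> G"
  obtains l where "\<And>u. l < u \<Longrightarrow> Psi s \<beta> G (Phi u) < u" "\<And>u. u < l \<Longrightarrow> u < Psi s \<beta> G (Phi u)"
    "Phi l * (1 - Phi l) * dPsi (Phi l) < 1"
proof -
  obtain p where p: "p > 0" "Phi (Psi s \<beta> G p) = p" "\<And>q. q > 0 \<Longrightarrow> Phi (Psi s \<beta> G q) = q \<Longrightarrow> q = p"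
    "deriv (phi s \<beta> G) p < 1"
    using assms unfolding high_temperature_def phi_def[of s \<beta> G, symmetric] by blast
  define l where "l = Psi s \<beta> G p"
  have pl: "Phi l = p" using p(2) by (simp add: l_def)
  let ?F = "\<lambda>u. Psi s \<beta> G (Phi u)"
  have cont: "isCont (\<lambda>u. ?F u - u) u" for u
    by (rule continuous_diff[OF isCont_o2[OF isCont_Phi isCont_Psi] continuous_ident])
  have fixed: "u = l" if "?F u - u = 0" for u
  proof -
    have "Phi (Psi s \<beta> G (Phi u)) = Phi u" using that by simp
    from p(3)[OF Phi_bounds(1) this] have "Phi u = p" .
    with that show ?thesis by (simp add: l_def)
  qed
  have F: "0 \<le> ?F u" "?F u \<le> Psi s \<beta> G 1" for u
    using Phi_bounds[of u] Psi_nonneg[of "Phi u"] Psi_mono[of "Phi u" 1] by simp_all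
  show thesis
  proof (rule that)
    fix u assume "l < u"
    show "?F u < u"
    proof (rule ccontr)
      assume "\<not> ?F u < u"
      then have "u \<le> Psi s \<beta> G 1" "0 \<le> ?F u - u" using F(2)[of u] by auto
      moreover have "?F (Psi s \<beta> G 1) - Psi s \<beta> G 1 \<le> 0" using F(2) by simp
      ultimately have "\<exists>v\<ge>u. v \<le> Psi s \<beta> G 1 \<and> ?F v - v = 0"
        by (intro IVT2 allI impI cont)
      then obtain v where "u \<le> v" "?F v - v = 0" by blast
      then show False using fixed[of v] \<open>l < u\<close> by simp
    qed
  next
    fix u assume "u < l"
    show "u < ?F u"
    proof (rule ccontr)
      assume "\<not> u < ?F u"
      then have "0 \<le> u" "?F u - u \<le> 0" using F(1)[of u] by auto
      moreover have "0 \<le> ?F 0 - 0" using F(1) by simp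
      ultimately have "\<exists>v\<ge>0. v \<le> u \<and> ?F v - v = 0"
        by (intro IVT2 allI impI cont)
      then obtain v where "v \<le> u" "?F v - v = 0" by blast
      then show False using fixed[of v] \<open>u < l\<close> by simp
    qed
  next
    have "(phi s \<beta> G has_real_derivative (Phi l * (1 - Phi l)) * dPsi p) (at p)"
      unfolding phi_def[abs_def] l_def
      by (rule DERIV_chain2[OF has_real_derivative_Phi DERIV_Psi])
    then have "deriv (phi s \<beta> G) p = Phi l * (1 - Phi l) * dPsi p"
      by (rule DERIV_imp_deriv)
    then show "Phi l * (1 - Phi l) * dPsi (Phi l) < 1" using p(4) by (simp add: pl)
  qed
qed

section \<open>The variance of the number of edges at high temperature\<close>

lemma eventually_second_excess:
  assumes good: "good 1 u" and gap: "dPsi (Phi u) < \<kappa>"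
  shows "\<exists>c\<ge>0. \<forall>\<^sub>F n in sequentially. \<forall>e\<in>complete_edges n.
    gm.ex n (\<lambda>A. max 0 (gm.ddH n e A - \<kappa>)) \<le> c / real n"
proof -
  define g where "g = \<kappa> - dPsi (Phi u)"
  define m where "m = (\<Sum>i=1..s. card (edges (G i)))"
  define B where "B = dPsi 1"
  have q: "0 \<le> Phi u" using Phi_bounds[of u] by simp
  have B: "0 \<le> B" unfolding B_def by (rule dPsi_nonneg) simp
  have g: "0 < g" using gap by (simp add: g_def)
  obtain c where c: "0 \<le> c" "\<forall>\<^sub>F n in sequentially. \<forall>e\<in>complete_edges n.
     gm.ex n (\<lambda>A. max 0 (1 * (gm.dH n e A - u))) \<le> c / real n"
    by (rule good_obtain[OF good])
  define c' where "c' = (real m)\<^sup>2 * coupling_const * B / (16 * g) + real m * B * c"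
  have "0 \<le> c'" unfolding c'_def using B c(1) g coupling_const_nonneg by simp
  moreover have "\<forall>\<^sub>F n in sequentially. \<forall>e\<in>complete_edges n.
    gm.ex n (\<lambda>A. max 0 (gm.ddH n e A - \<kappa>)) \<le> c' / real n"
    using c(2)
  proof eventually_elim
    case (elim n)
    show ?case
    proof
      fix e assume e: "e \<in> complete_edges n"
      have "gm.ex n (\<lambda>A. max 0 (gm.ddH n e A - \<kappa>))
          \<le> (real m)\<^sup>2 * (coupling_const / real n) * B / (16 * g) + real m * B * (c / real n)"
      proof (rule gm.ex_ddH_excess_le[OF e])
        show "(\<Sum>f\<in>complete_edges n - {e}. gm.coupling n e f) \<le> B"
          unfolding B_def by (rule sum_coupling_le[OF e])
        show "gm.coupling n e f \<le> coupling_const / real n" if "f \<in> complete_edges n - {e}" for f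
          using that e by (intro coupling_le) auto
        show "card (copy j) \<le> m" if "j \<in> copies n" for j
        proof -
          have "fst j \<in> {1..s}" using that by (auto simp: copies_def)
          then show ?thesis
            unfolding card_copy[OF that] m_def by (intro member_le_sum) auto
        qed
        show "gm.ex n (\<lambda>A. max 0 (gm.dH n f A - u)) \<le> c / real n" if "f \<in> complete_edges n" for f
          using elim that by simp
        show "g \<le> \<kappa> - (\<Sum>j\<in>{j\<in>copies n. e \<in> copy j}.
            real (card (copy j) - 1) * (weight n j * Phi u ^ (card (copy j) - 2)))"
          using mean_DDH_le[OF e q] unfolding g_def by linarith
      qed (use g c(1) coupling_const_nonneg in auto)
      also have "\<dots> = c' / real n" by (simp add: c'_def add_divide_distrib mult_ac)
      finally show "gm.ex n (\<lambda>A. max 0 (gm.ddH n e A - \<kappa>)) \<le> c' / real n" .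
    qed
  qed
  ultimately show ?thesis by blast
qed

lemma card_complete_edges: "card (complete_edges n) = n choose 2"
  unfolding edges_on_def using n_subsets[of "{1..n}" 2] by simp

theorem variance_edges_le:
  assumes "high_temperature s \<beta> G"
  shows "\<exists>c. \<forall>\<^sub>F n in sequentially.
    gm.cov n (size_in (complete_edges n)) (size_in (complete_edges n))
      \<le> c * (real (card (complete_edges n)) * real n)"
proof -
  obtain l where l: "\<And>u. l < u \<Longrightarrow> Psi s \<beta> G (Phi u) < u" "\<And>u. u < l \<Longrightarrow> u < Psi s \<beta> G (Phi u)"
    "Phi l * (1 - Phi l) * dPsi (Phi l) < 1"
    using high_temperature_field[OF assms] by metis
  define x y where "x = Phi l * (1 - Phi l)" and "y = dPsi (Phi l)"
  have xy: "0 \<le> x" "0 \<le> y" "x * y < 1"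
    using Phi_bounds[of l] l(3) by (auto simp: x_def y_def intro!: dPsi_nonneg mult_nonneg_nonneg)
  \<comment> \<open>Strictness of \<open>x * y < 1\<close> leaves room to enlarge both slopes, so
    that they become bounds on a neighbourhood of \<open>l\<close>.\<close>
  have "((\<lambda>\<epsilon>. (x + \<epsilon>) * (y + \<epsilon>)) \<longlongrightarrow> (x + 0) * (y + 0)) (at_right 0)"
    by (intro tendsto_intros)
  then have "\<forall>\<^sub>F \<epsilon> in at_right 0. (x + \<epsilon>) * (y + \<epsilon>) < 1"
    using xy(3) by (intro order_tendstoD(2)) auto
  moreover have "\<forall>\<^sub>F \<epsilon> in at_right (0::real). 0 < \<epsilon>" by (rule eventually_at_right_less)
  ultimately have "\<forall>\<^sub>F \<epsilon> in at_right 0. 0 < \<epsilon> \<and> (x + \<epsilon>) * (y + \<epsilon>) < 1"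
    by eventually_elim auto
  then obtain \<epsilon> where \<epsilon>: "0 < \<epsilon>" "(x + \<epsilon>) * (y + \<epsilon>) < 1"
    using eventually_happens'[OF trivial_limit_at_right_real] by blast
  define \<alpha> \<kappa> where "\<alpha> = x + \<epsilon>" and "\<kappa> = y + \<epsilon>"
  have \<alpha>0: "0 \<le> \<alpha>" and \<alpha>\<kappa>: "0 < 1 - \<alpha> * \<kappa>" using \<epsilon> xy by (auto simp: \<alpha>_def \<kappa>_def)

  have "isCont (\<lambda>u. Phi u * (1 - Phi u)) l"
    by (intro continuous_intros isCont_Phi)
  then obtain d1 where d1: "d1 > 0" "\<And>u. \<bar>u - l\<bar> < d1 \<Longrightarrow> Phi u * (1 - Phi u) < \<alpha>"
    using order_tendstoD(2)[of "\<lambda>u. Phi u * (1 - Phi u)" x "at l" \<alpha>] \<epsilon>(1)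
    by (auto simp: continuous_at x_def \<alpha>_def eventually_at dist_real_def) (metis abs_zero cancel_comm_monoid_add_class.diff_cancel less_add_same_cancel1)
  have "isCont (\<lambda>u. dPsi (Phi u)) l"
    by (rule isCont_o2[OF isCont_Phi isCont_dPsi])
  then obtain d2 where d2: "d2 > 0" "\<And>u. \<bar>u - l\<bar> < d2 \<Longrightarrow> dPsi (Phi u) < \<kappa>"
    using order_tendstoD(2)[of "\<lambda>u. dPsi (Phi u)" y "at l" \<kappa>] \<epsilon>(1)
    by (auto simp: continuous_at y_def \<kappa>_def eventually_at dist_real_def) (metis abs_zero cancel_comm_monoid_add_class.diff_cancel less_add_same_cancel1)
  \<comment> \<open>Between \<open>u0\<close> and \<open>u1\<close> the slope of \<open>Phi\<close>
    is at most \<open>\<alpha>\<close>; \<open>u2\<close> is a threshold above \<open>l\<close> at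
    which the mean second difference is still below \<open>\<kappa>\<close>.\<close>
  define u0 u1 u2 where "u0 = l - d1 / 2" and "u1 = l + d1 / 2" and "u2 = l + d2 / 2"
  have slope: "Phi u * (1 - Phi u) \<le> \<alpha>" if "u0 \<le> u" "u \<le> u1" for u
    using that d1 by (intro less_imp_le[OF d1(2)]) (auto simp: u0_def u1_def abs_le_iff)
  have u01: "u0 \<le> u1" using d1 by (simp add: u0_def u1_def)
  have "good 1 u1" "good 1 u2"
    using d1 d2 by (auto intro!: good_upper[of l] l(1) simp: u1_def u2_def)
  then obtain c1 where c1: "0 \<le> c1"
    and e1: "\<forall>\<^sub>F n in sequentially. \<forall>e\<in>complete_edges n. gm.ex n (\<lambda>A. max 0 (1 * (gm.dH n e A - u1))) \<le> c1 / real n"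
    by (blast elim: good_obtain)
  have "good (-1) u0"
    using d1 by (auto intro!: good_lower[of l] l(2) simp: u0_def)
  then obtain c2 where c2: "0 \<le> c2"
    and e2: "\<forall>\<^sub>F n in sequentially. \<forall>e\<in>complete_edges n. gm.ex n (\<lambda>A. max 0 (- 1 * (gm.dH n e A - u0))) \<le> c2 / real n"
    by (blast elim: good_obtain)
  have "dPsi (Phi u2) < \<kappa>" using d2 by (intro d2(2)) (simp add: u2_def)
  then obtain c3 where c3: "0 \<le> c3"
    and e3: "\<forall>\<^sub>F n in sequentially. \<forall>e\<in>complete_edges n. gm.ex n (\<lambda>A. max 0 (gm.ddH n e A - \<kappa>)) \<le> c3 / real n"
    using eventually_second_excess[OF \<open>good 1 u2\<close>] by blast
  define c where "c = c1 + c2 + c3"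
  have c0: "0 \<le> c" "c1 \<le> c" "c2 \<le> c" "c3 \<le> c" using c1 c2 c3 by (auto simp: c_def)
  define C where "C = (1 + (4 + 2 * \<alpha>) * c) / (1 - \<alpha> * \<kappa>)"
  have "\<forall>\<^sub>F n in sequentially.
    gm.cov n (size_in (complete_edges n)) (size_in (complete_edges n))
      \<le> C * (real (card (complete_edges n)) * real n)"
    using e1 e2 e3 eventually_gt_at_top[of 0]
  proof eventually_elim
    case (elim n)
    define M where "M = real (card (complete_edges n))"
    define V where "V = gm.cov n (size_in (complete_edges n)) (size_in (complete_edges n))"
    have n: "1 \<le> real n" using elim(4) by simp
    have M0: "0 \<le> M" by (simp add: M_def)
    \<comment> \<open>With \<open>M \<le> n\<^sup>2\<close> the error
      \<open>M\<^sup>2 * (c / n)\<close> is at most \<open>c * M * n\<close>, the order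
      claimed.\<close>
    have "n choose 2 \<le> n * n" unfolding choose_two by (meson div_le_dividend diff_le_self le_trans mult_le_mono2)
    then have Mn: "M \<le> real n * real n"
      unfolding M_def card_complete_edges by (metis of_nat_le_iff of_nat_mult)
    have mono: "c' / real n \<le> c / real n" if "c' \<le> c" for c'
      using that n by (intro divide_right_mono) auto
    have main: "(1 - \<alpha> * \<kappa>) * V \<le> M + (4 + 2 * \<alpha>) * M\<^sup>2 * (c / real n)"
      unfolding V_def M_def
    proof (rule gm.variance_size_le[OF \<alpha>0 slope u01])
      fix e assume e: "e \<in> complete_edges n"
      show "gm.ex n (\<lambda>A. max 0 (gm.dH n e A - u1)) \<le> c / real n"
        using elim(1) e mono[OF c0(2)] by fastforce
      show "gm.ex n (\<lambda>A. max 0 (u0 - gm.dH n e A)) \<le> c / real n"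
        using elim(2) e mono[OF c0(3)] by fastforce
      show "gm.ex n (\<lambda>A. max 0 (gm.ddH n e A - \<kappa>)) \<le> c / real n"
        using elim(3) e mono[OF c0(4)] by fastforce
    qed
    have M_le: "M \<le> M * real n" using n M0 by (simp add: mult_le_cancel_left1)
    have "(4 + 2 * \<alpha>) * M\<^sup>2 * (c / real n) = (4 + 2 * \<alpha>) * c * M * (M / real n)"
      by (simp add: power2_eq_square)
    also have "\<dots> \<le> (4 + 2 * \<alpha>) * c * M * real n"
      using Mn n M0 \<alpha>0 c0(1) by (intro mult_left_mono) (auto simp: divide_le_eq)
    finally have "(4 + 2 * \<alpha>) * M\<^sup>2 * (c / real n) \<le> (4 + 2 * \<alpha>) * c * M * real n" .
    with main M_le have "(1 - \<alpha> * \<kappa>) * V \<le> M * real n + (4 + 2 * \<alpha>) * c * M * real n"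
      by linarith
    then have "(1 - \<alpha> * \<kappa>) * V \<le> (1 + (4 + 2 * \<alpha>) * c) * (M * real n)"
      by (simp add: algebra_simps)
    then have "V \<le> C * (M * real n)"
      using \<alpha>\<kappa> by (simp add: C_def field_simps)
    then show ?case by (simp add: V_def M_def)
  qed
  then show ?thesis by blast
qed

section \<open>Exchangeability\<close>

text \<open>The restriction keeps the relabelled injection extensional, hence an index in
  \<open>copies n\<close>.\<close>

definition relabel :: "(nat \<Rightarrow> nat) \<Rightarrow> nat \<times> ('v \<Rightarrow> nat) \<Rightarrow> nat \<times> ('v \<Rightarrow> nat)" where
  "relabel \<pi> j = (fst j, restrict (\<pi> \<circ> snd j) (verts (G (fst j))))"

lemma relabel_in_copies:
  assumes "\<pi> permutes {1..n}" "j \<in> copies n"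
  shows "relabel \<pi> j \<in> copies n"
proof -
  have j: "fst j \<in> {1..s}" "snd j \<in> verts (G (fst j)) \<rightarrow>\<^sub>E {1..n}" "inj_on (snd j) (verts (G (fst j)))"
    using assms(2) by (auto simp: copies_def inj_maps_def)
  have "inj_on (\<pi> \<circ> snd j) (verts (G (fst j)))"
    using j(3) permutes_inj_on[OF assms(1)] by (rule comp_inj_on)
  moreover have "restrict (\<pi> \<circ> snd j) (verts (G (fst j))) \<in> verts (G (fst j)) \<rightarrow>\<^sub>E {1..n}"
    using j(2) permutes_in_image[OF assms(1)] by (auto simp: PiE_def Pi_def)
  ultimately show ?thesis
    using j(1) by (auto simp: relabel_def copies_def inj_maps_def inj_on_restrict_eq)
qed

lemma relabel_relabel:
  assumes "\<And>x. \<pi>' (\<pi> x) = x" "j \<in> copies n"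
  shows "relabel \<pi>' (relabel \<pi> j) = j"
  using assms
  by (cases j) (auto simp: relabel_def copies_def inj_maps_def fun_eq_iff PiE_def extensional_def restrict_def)

lemma copy_relabel:
  assumes "j \<in> copies n"
  shows "copy (relabel \<pi> j) = (`) \<pi> ` copy j"
proof -
  have "fst j \<in> {1..s}" using assms by (auto simp: copies_def)
  then have sub: "a \<subseteq> verts (G (fst j))" if "a \<in> edges (G (fst j))" for a
    using edge_in[OF _ that] by (auto simp: edges_on_def)
  have "snd (relabel \<pi> j) ` a = \<pi> ` (snd j ` a)" if "a \<in> edges (G (fst j))" for a
    using sub[OF that] by (auto simp: relabel_def image_image intro!: image_cong)
  moreover have "fst (relabel \<pi> j) = fst j" by (simp add: relabel_def)
  ultimately show ?thesis
    by (auto simp: copy_def image_image)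
qed

lemma Ham_permute:
  assumes \<pi>: "\<pi> permutes {1..n}"
  shows "gm.Ham n ((`) \<pi> ` A) = gm.Ham n A"
proof -
  have bij: "bij_betw (relabel \<pi>) (copies n) (copies n)"
    using permutes_inverses[OF \<pi>] relabel_in_copies[OF \<pi>] relabel_in_copies[OF permutes_inv[OF \<pi>]]
    by (intro bij_betw_byWitness[where f' = "relabel (inv \<pi>)"]) (auto simp: relabel_relabel)
  have inj: "inj ((`) \<pi>)" using permutes_inj[OF \<pi>] by (simp add: inj_image_eq_iff inj_def)
  have "gm.Ham n ((`) \<pi> ` A) = (\<Sum>j\<in>copies n. weight n (relabel \<pi> j) * of_bool (copy (relabel \<pi> j) \<subseteq> (`) \<pi> ` A))"
    unfolding gm.Ham_def by (rule sum.reindex_bij_betw[OF bij, symmetric])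
  also have "\<dots> = gm.Ham n A"
    unfolding gm.Ham_def
  proof (rule sum.cong)
    fix j assume j: "j \<in> copies n"
    have "weight n (relabel \<pi> j) = weight n j" by (simp add: weight_def relabel_def)
    then show "weight n (relabel \<pi> j) * of_bool (copy (relabel \<pi> j) \<subseteq> (`) \<pi> ` A)
        = weight n j * of_bool (copy j \<subseteq> A)"
      unfolding copy_relabel[OF j] inj_image_subset_iff[OF inj] by simp
  qed simp
  finally show ?thesis .
qed

lemma cov_permute:
  assumes \<pi>: "\<pi> permutes {1..n}"
  shows "gm.cov n (\<lambda>A. of_bool (\<pi> ` e \<in> A)) (\<lambda>A. of_bool (\<pi> ` f \<in> A))
    = gm.cov n (\<lambda>A. of_bool (e \<in> A)) (\<lambda>A. of_bool (f \<in> A))"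
proof -
  have inj: "inj ((`) \<pi>)" using permutes_inj[OF \<pi>] by (simp add: inj_image_eq_iff inj_def)
  have closed: "\<rho> ` e \<in> complete_edges n" if "\<rho> permutes {1..n}" "e \<in> complete_edges n" for \<rho> e
  proof -
    have e: "e \<subseteq> {1..n}" "card e = 2" using that by (auto simp: edges_on_def)
    have "\<rho> ` e \<subseteq> \<rho> ` {1..n}" using e by (intro image_mono)
    moreover have "card (\<rho> ` e) = 2" using e permutes_inj_on[OF that(1)] by (simp add: card_image)
    ultimately show ?thesis using permutes_image[OF that(1)] by (simp add: edges_on_def)
  qed
  have "bij_betw ((`) \<pi>) (complete_edges n) (complete_edges n)"
    using closed[OF \<pi>] closed[OF permutes_inv[OF \<pi>]] permutes_inverses[OF \<pi>]
    by (intro bij_betw_byWitness[where f' = "(`) (inv \<pi>)"]) (auto simp: image_image)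
  note inv = gm.ex_invariant[OF this Ham_permute[OF \<pi>]]
  have "gm.ex n (\<lambda>A. h A) = gm.ex n (\<lambda>A. h ((`) \<pi> ` A))" for h :: "nat set set \<Rightarrow> real"
    by (rule inv[symmetric])
  from this[of "\<lambda>A. of_bool (\<pi> ` e \<in> A)"] this[of "\<lambda>A. of_bool (\<pi> ` f \<in> A)"]
    this[of "\<lambda>A. of_bool (\<pi> ` e \<in> A) * of_bool (\<pi> ` f \<in> A)"]
  show ?thesis
    unfolding gm.cov_def by (simp only: inj_image_mem_iff[OF inj])
qed

text \<open>Vertex permutations act transitively on ordered pairs of disjoint edges: bijections from
  \<open>e\<close> to \<open>e'\<close> and from \<open>f\<close> to \<open>f'\<close> glue, and the
  result extends to all vertices.\<close>

lemma cov_disjoint_edges_eq: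
  assumes in_E: "e \<in> complete_edges n" "f \<in> complete_edges n" "e' \<in> complete_edges n" "f' \<in> complete_edges n"
    and "disjnt e f" "disjnt e' f'"
  shows "gm.cov n (\<lambda>A. of_bool (e' \<in> A)) (\<lambda>A. of_bool (f' \<in> A))
    = gm.cov n (\<lambda>A. of_bool (e \<in> A)) (\<lambda>A. of_bool (f \<in> A))"
proof -
  have card: "finite e" "finite f" "finite e'" "finite f'" "card e = card e'" "card f = card f'"
    using in_E by (auto simp: edges_on_def intro: card_ge_0_finite)
  obtain g h where g: "bij_betw g e e'" and h: "bij_betw h f f'"
    using card by (metis finite_same_card_bij)
  define k where "k = (\<lambda>x. if x \<in> e then g x else h x)"
  have ke: "bij_betw k e e'" using g by (subst bij_betw_cong[of _ _ g]) (auto simp: k_def)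
  have kf: "bij_betw k f f'" using h assms(5)
    by (subst bij_betw_cong[of _ _ h]) (auto simp: k_def disjnt_iff)
  have k: "bij_betw k (e \<union> f) (e' \<union> f')"
    using assms(6) by (intro bij_betw_combine ke kf) (simp add: disjnt_def)
  have "\<exists>\<pi>. \<pi> permutes {1..n} \<and> (\<forall>x\<in>e \<union> f. \<pi> x = k x)"
    using k in_E by (intro ex_permutes_extending) (auto simp: edges_on_def bij_betw_def)
  then obtain \<pi> where \<pi>: "\<pi> permutes {1..n}" "\<And>x. x \<in> e \<union> f \<Longrightarrow> \<pi> x = k x" by blast
  have "\<pi> ` e = k ` e" "\<pi> ` f = k ` f" using \<pi>(2) by (auto intro!: image_cong)
  then have "\<pi> ` e = e'" "\<pi> ` f = f'" using ke kf by (auto simp: bij_betw_def)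
  then show ?thesis using cov_permute[OF \<pi>(1), of e f] by simp
qed

text \<open>All disjoint pairs share one covariance and dropping the other pairs only lowers the
  sum, so the variance of the edge count bounds it on average. The 8 comes from
  \<open>(n - 2) choose 2 \<ge> n\<^sup>2 / 8\<close>, the number of edges disjoint from a given
  one.\<close>

theorem cov_disjoint_edges_le:
  assumes "high_temperature s \<beta> G"
  shows "\<exists>c\<ge>0. \<forall>\<^sub>F n in sequentially. \<forall>e\<in>complete_edges n. \<forall>f\<in>complete_edges n. disjnt e f \<longrightarrow>
    gm.cov n (\<lambda>A. of_bool (e \<in> A)) (\<lambda>A. of_bool (f \<in> A)) \<le> c / real n"
proof -
  obtain c where c: "\<forall>\<^sub>F n in sequentially.
    gm.cov n (size_in (complete_edges n)) (size_in (complete_edges n))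
      \<le> c * (real (card (complete_edges n)) * real n)"
    using variance_edges_le[OF assms] by blast
  have "\<forall>\<^sub>F n in sequentially. \<forall>e\<in>complete_edges n. \<forall>f\<in>complete_edges n. disjnt e f \<longrightarrow>
    gm.cov n (\<lambda>A. of_bool (e \<in> A)) (\<lambda>A. of_bool (f \<in> A)) \<le> (8 * \<bar>c\<bar>) / real n"
    using c eventually_ge_at_top[of 6]
  proof eventually_elim
    case (elim n)
    show ?case
    proof (intro ballI impI)
      fix e f assume ef: "e \<in> complete_edges n" "f \<in> complete_edges n" "disjnt e f"
      define E where "E = complete_edges n"
      define C where "C = (\<lambda>e f. gm.cov n (\<lambda>A. of_bool (e \<in> A)) (\<lambda>A. of_bool (f \<in> A)))"
      have C0: "0 \<le> C a b" for a b
        unfolding C_def by (intro gm.cov_nonneg gm.mono_indicator)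
      have N: "card {b\<in>E. disjnt a b} = (n - 2) choose 2" if "a \<in> E" for a
      proof -
        have a: "a \<subseteq> {1..n}" "card a = 2" using that by (auto simp: E_def edges_on_def)
        have "{b\<in>E. disjnt a b} = {b. b \<subseteq> {1..n} - a \<and> card b = 2}"
          by (auto simp: E_def edges_on_def disjnt_iff)
        then have "card {b\<in>E. disjnt a b} = card ({1..n} - a) choose 2"
          using n_subsets[of "{1..n} - a" 2] by simp
        also have "card ({1..n} - a) = n - 2"
          using a card_Diff_subset[of a "{1..n}"] by (simp add: card_ge_0_finite)
        finally show ?thesis .
      qed
      have "real (card E) * (real ((n - 2) choose 2) * C e f) = (\<Sum>a\<in>E. \<Sum>b\<in>{b\<in>E. disjnt a b}. C e f)"
        using N by simp
      also have "\<dots> = (\<Sum>a\<in>E. \<Sum>b\<in>{b\<in>E. disjnt a b}. C a b)"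
        unfolding C_def E_def
        by (intro sum.cong refl cov_disjoint_edges_eq) (use ef in auto)
      also have "\<dots> \<le> (\<Sum>a\<in>E. \<Sum>b\<in>E. C a b)"
        by (intro sum_mono sum_mono2) (auto simp: E_def C0 simp del: One_nat_def)
      also have "\<dots> = gm.cov n (size_in E) (size_in E)"
        unfolding gm.cov_size_in gm.cov_size_in_left C_def by (rule sum.swap)
      also have "\<dots> \<le> c * (real (card E) * real n)"
        using elim(1) by (simp add: E_def)
      also have "\<dots> \<le> \<bar>c\<bar> * (real (card E) * real n)"
        by (intro mult_right_mono) auto
      finally have "real (card E) * (real ((n - 2) choose 2) * C e f) \<le> real (card E) * (\<bar>c\<bar> * real n)"
        by (simp add: mult_ac)
      moreover have "0 < real (card E)"
        using ef(1) by (auto simp: E_def card_gt_0_iff simp del: One_nat_def)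
      ultimately have 1: "real ((n - 2) choose 2) * C e f \<le> \<bar>c\<bar> * real n"
        by (simp only: mult_le_cancel_left_pos)
      have "real n * real n / 8 \<le> real ((n - 2) choose 2)"
      proof -
        have "2 * ((n - 2) choose 2) = (n - 2) * (n - 3)"
        proof -
          have "even ((n - 2) * (n - 2 - 1))" by (cases "even n") auto
          then have "2 * ((n - 2) * (n - 2 - 1) div 2) = (n - 2) * (n - 2 - 1)"
            by (rule dvd_mult_div_cancel)
          moreover have "n - 2 - 1 = n - 3" by simp
          ultimately show ?thesis unfolding choose_two by (simp only:)
        qed
        then have "real (2 * ((n - 2) choose 2)) = real ((n - 2) * (n - 3))" by (rule arg_cong)
        then have "2 * real ((n - 2) choose 2) = (real n - 2) * (real n - 3)"
          using elim(2) by (simp only: of_nat_mult of_nat_numeral) (simp add: of_nat_diff)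
        \<comment> \<open>Here \<open>n \<ge> 6\<close> gives
          \<open>n - 3 \<ge> n / 2\<close>.\<close>
        moreover have "(real n / 2) * (real n / 2) \<le> (real n - 2) * (real n - 3)"
          using elim(2) by (intro mult_mono) auto
        ultimately show ?thesis by simp
      qed
      then have "real n * real n / 8 * C e f \<le> real ((n - 2) choose 2) * C e f"
        using C0 by (intro mult_right_mono) auto
      with 1 have "real n * (real n * C e f) \<le> real n * (8 * \<bar>c\<bar>)" by (simp add: mult_ac)
      moreover have "0 < real n" using elim(2) by simp
      ultimately have "real n * C e f \<le> 8 * \<bar>c\<bar>"
        by (simp only: mult_le_cancel_left_pos)
      then show "gm.cov n (\<lambda>A. of_bool (e \<in> A)) (\<lambda>A. of_bool (f \<in> A)) \<le> (8 * \<bar>c\<bar>) / real n"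
        using elim(2) by (simp add: C_def pos_le_divide_eq mult.commute)
    qed
  qed
  then show ?thesis by (intro exI[of _ "8 * \<bar>c\<bar>"]) auto
qed

text \<open>An edge probability is an average of \<open>Phi\<close> over fields between 0 and
  \<open>Psi s \<beta> G 1\<close>. Being bounded away from 0 and 1 uniformly in \<open>n\<close>
  keeps the variance of a sum of \<open>m\<close> indicators at least of order
  \<open>m\<close>.\<close>

lemma edge_probability_bounds:
  assumes e: "e \<in> complete_edges n"
  shows "1 / 2 \<le> gm.ex n (\<lambda>A. of_bool (e \<in> A) :: real)" "gm.ex n (\<lambda>A. of_bool (e \<in> A) :: real) \<le> Phi (Psi s \<beta> G 1)"
proof -
  have eq: "gm.ex n (\<lambda>A. of_bool (e \<in> A) :: real) = gm.ex n (\<lambda>A. Phi (gm.dH n e A))"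
    by (subst gm.ex_resample[OF e]) simp
  have "Phi 0 = 1 / 2" by (simp add: Phi_def)
  then have "1 / 2 \<le> Phi (gm.dH n e A)" for A
    using Phi_mono[OF DH_bounds(1)[OF e, of A]] by simp
  then show "1 / 2 \<le> gm.ex n (\<lambda>A. of_bool (e \<in> A) :: real)"
    unfolding eq by (intro gm.ex_ge_const)
  show "gm.ex n (\<lambda>A. of_bool (e \<in> A) :: real) \<le> Phi (Psi s \<beta> G 1)"
    unfolding eq by (intro gm.ex_le_const Phi_mono DH_bounds e)
qed

end

section \<open>A quantitative central limit theorem\<close>

lemma norm_cis_taylor_le: "norm (cis x - (1 + \<i> * of_real x - of_real (x\<^sup>2 / 2))) \<le> \<bar>x\<bar> ^ 3"
proof -
  have "norm (cis x - (1 + \<i> * of_real x - of_real (x\<^sup>2 / 2))) \<le> \<bar>x\<bar> ^ 3 / 6"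
    using iexp_approx1[of x 2]
    by (simp add: cis_conv_exp numeral_2_eq_2 numeral_3_eq_3 power2_eq_square algebra_simps)
  also have "\<dots> \<le> \<bar>x\<bar> ^ 3" by simp
  finally show ?thesis .
qed

lemma abs_exp_minus_diff_le:
  fixes x y :: real
  assumes "0 \<le> x" "x \<le> y"
  shows "\<bar>exp (- x) - exp (- y)\<bar> \<le> y - x"
proof -
  have "1 - exp (- (y - x)) \<le> y - x"
    using exp_ge_add_one_self[of "- (y - x)"] by linarith
  then have "exp (- x) * (1 - exp (- (y - x))) \<le> 1 * (y - x)"
    using assms by (intro mult_mono) auto
  moreover have "exp (- x) * (1 - exp (- (y - x))) = exp (- x) - exp (- y)"
    by (simp add: right_diff_distrib flip: exp_add)
  moreover have "exp (- y) \<le> exp (- x)" using assms by simp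
  ultimately show ?thesis by simp
qed

lemma abs_exp_minus_taylor_le:
  fixes y :: real
  assumes "0 \<le> y"
  shows "\<bar>exp (- y) - (1 - y)\<bar> \<le> y\<^sup>2"
proof -
  have "1 \<le> (1 - y + y\<^sup>2) * (1 + y)"
    using assms by (simp add: algebra_simps power2_eq_square)
  then have "1 / (1 + y) \<le> 1 - y + y\<^sup>2" using assms by (simp add: divide_le_eq)
  moreover have "exp (- y) \<le> 1 / (1 + y)"
    using exp_ge_add_one_self[of y] assms by (simp add: exp_minus inverse_eq_divide frac_le)
  ultimately show ?thesis using exp_ge_add_one_self[of "- y"] by simp
qed

text \<open>The exponential of a centred Bernoulli variable takes the values \<open>cis x\<close>
  and \<open>cis y\<close>, with \<open>x = - s * q\<close> and \<open>y = s * (1 - q)\<close>. In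
  the mean the linear Taylor terms cancel and the quadratic ones give the variance; the cubic error
  is that of \<open>cis\<close>, the quartic one that of the real exponential.\<close>

lemma bernoulli_char_approx:
  fixes q s :: real
  assumes "0 \<le> q" "q \<le> 1"
  shows "norm (cis (- s * q) * (1 + (cis s - 1) * of_real q) - exp (of_real (- (s\<^sup>2 * (q * (1 - q)) / 2))))
    \<le> \<bar>s\<bar> ^ 3 + s ^ 4"
proof -
  define v where "v = q * (1 - q)"
  have v: "0 \<le> v" "v \<le> 1"
    using assms mult_mono[of q 1 "1 - q" 1] by (auto simp: v_def)
  define T where "T = (\<lambda>x. 1 + \<i> * of_real x - of_real (x\<^sup>2 / 2) :: complex)"
  define x y where "x = - s * q" and "y = s * (1 - q)"
  have "cis x * cis s = cis y" by (simp add: cis_mult x_def y_def algebra_simps)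
  then have a: "cis (- s * q) * (1 + (cis s - 1) * of_real q) = of_real (1 - q) * cis x + of_real q * cis y"
    unfolding x_def[symmetric] by (simp add: algebra_simps flip: \<open>cis x * cis s = cis y\<close>)
  have "\<bar>x\<bar> \<le> \<bar>s\<bar>" "\<bar>y\<bar> \<le> \<bar>s\<bar>"
    using assms by (auto simp: x_def y_def abs_mult mult_left_le)
  then have x: "norm (cis x - T x) \<le> \<bar>s\<bar> ^ 3" and y: "norm (cis y - T y) \<le> \<bar>s\<bar> ^ 3"
    using norm_cis_taylor_le[of x] norm_cis_taylor_le[of y] unfolding T_def
    by (meson abs_ge_zero order_trans power_mono)+
  have T: "of_real (1 - q) * T x + of_real q * T y = of_real (1 - s\<^sup>2 * v / 2)"
  proof -
    have "of_real (1 - q) * T x + of_real q * T y =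
        of_real ((1 - q) + q) + \<i> * of_real ((1 - q) * x + q * y) - of_real (((1 - q) * x\<^sup>2 + q * y\<^sup>2) / 2)"
      by (simp add: T_def algebra_simps add_divide_distrib diff_divide_distrib)
    also have "(1 - q) * x + q * y = 0" by (simp add: x_def y_def algebra_simps)
    also have "(1 - q) * x\<^sup>2 + q * y\<^sup>2 = s\<^sup>2 * v"
      by (simp add: x_def y_def v_def power2_eq_square algebra_simps)
    finally show ?thesis by simp
  qed
  have "norm (of_real (1 - q) * cis x + of_real q * cis y - of_real (1 - s\<^sup>2 * v / 2))
      = norm (of_real (1 - q) * (cis x - T x) + of_real q * (cis y - T y))"
    unfolding T[symmetric] by (simp only: right_diff_distrib add_diff_add)
  also have "\<dots> \<le> (1 - q) * \<bar>s\<bar> ^ 3 + q * \<bar>s\<bar> ^ 3"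
    using assms x y by (intro norm_triangle_mono) (auto simp: norm_mult intro!: mult_left_mono simp del: of_real_diff)
  also have "\<dots> = \<bar>s\<bar> ^ 3" by (simp add: algebra_simps)
  finally have 1: "norm (of_real (1 - q) * cis x + of_real q * cis y - of_real (1 - s\<^sup>2 * v / 2)) \<le> \<bar>s\<bar> ^ 3" .
  have "norm (of_real (1 - s\<^sup>2 * v / 2) - exp (of_real (- (s\<^sup>2 * v / 2))) :: complex)
      = \<bar>exp (- (s\<^sup>2 * v / 2)) - (1 - s\<^sup>2 * v / 2)\<bar>"
    by (metis exp_of_real norm_of_real of_real_diff norm_minus_commute)
  also have "\<dots> \<le> (s\<^sup>2 * v / 2)\<^sup>2"
    using v by (intro abs_exp_minus_taylor_le) auto
  also have "\<dots> \<le> (s\<^sup>2)\<^sup>2"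
    using v by (intro power_mono) (auto intro: order_trans[OF mult_left_mono[of v 2]])
  also have "\<dots> = s ^ 4" by simp
  finally have 2: "norm (of_real (1 - s\<^sup>2 * v / 2) - exp (of_real (- (s\<^sup>2 * v / 2))) :: complex) \<le> s ^ 4" .
  from norm_triangle_mono[OF 1 2] show ?thesis
    unfolding a v_def by (simp only: diff_add_cancel add_diff_eq)
qed

section \<open>Normal approximation for weakly correlated indicators\<close>

context ferromagnetic_gibbs begin

text \<open>Three comparisons: with the product of the marginal characteristic functions, with the
  Gaussian whose variance \<open>V\<close> is the sum of the marginal variances, and with that of
  the true variance \<open>S\<close>. The first costs \<open>2 * s\<^sup>2 * k * m\<^sup>2\<close>
  and the last \<open>s\<^sup>2 / 2 * (k * m\<^sup>2)\<close>, whence \<open>5 / 2\<close>; the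
  lower bound \<open>v\<close> enters through
  \<open>s\<^sup>2 * m \<le> t\<^sup>2 / v\<close>.\<close>

theorem clt_bound:
  assumes D: "finite D" "D \<noteq> {}" and k: "0 \<le> k"
    and cov: "\<And>e f. e \<in> D \<Longrightarrow> f \<in> D \<Longrightarrow> e \<noteq> f \<Longrightarrow> cov (\<lambda>A. of_bool (e \<in> A)) (\<lambda>A. of_bool (f \<in> A)) \<le> k"
    and v: "0 < v" "\<And>e. e \<in> D \<Longrightarrow>
      v \<le> ex (\<lambda>A. of_bool (e \<in> A)) * (1 - ex (\<lambda>A. of_bool (e \<in> A)))"
  defines "m \<equiv> real (card D)"
  shows "norm (ex (\<lambda>A. cis (t * ((size_in D A - ex (size_in D)) / sqrt (cov (size_in D) (size_in D)))))
      - exp (of_real (- (t\<^sup>2) / 2)))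
    \<le> 5 / 2 * (t\<^sup>2 / v) * (k * m) + \<bar>t\<bar> ^ 3 / (v * sqrt v) / sqrt m + t ^ 4 / v\<^sup>2 / m"
proof -
  define x where "x = (\<lambda>(e::'e) A. of_bool (e \<in> A) :: real)"
  define q where "q = (\<lambda>e. ex (x e))"
  define w where "w = (\<lambda>e. q e * (1 - q e))"
  define V where "V = (\<Sum>e\<in>D. w e)"
  define S where "S = cov (size_in D) (size_in D)"
  define s where "s = t / sqrt S"
  have m: "1 \<le> m" using D by (simp add: m_def Suc_le_eq card_gt_0_iff)
  have q: "0 \<le> q e" "q e \<le> 1" for e
    unfolding q_def x_def by (rule ex_ge_const; simp) (rule ex_le_const; simp)
  have w: "v \<le> w e" if "e \<in> D" for e
    using v(2)[OF that] by (simp add: w_def q_def x_def)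
  have diag: "cov (x e) (x e) = w e" for e
  proof -
    have "ex (\<lambda>A. x e A * x e A) = q e"
      unfolding q_def by (rule ex_cong) (simp add: x_def)
    then show ?thesis by (simp add: cov_def w_def q_def algebra_simps)
  qed
  have mV: "m * v \<le> V"
    unfolding V_def m_def using sum_bounded_below[of D v w] w by simp
  have S_eq: "S = (\<Sum>e\<in>D. cov (x e) (x e) + (\<Sum>f\<in>D - {e}. cov (x e) (x f)))"
  proof -
    have "S = (\<Sum>e\<in>D. \<Sum>f\<in>D. cov (x e) (x f))"
      unfolding S_def x_def cov_size_in cov_size_in_left by (rule sum.swap)
    also have "\<dots> = (\<Sum>e\<in>D. cov (x e) (x e) + (\<Sum>f\<in>D - {e}. cov (x e) (x f)))"
      using D(1) by (intro sum.cong refl sum.remove) auto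
    finally show ?thesis .
  qed
  \<comment> \<open>By positive association the off-diagonal covariances can only enlarge the
    variance, so the lower bound for \<open>V\<close> carries over to \<open>S\<close>.\<close>
  have VS: "V \<le> S"
    unfolding S_eq V_def diag
    by (intro sum_mono) (auto simp: x_def intro!: sum_nonneg cov_nonneg mono_indicator)
  have "(\<Sum>e\<in>D. \<Sum>f\<in>D - {e}. cov (x e) (x f)) \<le> (\<Sum>e\<in>D. m * k)"
  proof (rule sum_mono)
    fix e assume "e \<in> D"
    then have "(\<Sum>f\<in>D - {e}. cov (x e) (x f)) \<le> real (card (D - {e})) * k"
      using cov by (intro sum_bounded_above) (auto simp: x_def)
    also have "\<dots> \<le> m * k"
      using k D(1) by (intro mult_right_mono) (auto simp: m_def card_Diff1_le)
    finally show "(\<Sum>f\<in>D - {e}. cov (x e) (x f)) \<le> m * k" .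
  qed
  then have SV: "S - V \<le> k * m\<^sup>2"
    unfolding S_eq V_def diag sum.distrib by (simp add: m_def power2_eq_square mult_ac)
  have S: "m * v \<le> S" "0 < S"
  proof -
    show "m * v \<le> S" using mV VS by linarith
    have "0 < m * v" using m v(1) by simp
    then show "0 < S" using mV VS by linarith
  qed
  have V0: "0 \<le> V" using mV m v(1) by (meson order_trans less_imp_le mult_nonneg_nonneg zero_le_one)
  have ss: "s\<^sup>2 = t\<^sup>2 / S" using S by (simp add: s_def power_divide)
  have sm: "s\<^sup>2 * m \<le> t\<^sup>2 / v"
  proof -
    have "t\<^sup>2 / S \<le> t\<^sup>2 / (m * v)"
      using S v(1) m by (intro divide_left_mono) auto
    then have "t\<^sup>2 / S * m \<le> t\<^sup>2 / (m * v) * m"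
      using m by (intro mult_right_mono) auto
    then show ?thesis using m by (simp add: ss)
  qed
  have s_le: "\<bar>s\<bar> \<le> \<bar>t\<bar> / (sqrt v * sqrt m)"
  proof -
    have "sqrt v * sqrt m \<le> sqrt S" using S by (simp add: mult.commute flip: real_sqrt_mult)
    then show ?thesis
      using v(1) m S(2) unfolding s_def abs_divide by (intro divide_left_mono) auto
  qed

  define a where "a = (\<lambda>e. cis (- s * q e) * ex (\<lambda>A. cis (s * x e A)))"
  define b where "b = (\<lambda>e. exp (of_real (- (s\<^sup>2 * w e / 2))) :: complex)"
  have mean: "ex (size_in D) = (\<Sum>e\<in>D. q e)"
    unfolding size_in_def[abs_def] q_def x_def by (rule ex_sum)
  have shift: "cis (- s * ex (size_in D)) = (\<Prod>e\<in>D. cis (- s * q e))"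
    unfolding mean cis_conv_exp by (subst exp_sum[OF D(1), symmetric]) (simp add: sum_distrib_left)
  have "ex (\<lambda>A. cis (t * ((size_in D A - ex (size_in D)) / sqrt S)))
      = ex (\<lambda>A. cis (- s * ex (size_in D)) * cis (s * size_in D A))"
    unfolding cis_mult by (simp add: s_def algebra_simps diff_divide_distrib)
  then have lhs: "ex (\<lambda>A. cis (t * ((size_in D A - ex (size_in D)) / sqrt S)))
      = cis (- s * ex (size_in D)) * ex (\<lambda>A. cis (s * size_in D A))"
    by (simp only: ex_cmult)
  have prod_a: "(\<Prod>e\<in>D. a e) = cis (- s * ex (size_in D)) * (\<Prod>e\<in>D. ex (\<lambda>A. cis (s * x e A)))"
    unfolding a_def shift by (rule prod.distrib)
  have "norm (ex (\<lambda>A. cis (t * ((size_in D A - ex (size_in D)) / sqrt S))) - (\<Prod>e\<in>D. a e))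
      = norm (ex (\<lambda>A. cis (s * size_in D A)) - (\<Prod>e\<in>D. ex (\<lambda>A. cis (s * x e A))))"
    unfolding lhs prod_a right_diff_distrib[symmetric] norm_mult by simp
  also have "\<dots> \<le> 2 * s\<^sup>2 * k * m\<^sup>2"
    unfolding x_def m_def by (rule newman_inequality[OF D(1) k cov])
  finally have 1: "norm (ex (\<lambda>A. cis (t * ((size_in D A - ex (size_in D)) / sqrt S))) - (\<Prod>e\<in>D. a e))
      \<le> 2 * s\<^sup>2 * k * m\<^sup>2" .

  have ex_cis: "ex (\<lambda>A. cis (s * x e A)) = 1 + (cis s - 1) * of_real (q e)" for e
  proof -
    have "ex (\<lambda>A. cis (s * x e A)) = ex (\<lambda>A. 1 + (cis s - 1) * of_real (x e A))"
      by (intro ex_cong) (auto simp: x_def)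
    also have "\<dots> = 1 + (cis s - 1) * ex (\<lambda>A. of_real (x e A))"
      by (simp only: ex_add ex_cmult ex_const)
    also have "ex (\<lambda>A. of_real (x e A)) = (of_real (q e) :: complex)"
      by (simp add: q_def ex_def scaleR_conv_of_real)
    finally show ?thesis .
  qed
  have ab: "norm (a e - b e) \<le> \<bar>s\<bar> ^ 3 + s ^ 4" for e
    unfolding a_def b_def ex_cis w_def by (rule bernoulli_char_approx[OF q])
  have "norm ((\<Prod>e\<in>D. a e) - (\<Prod>e\<in>D. b e)) \<le> (\<Sum>e\<in>D. norm (a e - b e))"
  proof (rule norm_prod_diff)
    fix e assume "e \<in> D"
    have "norm (ex (\<lambda>A. cis (s * x e A))) \<le> ex (\<lambda>A. norm (cis (s * x e A)))" by (rule norm_ex_le)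
    then show "norm (a e) \<le> 1" by (simp add: a_def norm_mult ex_const)
    have "0 \<le> s\<^sup>2 * w e" using q by (simp add: w_def)
    then show "norm (b e) \<le> 1" by (simp add: b_def norm_exp_eq_Re)
  qed
  also have "\<dots> \<le> m * (\<bar>s\<bar> ^ 3 + s ^ 4)"
    unfolding m_def using ab by (rule sum_bounded_above)
  finally have 2: "norm ((\<Prod>e\<in>D. a e) - (\<Prod>e\<in>D. b e)) \<le> m * (\<bar>s\<bar> ^ 3 + s ^ 4)" .

  have prod_b: "(\<Prod>e\<in>D. b e) = of_real (exp (- (s\<^sup>2 * V / 2)))"
    unfolding b_def V_def
    by (simp add: exp_sum[OF D(1), symmetric] sum_distrib_left sum_divide_distrib sum_negf flip: exp_of_real)
  have t2: "t\<^sup>2 = s\<^sup>2 * S" using S by (simp add: ss)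
  have "norm ((\<Prod>e\<in>D. b e) - exp (of_real (- (t\<^sup>2) / 2)))
      = \<bar>exp (- (s\<^sup>2 * V / 2)) - exp (- (s\<^sup>2 * S / 2))\<bar>"
    unfolding prod_b t2 by (metis (no_types, lifting) exp_of_real minus_divide_left norm_of_real of_real_diff)
  also have "\<dots> \<le> s\<^sup>2 * S / 2 - s\<^sup>2 * V / 2"
    using VS V0 by (intro abs_exp_minus_diff_le) (auto intro!: mult_left_mono)
  also have "\<dots> = s\<^sup>2 / 2 * (S - V)" by (simp add: algebra_simps)
  also have "\<dots> \<le> s\<^sup>2 / 2 * (k * m\<^sup>2)"
    using SV by (intro mult_left_mono) auto
  finally have 3: "norm ((\<Prod>e\<in>D. b e) - exp (of_real (- (t\<^sup>2) / 2))) \<le> s\<^sup>2 / 2 * (k * m\<^sup>2)" .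

  have "norm (ex (\<lambda>A. cis (t * ((size_in D A - ex (size_in D)) / sqrt S))) - exp (of_real (- (t\<^sup>2) / 2)))
      \<le> 2 * s\<^sup>2 * k * m\<^sup>2 + m * (\<bar>s\<bar> ^ 3 + s ^ 4) + s\<^sup>2 / 2 * (k * m\<^sup>2)"
    using norm_triangle_mono[OF norm_triangle_mono[OF 1 2] 3] by simp
  also have "\<dots> = 5 / 2 * (s\<^sup>2 * m) * (k * m) + (s\<^sup>2 * m) * \<bar>s\<bar> + (s\<^sup>2 * m) * (s\<^sup>2 * m) / m"
  proof -
    have "\<bar>s\<bar> ^ 3 = s\<^sup>2 * \<bar>s\<bar>" by (simp add: power3_eq_cube power2_eq_square)
    moreover have "m * s ^ 4 = (s\<^sup>2 * m) * (s\<^sup>2 * m) / m"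
      using m by (simp add: power4_eq_xxxx power2_eq_square)
    ultimately show ?thesis by (simp add: algebra_simps power2_eq_square)
  qed
  also have "\<dots> \<le> 5 / 2 * (t\<^sup>2 / v) * (k * m) + (t\<^sup>2 / v) * (\<bar>t\<bar> / (sqrt v * sqrt m))
      + (t\<^sup>2 / v) * (t\<^sup>2 / v) / m"
    using sm s_le k m v(1)
    by (intro add_mono mult_mono divide_right_mono mult_left_mono order_trans[OF _ sm]) auto
  also have "\<dots> = 5 / 2 * (t\<^sup>2 / v) * (k * m) + \<bar>t\<bar> ^ 3 / (v * sqrt v) / sqrt m + t ^ 4 / v\<^sup>2 / m"
    by (simp add: power3_eq_cube power4_eq_xxxx power2_eq_square)
  finally show ?thesis unfolding S_def .
qed

end

section \<open>Transfer to the exponential random graph measure\<close>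

lemma prod_of_bool_eq: "finite S \<Longrightarrow> (\<Prod>a\<in>S. of_bool (P a)) = (of_bool (\<forall>a\<in>S. P a) :: real)"
  by (induction S rule: finite_induct) auto

context ergm_model begin

definition conf :: "nat \<Rightarrow> nat set set \<Rightarrow> config" where
  "conf n A = restrict (\<lambda>e. of_bool (e \<in> A)) (complete_edges n)"

lemma bij_betw_conf: "bij_betw (conf n) (Pow (complete_edges n)) (configs n)"
proof (rule bij_betw_byWitness[where f' = "\<lambda>x. {e \<in> complete_edges n. x e = 1}"])
  show "\<forall>A\<in>Pow (complete_edges n). {e \<in> complete_edges n. conf n A e = 1} = A"
    by (auto simp: conf_def)
  show "\<forall>x\<in>configs n. conf n {e \<in> complete_edges n. x e = 1} = x"
  proof
    fix x assume "x \<in> configs n"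
    then have x: "e \<in> complete_edges n \<Longrightarrow> x e = 0 \<or> x e = 1"
      and ext: "e \<notin> complete_edges n \<Longrightarrow> x e = undefined" for e
      by (auto simp: configs_def PiE_def Pi_def extensional_def)
    show "conf n {e \<in> complete_edges n. x e = 1} = x"
    proof
      fix e show "conf n {e \<in> complete_edges n. x e = 1} e = x e"
        using x[of e] ext[of e] by (cases "e \<in> complete_edges n") (auto simp: conf_def)
    qed
  qed
qed (auto simp: conf_def configs_def)

text \<open>A product of edge indicators is the indicator that the copy lies in the edge set, so
  subgraph counts are sums over hyperedges.\<close>

lemma hamiltonian_conf: "hamiltonian s \<beta> G n (conf n A) = gm.Ham n A"
proof -
  have "gm.Ham n A = (\<Sum>j\<in>copies n. weight n j * of_bool (copy j \<subseteq> A))"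
    by (rule gm.Ham_def)
  also have "\<dots> = (\<Sum>i=1..s. \<Sum>\<psi>\<in>inj_maps (verts (G i)) {1..n}. weight n (i, \<psi>) * of_bool (copy (i, \<psi>) \<subseteq> A))"
    unfolding copies_def by (subst sum.Sigma) (auto simp: finite_inj_maps fin case_prod_beta)
  also have "\<dots> = hamiltonian s \<beta> G n (conf n A)"
    unfolding hamiltonian_def
  proof (rule sum.cong)
    fix i assume i: "i \<in> {1..s}"
    have "subgraph_count (G i) n (conf n A)
        = (\<Sum>\<psi>\<in>inj_maps (verts (G i)) {1..n}. of_bool (copy (i, \<psi>) \<subseteq> A))"
      unfolding subgraph_count_def inj_maps_def[symmetric]
    proof (rule sum.cong)
      fix \<psi> assume \<psi>: "\<psi> \<in> inj_maps (verts (G i)) {1..n}"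
      then have "copy (i, \<psi>) \<subseteq> complete_edges n"
        using i by (intro gm.C_subset) (auto simp: copies_def)
      then have "(\<Prod>a\<in>edges (G i). conf n A (\<psi> ` a)) = (\<Prod>a\<in>edges (G i). of_bool (\<psi> ` a \<in> A))"
        by (intro prod.cong) (auto simp: conf_def copy_def)
      also have "\<dots> = of_bool (copy (i, \<psi>) \<subseteq> A)"
        using fin[OF i] by (simp add: prod_of_bool_eq copy_def image_subset_iff)
      finally show "(\<Prod>a\<in>edges (G i). conf n A (\<psi> ` a)) = of_bool (copy (i, \<psi>) \<subseteq> A)" .
    qed simp
    then show "(\<Sum>\<psi>\<in>inj_maps (verts (G i)) {1..n}. weight n (i, \<psi>) * of_bool (copy (i, \<psi>) \<subseteq> A))
        = \<beta> i * subgraph_count (G i) n (conf n A) / real n powi (int (card (verts (G i))) - 2)"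
      by (simp add: weight_def sum_distrib_left sum_divide_distrib del: sum_of_bool_eq sum_mult_of_bool_eq)
  qed simp
  finally show ?thesis by simp
qed

lemma integral_ergm:
  fixes g :: "config \<Rightarrow> 'b::{banach, second_countable_topology}"
  shows "integral\<^sup>L (ergm s \<beta> G n) g = gm.ex n (\<lambda>A. g (conf n A))"
proof -
  define Z where "Z = (\<Sum>y\<in>configs n. exp (hamiltonian s \<beta> G n y))"
  have Z: "Z = (\<Sum>B\<in>Pow (complete_edges n). exp (gm.Ham n B))"
    unfolding Z_def by (subst sum.reindex_bij_betw[OF bij_betw_conf, symmetric]) (simp add: hamiltonian_conf)
  have "0 \<le> Z" unfolding Z_def by (intro sum_nonneg) auto
  then have "integral\<^sup>L (ergm s \<beta> G n) g = (\<Sum>x\<in>configs n. (exp (hamiltonian s \<beta> G n x) / Z) *\<^sub>R g x)"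
    unfolding ergm_def Z_def[symmetric]
    by (intro lebesgue_integral_point_measure_finite finite_configs) auto
  also have "\<dots> = (\<Sum>A\<in>Pow (complete_edges n). (exp (gm.Ham n A) / Z) *\<^sub>R g (conf n A))"
    by (subst sum.reindex_bij_betw[OF bij_betw_conf, symmetric]) (simp add: hamiltonian_conf)
  also have "\<dots> = gm.ex n (\<lambda>A. g (conf n A))"
    unfolding gm.ex_def gm.pr_def Z ..
  finally show ?thesis .
qed

lemma measurable_ergm: "g \<in> space M \<rightarrow> space M' \<Longrightarrow> M = ergm s \<beta> G n \<Longrightarrow> g \<in> measurable M M'"
  by (simp add: ergm_def space_point_measure)

lemma size_in_conf: "D \<subseteq> complete_edges n \<Longrightarrow> (\<Sum>e\<in>D. conf n A e) = size_in D A"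
  unfolding size_in_def by (intro sum.cong) (auto simp: conf_def)

end

lemma (in gibbs) ex_square_centered: "ex (\<lambda>A. (f A - ex f)\<^sup>2) = cov f f"
proof -
  have "(\<lambda>A. (f A - ex f)\<^sup>2) = (\<lambda>A. (f A * f A - 2 * ex f * f A) + (ex f)\<^sup>2)"
    by (simp add: fun_eq_iff power2_eq_square algebra_simps)
  then have "ex (\<lambda>A. (f A - ex f)\<^sup>2) = ex (\<lambda>A. f A * f A) - 2 * ex f * ex f + (ex f)\<^sup>2"
    by (simp only: ex_add ex_diff ex_cmult ex_const)
  then show ?thesis by (simp add: cov_def power2_eq_square)
qed

theorem theorem2:
  fixes s :: nat and \<beta> :: "nat \<Rightarrow> real" and G :: "nat \<Rightarrow> 'v graph"
    and m :: "nat \<Rightarrow> nat" and I :: "nat \<Rightarrow> nat set set"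
    and \<Omega> :: "nat \<Rightarrow> 'w measure" and X :: "nat \<Rightarrow> 'w \<Rightarrow> config"
  defines "S \<equiv> \<lambda>n \<omega>. \<Sum>e\<in>I n. X n \<omega> e"
  assumes "1 \<le> s"
    and "\<And>i. i \<in> {1..s} \<Longrightarrow> finite_simple_graph (G i)"
    and "\<And>i. i \<in> {1..s} \<Longrightarrow> 0 < \<beta> i"
    and "high_temperature s \<beta> G"
    and "\<And>n. 0 < m n"
    and "filterlim m at_top at_top"
    and "(\<lambda>n. real (m n)) \<in> o(\<lambda>n. real n)"
    and "\<forall>\<^sub>F n in at_top. I n \<subseteq> complete_edges n \<and> card (I n) = m n \<and> pairwise disjnt (I n)"
    and "\<And>n. prob_space (\<Omega> n)"
    and "\<And>n. X n \<in> measurable (\<Omega> n) (ergm s \<beta> G n)"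
    and "\<And>n. distr (\<Omega> n) (ergm s \<beta> G n) (X n) = ergm s \<beta> G n"
  shows "weak_conv_m
    (\<lambda>n. distr (\<Omega> n) borel
      (\<lambda>\<omega>. (S n \<omega> - prob_space.expectation (\<Omega> n) (S n)) / sqrt (prob_space.variance (\<Omega> n) (S n))))
    std_normal_distribution"
proof -
  note m_pos = assms(6) and m_top = assms(7) and m_o = assms(8) and I = assms(9)
    and X = assms(11) and law = assms(12)
  interpret ergm_model s \<beta> G by unfold_locales (rule assms(3) assms(4); assumption)+
  interpret P: prob_space "\<Omega> n" for n by (rule assms(10))
  have meas: "(\<lambda>\<omega>. g (X n \<omega>)) \<in> borel_measurable (\<Omega> n)" for g :: "config \<Rightarrow> 'c::topological_space" and n
    by (rule measurable_compose[OF X measurable_ergm]) auto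
  have law': "(\<integral>\<omega>. g (X n \<omega>) \<partial>\<Omega> n) = gm.ex n (\<lambda>A. g (conf n A))"
    for g :: "config \<Rightarrow> 'c::{banach, second_countable_topology}" and n
  proof -
    have "(\<integral>\<omega>. g (X n \<omega>) \<partial>\<Omega> n) = (\<integral>x. g x \<partial>distr (\<Omega> n) (ergm s \<beta> G n) (X n))"
      by (rule integral_distr[symmetric, OF X measurable_ergm]) auto
    then show ?thesis by (simp only: law integral_ergm)
  qed
  define Y where "Y = (\<lambda>n \<omega>. (S n \<omega> - P.expectation n (S n)) / sqrt (P.variance n (S n)))"
  have Y_meas: "Y n \<in> borel_measurable (\<Omega> n)" for n
    unfolding Y_def S_def
    by (rule meas[of "\<lambda>x. ((\<Sum>e\<in>I n. x e) - a) / b" for a b])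
  \<comment> \<open>Edge probabilities are at least \<open>1/2\<close> and their complements at
    least \<open>1 - Phi (Psi s \<beta> G 1)\<close>; the product bounds all marginal variances from
    below.\<close>
  define v where "v = (1 - Phi (Psi s \<beta> G 1)) / 2"
  have v: "0 < v" using Phi_bounds[of "Psi s \<beta> G 1"] by (simp add: v_def)
  obtain c where c: "0 \<le> c" "\<forall>\<^sub>F n in sequentially. \<forall>e\<in>complete_edges n. \<forall>f\<in>complete_edges n.
      disjnt e f \<longrightarrow> gm.cov n (\<lambda>A. of_bool (e \<in> A)) (\<lambda>A. of_bool (f \<in> A)) \<le> c / real n"
    using cov_disjoint_edges_le[OF assms(5)] by blast
  have "weak_conv_m (\<lambda>n. distr (\<Omega> n) borel (Y n)) std_normal_distribution"
  proof (rule levy_continuity)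
    show "real_distribution (distr (\<Omega> n) borel (Y n))" for n
      by (rule P.real_distribution_distr[OF Y_meas])
    show "real_distribution std_normal_distribution" by (rule real_dist_normal_dist)
    fix t :: real
    \<comment> \<open>The bound of \<open>clt_bound\<close> with \<open>k = c / n\<close>. For fixed
      \<open>t\<close> its terms are of order \<open>m / n\<close>, \<open>1 / sqrt m\<close> and
      \<open>1 / m\<close>, which is where \<open>m = o(n)\<close> and the divergence of
      \<open>m\<close> enter.\<close>
    define err where "err = (\<lambda>n. 5 / 2 * (t\<^sup>2 / v) * (c / real n * real (m n))
        + \<bar>t\<bar> ^ 3 / (v * sqrt v) / sqrt (real (m n)) + t ^ 4 / v\<^sup>2 / real (m n))"
    have "\<forall>\<^sub>F n in sequentially.
      norm (char (distr (\<Omega> n) borel (Y n)) t - char std_normal_distribution t) \<le> err n"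
      using c(2) I
    proof eventually_elim
      case (elim n)
      have sub: "I n \<subseteq> complete_edges n" and card: "card (I n) = m n" and disj: "pairwise disjnt (I n)"
        using elim(2) by auto
      have fin_I: "finite (I n)" by (rule finite_subset[OF sub gm.finite_E])
      have ne: "I n \<noteq> {}" using card m_pos[of n] by auto
      let ?N = "size_in (I n)"
      have ES: "P.expectation n (S n) = gm.ex n ?N"
        unfolding S_def law'[of n "\<lambda>x. \<Sum>e\<in>I n. x e"] by (simp add: size_in_conf[OF sub])
      have VS: "P.variance n (S n) = gm.cov n ?N ?N"
        unfolding ES gm.ex_square_centered[symmetric]
        unfolding S_def law'[of n "\<lambda>x. ((\<Sum>e\<in>I n. x e) - gm.ex n ?N)\<^sup>2"]
        by (simp add: size_in_conf[OF sub])
      have "char (distr (\<Omega> n) borel (Y n)) t = (\<integral>\<omega>. iexp (t * Y n \<omega>) \<partial>\<Omega> n)"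
        unfolding char_def by (intro integral_distr Y_meas) simp
      also have "\<dots> = gm.ex n (\<lambda>A. cis (t * ((?N A - gm.ex n ?N) / sqrt (gm.cov n ?N ?N))))"
        unfolding Y_def VS unfolding ES unfolding S_def
          law'[of n "\<lambda>x. iexp (t * (((\<Sum>e\<in>I n. x e) - gm.ex n ?N) / sqrt (gm.cov n ?N ?N)))"]
        by (simp add: size_in_conf[OF sub] cis_conv_exp)
      finally have char: "char (distr (\<Omega> n) borel (Y n)) t
        = gm.ex n (\<lambda>A. cis (t * ((?N A - gm.ex n ?N) / sqrt (gm.cov n ?N ?N))))" .
      have normal: "char std_normal_distribution t = exp (of_real (- (t\<^sup>2) / 2))"
        unfolding char_std_normal_distribution by (rule exp_of_real[symmetric])
      show ?case
        unfolding char normal err_def card[symmetric]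
      proof (rule gm.clt_bound[OF fin_I ne])
        show "0 \<le> c / real n" using c(1) by simp
        fix e f assume "e \<in> I n" "f \<in> I n" "e \<noteq> f"
        then show "gm.cov n (\<lambda>A. of_bool (e \<in> A)) (\<lambda>A. of_bool (f \<in> A)) \<le> c / real n"
          using elim(1) sub disj by (auto dest: pairwiseD)
      next
        fix e assume "e \<in> I n"
        then have e: "e \<in> complete_edges n" using sub by auto
        let ?q = "gm.ex n (\<lambda>A. of_bool (e \<in> A))"
        have "1 / 2 * (1 - Phi (Psi s \<beta> G 1)) \<le> ?q * (1 - ?q)"
          using edge_probability_bounds[OF e] Phi_bounds[of "Psi s \<beta> G 1"] by (intro mult_mono) auto
        then show "v \<le> ?q * (1 - ?q)" by (simp add: v_def)
      qed (rule v)
    qed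
    moreover have "err \<longlonglongrightarrow> 0"
    proof -
      have top: "filterlim (\<lambda>n. real (m n)) at_top sequentially"
        by (rule filterlim_compose[OF filterlim_real_sequentially m_top])
      have "(\<lambda>n. real (m n) / real n) \<longlonglongrightarrow> 0" by (rule smalloD_tendsto[OF m_o])
      from tendsto_mult_left[OF this, of c] have 1: "(\<lambda>n. c / real n * real (m n)) \<longlonglongrightarrow> 0"
        by simp
      have 2: "(\<lambda>n. \<bar>t\<bar> ^ 3 / (v * sqrt v) / sqrt (real (m n))) \<longlonglongrightarrow> 0"
        by (intro tendsto_divide_0[OF tendsto_const] filterlim_at_top_imp_at_infinity
            filterlim_compose[OF sqrt_at_top top])
      have 3: "(\<lambda>n. t ^ 4 / v\<^sup>2 / real (m n)) \<longlonglongrightarrow> 0"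
        by (intro tendsto_divide_0[OF tendsto_const] filterlim_at_top_imp_at_infinity top)
      from tendsto_add[OF tendsto_add[OF tendsto_mult_right_zero[OF 1, of "5 / 2 * (t\<^sup>2 / v)"] 2] 3]
      show ?thesis by (simp add: err_def)
    qed
    ultimately have "(\<lambda>n. char (distr (\<Omega> n) borel (Y n)) t - char std_normal_distribution t) \<longlonglongrightarrow> 0"
      by (rule Lim_null_comparison)
    then show "(\<lambda>n. char (distr (\<Omega> n) borel (Y n)) t) \<longlonglongrightarrow> char std_normal_distribution t"
      by (rule LIM_zero_cancel)
  qed
  then show ?thesis by (simp add: Y_def)
qed

end
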